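(* Let $X$ be a compact Kähler manifold. If $X$ has a scalar-flat Kähler metric $\omega$, then either $X$ is a Calabi-Yau manifold, or both $K_X$ and $K_X^{-1}$ are RC-positive.
   Context: Complex manifolds are assumed connected. For a smooth Kähler (or Hermitian) metric $\omega$ on $X$, $n=\dim_{\mathbb C}X$, $\mathrm{Ric}(\omega)=-\sqrt{-1}\,\partial\bar\partial\log\omega^n$ and the scalar curvature is $s=\mathrm{tr}_\omega\mathrm{Ric}(\omega)$; $\omega$ is scalar-flat if $s\equiv 0$. A (Kähler) Calabi-Yau manifold means a compact Kähler manifold $X$ with vanishing first Chern class $c_1(X)=0$ in $H^2(X,\mathbb R)$ (equivalently, $K_X$ admits a smooth Hermitian metric with zero curvature). A holomorphic line bundle $\mathscr L$ over $X$ is called RC-positive if it has a smooth Hermitian metric $h$ such that its curvature $-\sqrt{-1}\,\partial\bar\partial\log h$ has at least one positive eigenvalue at every point of $X$. *)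

theory Defs
  imports "HOL-Analysis.Analysis"
begin

section \<open>Calculus on open subsets of complex coordinate space\<close>

text \<open>Real differentiability class on an open set: all iterated directional derivatives exist
  and are continuous.\<close>

primrec Ck_on :: "nat \<Rightarrow> ('v::real_normed_vector \<Rightarrow> 'w::real_normed_vector) \<Rightarrow> 'v set \<Rightarrow> bool" where
  "Ck_on 0 f S \<longleftrightarrow> continuous_on S f"
| "Ck_on (Suc k) f S \<longleftrightarrow>
     (\<forall>x\<in>S. f differentiable (at x)) \<and>
     (\<forall>v. Ck_on k (\<lambda>x. frechet_derivative f (at x) v) S)"

definition smooth_on :: "('v::real_normed_vector \<Rightarrow> 'w::real_normed_vector) \<Rightarrow> 'v set \<Rightarrow> bool" where
  "smooth_on f S \<longleftrightarrow> (\<forall>k. Ck_on k f S)"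

text \<open>Holomorphic functions of several variables on an open set: complex Frechet differentiable
  at every point.\<close>

definition mv_holomorphic_on :: "(complex ^ 'n::finite \<Rightarrow> complex) \<Rightarrow> (complex ^ 'n) set \<Rightarrow> bool" where
  "mv_holomorphic_on f S \<longleftrightarrow>
     (\<forall>z\<in>S. \<exists>D. (f has_derivative D) (at z) \<and> (\<forall>a v. D (a *s v) = a * D v))"

text \<open>The Wirtinger derivatives with respect to \<open>z\<^sub>k\<close> and to its conjugate.\<close>

definition d_z :: "'n \<Rightarrow> (complex ^ 'n::finite \<Rightarrow> complex) \<Rightarrow> complex ^ 'n \<Rightarrow> complex" where
  "d_z k f z = (frechet_derivative f (at z) (axis k 1)
                  - \<i> * frechet_derivative f (at z) (axis k \<i>)) / 2"

definition d_zbar :: "'n \<Rightarrow> (complex ^ 'n::finite \<Rightarrow> complex) \<Rightarrow> complex ^ 'n \<Rightarrow> complex" where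
  "d_zbar k f z = (frechet_derivative f (at z) (axis k 1)
                  + \<i> * frechet_derivative f (at z) (axis k \<i>)) / 2"


section \<open>Complex manifolds\<close>

text \<open>A chart is a pair of its domain and its coordinate map. The values of the coordinate map
  outside the domain are irrelevant. A complex structure is given by an atlas, which need not be
  maximal. The complex dimension is the cardinality of the index type.\<close>

type_synonym ('a, 'n) chart = "'a set \<times> ('a \<Rightarrow> complex ^ 'n)"

definition chart_inv :: "('a, 'n::finite) chart \<Rightarrow> complex ^ 'n \<Rightarrow> 'a" where
  "chart_inv c = inv_into (fst c) (snd c)"

definition is_chart :: "'a topology \<Rightarrow> ('a, 'n::finite) chart \<Rightarrow> bool" where
  "is_chart X c \<longleftrightarrow>
     openin X (fst c) \<and> open (snd c ` fst c) \<and>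
     homeomorphic_map (subtopology X (fst c)) (top_of_set (snd c ` fst c)) (snd c)"

text \<open>\<open>transition c d\<close> expresses the coordinates of \<open>d\<close> in terms of those of \<open>c\<close>.\<close>

definition transition ::
  "('a, 'n::finite) chart \<Rightarrow> ('a, 'n) chart \<Rightarrow> complex ^ 'n \<Rightarrow> complex ^ 'n" where
  "transition c d = snd d \<circ> chart_inv c"

definition complex_manifold :: "'a topology \<Rightarrow> ('a, 'n::finite) chart set \<Rightarrow> bool" where
  "complex_manifold X A \<longleftrightarrow>
     topspace X \<noteq> {} \<and> connected_space X \<and> Hausdorff_space X \<and> second_countable X \<and>
     (\<forall>c\<in>A. is_chart X c) \<and> (\<Union>c\<in>A. fst c) = topspace X \<and>
     (\<forall>c\<in>A. \<forall>d\<in>A. \<forall>k. mv_holomorphic_on (\<lambda>z. transition c d z $ k) (snd c ` (fst c \<inter> fst d)))"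

definition holomorphic_on_manifold ::
  "('a, 'n::finite) chart set \<Rightarrow> ('a \<Rightarrow> complex) \<Rightarrow> 'a set \<Rightarrow> bool" where
  "holomorphic_on_manifold A f U \<longleftrightarrow>
     (\<forall>c\<in>A. mv_holomorphic_on (f \<circ> chart_inv c) (snd c ` (fst c \<inter> U)))"

definition smooth_on_manifold ::
  "('a, 'n::finite) chart set \<Rightarrow> ('a \<Rightarrow> real) \<Rightarrow> 'a set \<Rightarrow> bool" where
  "smooth_on_manifold A f U \<longleftrightarrow>
     (\<forall>c\<in>A. smooth_on (f \<circ> chart_inv c) (snd c ` (fst c \<inter> U)))"

definition d_transition ::
  "('a, 'n::finite) chart \<Rightarrow> ('a, 'n) chart \<Rightarrow> 'a \<Rightarrow> complex ^ 'n \<Rightarrow> complex ^ 'n" where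
  "d_transition c d p = frechet_derivative (transition c d) (at (snd c p))"

text \<open>The holomorphic Jacobian matrix: entry \<open>$ k $ i\<close> is the derivative of the \<open>k\<close>-th coordinate
  of \<open>d\<close> with respect to the \<open>i\<close>-th coordinate of \<open>c\<close>.\<close>

definition jacobian :: "('a, 'n::finite) chart \<Rightarrow> ('a, 'n) chart \<Rightarrow> 'a \<Rightarrow> complex ^ 'n ^ 'n" where
  "jacobian c d p = matrix (d_transition c d p)"


section \<open>Real differential forms and de Rham classes in degree two\<close>

text \<open>Forms are families of local expressions: in the chart \<open>c\<close> and at the point \<open>p\<close>, a tangent
  vector is represented by its coordinate vector in \<open>complex ^ 'n\<close>, regarded as a real vector
  space. Values at points outside the domain of \<open>c\<close> are irrelevant.\<close>

type_synonym ('a, 'n) form1 = "('a, 'n) chart \<Rightarrow> 'a \<Rightarrow> complex ^ 'n \<Rightarrow> real"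
type_synonym ('a, 'n) form2 = "('a, 'n) chart \<Rightarrow> 'a \<Rightarrow> complex ^ 'n \<Rightarrow> complex ^ 'n \<Rightarrow> real"

definition smooth_form1 :: "('a, 'n::finite) chart set \<Rightarrow> ('a, 'n) form1 \<Rightarrow> bool" where
  "smooth_form1 A \<eta> \<longleftrightarrow>
     (\<forall>c\<in>A. (\<forall>p\<in>fst c. linear (\<eta> c p)) \<and>
             (\<forall>v. smooth_on (\<lambda>z. \<eta> c (chart_inv c z) v) (snd c ` fst c))) \<and>
     (\<forall>c\<in>A. \<forall>d\<in>A. \<forall>p\<in>fst c \<inter> fst d. \<forall>v. \<eta> c p v = \<eta> d p (d_transition c d p v))"

definition smooth_form2 :: "('a, 'n::finite) chart set \<Rightarrow> ('a, 'n) form2 \<Rightarrow> bool" where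
  "smooth_form2 A \<theta> \<longleftrightarrow>
     (\<forall>c\<in>A. (\<forall>p\<in>fst c. bilinear (\<theta> c p) \<and> (\<forall>v. \<theta> c p v v = 0)) \<and>
             (\<forall>v w. smooth_on (\<lambda>z. \<theta> c (chart_inv c z) v w) (snd c ` fst c))) \<and>
     (\<forall>c\<in>A. \<forall>d\<in>A. \<forall>p\<in>fst c \<inter> fst d. \<forall>v w.
        \<theta> c p v w = \<theta> d p (d_transition c d p v) (d_transition c d p w))"

definition dir_deriv ::
  "('a, 'n::finite) chart \<Rightarrow> ('a \<Rightarrow> real) \<Rightarrow> 'a \<Rightarrow> complex ^ 'n \<Rightarrow> real" where
  "dir_deriv c f p v = frechet_derivative (f \<circ> chart_inv c) (at (snd c p)) v"

text \<open>Exterior derivatives, evaluated on constant coordinate vector fields (whose Lie brackets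
  vanish).\<close>

definition ext_deriv1 :: "('a, 'n::finite) form1 \<Rightarrow> ('a, 'n) form2" where
  "ext_deriv1 \<eta> c p u v = dir_deriv c (\<lambda>q. \<eta> c q v) p u - dir_deriv c (\<lambda>q. \<eta> c q u) p v"

definition ext_deriv2 ::
  "('a, 'n::finite) form2 \<Rightarrow> ('a, 'n) chart \<Rightarrow> 'a \<Rightarrow>
   complex ^ 'n \<Rightarrow> complex ^ 'n \<Rightarrow> complex ^ 'n \<Rightarrow> real" where
  "ext_deriv2 \<theta> c p u v w =
     dir_deriv c (\<lambda>q. \<theta> c q v w) p u + dir_deriv c (\<lambda>q. \<theta> c q w u) p v
       + dir_deriv c (\<lambda>q. \<theta> c q u v) p w"

definition closed_form2 :: "('a, 'n::finite) chart set \<Rightarrow> ('a, 'n) form2 \<Rightarrow> bool" where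
  "closed_form2 A \<theta> \<longleftrightarrow>
     smooth_form2 A \<theta> \<and> (\<forall>c\<in>A. \<forall>p\<in>fst c. \<forall>u v w. ext_deriv2 \<theta> c p u v w = 0)"

definition cohomologous2 ::
  "('a, 'n::finite) chart set \<Rightarrow> ('a, 'n) form2 \<Rightarrow> ('a, 'n) form2 \<Rightarrow> bool" where
  "cohomologous2 A \<theta> \<theta>' \<longleftrightarrow>
     (\<exists>\<eta>. smooth_form1 A \<eta> \<and>
        (\<forall>c\<in>A. \<forall>p\<in>fst c. \<forall>u v. \<theta> c p u v - \<theta>' c p u v = ext_deriv1 \<eta> c p u v))"

text \<open>The class of \<open>\<theta>\<close> in the second real de Rham cohomology, as a set of closed forms.\<close>

definition deRham_class2 ::
  "('a, 'n::finite) chart set \<Rightarrow> ('a, 'n) form2 \<Rightarrow> ('a, 'n) form2 set" where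
  "deRham_class2 A \<theta> = {\<theta>'. closed_form2 A \<theta>' \<and> cohomologous2 A \<theta>' \<theta>}"


section \<open>Kaehler metrics and scalar curvature\<close>

definition cnj_matrix :: "complex ^ 'n ^ 'n \<Rightarrow> complex ^ 'n ^ 'n" where
  "cnj_matrix M = (\<chi> i j. cnj (M $ i $ j))"

definition hermitian_pos_def :: "complex ^ 'n::finite ^ 'n \<Rightarrow> bool" where
  "hermitian_pos_def M \<longleftrightarrow>
     (\<forall>i j. M $ j $ i = cnj (M $ i $ j)) \<and>
     (\<forall>v. v \<noteq> 0 \<longrightarrow> 0 < Re (\<Sum>i\<in>UNIV. \<Sum>j\<in>UNIV. M $ i $ j * v $ i * cnj (v $ j)))"

text \<open>The real (1,1)-form \<open>\<i> * (\<Sum>i j. M $ i $ j * dz\<^sub>i \<and> cnj dz\<^sub>j)\<close> with Hermitian coefficient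
  matrix \<open>M\<close>, evaluated on two real tangent vectors; the value is real already, \<open>Re\<close> only adjusts
  the type.\<close>

definition form11 :: "complex ^ 'n::finite ^ 'n \<Rightarrow> complex ^ 'n \<Rightarrow> complex ^ 'n \<Rightarrow> real" where
  "form11 M u v =
     Re (\<i> * (\<Sum>i\<in>UNIV. \<Sum>j\<in>UNIV. M $ i $ j * (u $ i * cnj (v $ j) - v $ i * cnj (u $ j))))"

text \<open>A metric is the family of its coefficient matrices: entry \<open>$ i $ j\<close> of \<open>\<omega> c p\<close> is the
  coefficient of \<open>dz\<^sub>i \<otimes> cnj dz\<^sub>j\<close> at \<open>p\<close> in the coordinates of \<open>c\<close>.\<close>

type_synonym ('a, 'n) metric = "('a, 'n) chart \<Rightarrow> 'a \<Rightarrow> complex ^ 'n ^ 'n"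

definition hermitian_metric ::
  "('a, 'n::finite) chart set \<Rightarrow> ('a, 'n) metric \<Rightarrow> bool" where
  "hermitian_metric A \<omega> \<longleftrightarrow>
     (\<forall>c\<in>A. (\<forall>p\<in>fst c. hermitian_pos_def (\<omega> c p)) \<and>
             smooth_on (\<omega> c \<circ> chart_inv c) (snd c ` fst c)) \<and>
     (\<forall>c\<in>A. \<forall>d\<in>A. \<forall>p\<in>fst c \<inter> fst d.
        \<omega> c p = transpose (jacobian c d p) ** \<omega> d p ** cnj_matrix (jacobian c d p))"

definition kaehler_metric ::
  "('a, 'n::finite) chart set \<Rightarrow> ('a, 'n) metric \<Rightarrow> bool" where
  "kaehler_metric A \<omega> \<longleftrightarrow>
     hermitian_metric A \<omega> \<and> closed_form2 A (\<lambda>c p. form11 (\<omega> c p))"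

definition compact_kaehler_manifold ::
  "'a topology \<Rightarrow> ('a, 'n::finite) chart set \<Rightarrow> bool" where
  "compact_kaehler_manifold X A \<longleftrightarrow>
     complex_manifold X A \<and> compact_space X \<and> (\<exists>\<omega>. kaehler_metric A \<omega>)"

text \<open>Coefficient matrix of \<open>\<i>\<partial>\<partial>bar f\<close> at \<open>p\<close> in the coordinates of \<open>c\<close>.\<close>

definition ddbar :: "('a, 'n::finite) chart \<Rightarrow> ('a \<Rightarrow> real) \<Rightarrow> 'a \<Rightarrow> complex ^ 'n ^ 'n" where
  "ddbar c f p =
     (\<chi> i j. d_z i (d_zbar j (\<lambda>z. complex_of_real (f (chart_inv c z)))) (snd c p))"

text \<open>Coefficient matrix of \<open>Ric(\<omega>)\<close>. The density of the top power of \<open>\<omega>\<close> in the coordinates of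
  \<open>c\<close> is a constant multiple of the determinant of \<open>\<omega> c\<close>, which is real because \<open>\<omega> c p\<close> is
  Hermitian.\<close>

definition ricci :: "('a, 'n::finite) metric \<Rightarrow> ('a, 'n) chart \<Rightarrow> 'a \<Rightarrow> complex ^ 'n ^ 'n" where
  "ricci \<omega> c p = - ddbar c (\<lambda>q. ln (Re (det (\<omega> c q)))) p"

definition scalar_curvature :: "('a, 'n::finite) metric \<Rightarrow> ('a, 'n) chart \<Rightarrow> 'a \<Rightarrow> complex" where
  "scalar_curvature \<omega> c p = trace (matrix_inv (\<omega> c p) ** ricci \<omega> c p)"

definition scalar_flat :: "('a, 'n::finite) chart set \<Rightarrow> ('a, 'n) metric \<Rightarrow> bool" where
  "scalar_flat A \<omega> \<longleftrightarrow> (\<forall>c\<in>A. \<forall>p\<in>fst c. scalar_curvature \<omega> c p = 0)"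


section \<open>Holomorphic line bundles\<close>

text \<open>A line bundle is given by local frames \<open>e\<^sub>i\<close> over open sets \<open>lb_dom L i\<close> and the transition
  functions defined by \<open>e\<^sub>j = lb_trans L i j * e\<^sub>i\<close>.\<close>

record ('i, 'a) line_bundle =
  lb_index :: "'i set"
  lb_dom :: "'i \<Rightarrow> 'a set"
  lb_trans :: "'i \<Rightarrow> 'i \<Rightarrow> 'a \<Rightarrow> complex"

definition holomorphic_line_bundle ::
  "'a topology \<Rightarrow> ('a, 'n::finite) chart set \<Rightarrow> ('i, 'a) line_bundle \<Rightarrow> bool" where
  "holomorphic_line_bundle X A L \<longleftrightarrow>
     (\<forall>i\<in>lb_index L. openin X (lb_dom L i)) \<and>
     (\<Union>i\<in>lb_index L. lb_dom L i) = topspace X \<and>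
     (\<forall>i\<in>lb_index L. \<forall>j\<in>lb_index L.
        holomorphic_on_manifold A (lb_trans L i j) (lb_dom L i \<inter> lb_dom L j) \<and>
        (\<forall>p\<in>lb_dom L i \<inter> lb_dom L j. lb_trans L i j p \<noteq> 0)) \<and>
     (\<forall>i\<in>lb_index L. \<forall>p\<in>lb_dom L i. lb_trans L i i p = 1) \<and>
     (\<forall>i\<in>lb_index L. \<forall>j\<in>lb_index L. \<forall>k\<in>lb_index L.
        \<forall>p\<in>lb_dom L i \<inter> lb_dom L j \<inter> lb_dom L k.
          lb_trans L i k p = lb_trans L i j p * lb_trans L j k p)"

definition dual_bundle :: "('i, 'a) line_bundle \<Rightarrow> ('i, 'a) line_bundle" where
  "dual_bundle L =
     \<lparr>lb_index = lb_index L, lb_dom = lb_dom L, lb_trans = (\<lambda>i j p. inverse (lb_trans L i j p))\<rparr>"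

text \<open>\<open>K\<^sub>X\<close>, with the frame \<open>dz\<^sub>1 \<and> \<dots> \<and> dz\<^sub>n\<close> over each chart.\<close>

definition canonical_bundle ::
  "('a, 'n::finite) chart set \<Rightarrow> (('a, 'n) chart, 'a) line_bundle" where
  "canonical_bundle A =
     \<lparr>lb_index = A, lb_dom = fst, lb_trans = (\<lambda>c d p. det (jacobian c d p))\<rparr>"

text \<open>A Hermitian metric is given by the squared norms \<open>h i\<close> of the local frames.\<close>

definition line_metric ::
  "('a, 'n::finite) chart set \<Rightarrow> ('i, 'a) line_bundle \<Rightarrow> ('i \<Rightarrow> 'a \<Rightarrow> real) \<Rightarrow> bool" where
  "line_metric A L h \<longleftrightarrow>
     (\<forall>i\<in>lb_index L. (\<forall>p\<in>lb_dom L i. h i p > 0) \<and> smooth_on_manifold A (h i) (lb_dom L i)) \<and>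
     (\<forall>i\<in>lb_index L. \<forall>j\<in>lb_index L. \<forall>p\<in>lb_dom L i \<inter> lb_dom L j.
        h j p = (cmod (lb_trans L i j p))\<^sup>2 * h i p)"

text \<open>Coefficient matrix of the curvature \<open>-\<i>\<partial>\<partial>bar log h\<close>, computed with the frame \<open>i\<close> in the
  coordinates of \<open>c\<close>; it does not depend on \<open>i\<close>.\<close>

definition line_curvature ::
  "('i \<Rightarrow> 'a \<Rightarrow> real) \<Rightarrow> 'i \<Rightarrow> ('a, 'n::finite) chart \<Rightarrow> 'a \<Rightarrow> complex ^ 'n ^ 'n" where
  "line_curvature h i c p = - ddbar c (\<lambda>q. ln (h i q)) p"

definition has_positive_eigenvalue :: "complex ^ 'n::finite ^ 'n \<Rightarrow> bool" where
  "has_positive_eigenvalue M \<longleftrightarrow>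
     (\<exists>l::real. l > 0 \<and> (\<exists>v. v \<noteq> 0 \<and> M *v v = complex_of_real l *s v))"

text \<open>By Sylvester's law of inertia the number of positive eigenvalues of the Hermitian coefficient
  matrix does not depend on the chart around \<open>p\<close>.\<close>

definition RC_positive ::
  "'a topology \<Rightarrow> ('a, 'n::finite) chart set \<Rightarrow> ('i, 'a) line_bundle \<Rightarrow> bool" where
  "RC_positive X A L \<longleftrightarrow>
     holomorphic_line_bundle X A L \<and>
     (\<exists>h. line_metric A L h \<and>
        (\<forall>c\<in>A. \<forall>i\<in>lb_index L. \<forall>p\<in>fst c \<inter> lb_dom L i.
           has_positive_eigenvalue (line_curvature h i c p)))"


section \<open>The first Chern class and Calabi-Yau manifolds\<close>

definition is_curvature_form ::
  "('a, 'n::finite) chart set \<Rightarrow> ('i, 'a) line_bundle \<Rightarrow> ('i \<Rightarrow> 'a \<Rightarrow> real) \<Rightarrow>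
   ('a, 'n) form2 \<Rightarrow> bool" where
  "is_curvature_form A L h \<theta> \<longleftrightarrow>
     (\<forall>c\<in>A. \<forall>i\<in>lb_index L. \<forall>p\<in>fst c \<inter> lb_dom L i. \<theta> c p = form11 (line_curvature h i c p))"

text \<open>The real first Chern class of a line bundle via Chern-Weil theory: the de Rham class of the
  curvature form divided by \<open>2\<pi>\<close>. This class is the same for all metrics \<open>h\<close>, so the union
  merges copies of a single class.\<close>

definition line_chern_class ::
  "('a, 'n::finite) chart set \<Rightarrow> ('i, 'a) line_bundle \<Rightarrow> ('a, 'n) form2 set" where
  "line_chern_class A L =
     \<Union> {deRham_class2 A (\<lambda>c p u v. \<theta> c p u v / (2 * pi)) | h \<theta>.
           line_metric A L h \<and> is_curvature_form A L h \<theta>}"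

text \<open>\<open>c\<^sub>1(X)\<close> is the first Chern class of the anticanonical bundle, the determinant of the
  holomorphic tangent bundle.\<close>

definition first_chern_class ::
  "('a, 'n::finite) chart set \<Rightarrow> ('a, 'n) form2 set" where
  "first_chern_class A = line_chern_class A (dual_bundle (canonical_bundle A))"

definition calabi_yau_manifold ::
  "'a topology \<Rightarrow> ('a, 'n::finite) chart set \<Rightarrow> bool" where
  "calabi_yau_manifold X A \<longleftrightarrow>
     compact_kaehler_manifold X A \<and>
     first_chern_class A = deRham_class2 A (\<lambda>c p u v. 0)"

end

theory Submission
  imports Defs "HOL-Complex_Analysis.Cauchy_Integral_Formula"
begin

text \<open>The metric \<open>det \<omega>\<close> on the anticanonical bundle has curvature \<open>Ric(\<omega>)\<close>, and \<open>exp (- f) * det \<omega>\<close>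
  has curvature \<open>Ric(\<omega>) + \<i>\<partial>\<partial>bar f\<close>. If \<open>Ric(\<omega>)\<close> vanishes identically, every metric on the
  anticanonical bundle is \<open>exp (- f) * det \<omega>\<close> for a global function \<open>f\<close>, so its curvature is exact.
  Otherwise \<open>Ric(\<omega>)\<close> is non-zero and trace-free at some point, and therefore has eigenvalues of both signs on
  a small ball \<open>V\<close> around it. There is a smooth \<open>f\<close> with \<open>tr\<^sub>\<omega> (\<i>\<partial>\<partial>bar f) > 0\<close> off \<open>V\<close>. For small
  \<open>\<epsilon> > 0\<close> the forms \<open>\<plusminus> Ric(\<omega>) + \<epsilon> \<i>\<partial>\<partial>bar f\<close>, which are curvatures of the anticanonical and the canonical
  bundle, have a positive direction on \<open>V\<close> by continuity, and positive trace off \<open>V\<close> because \<open>Ric(\<omega>)\<close> is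
  trace-free. The function \<open>f\<close> is a finite sum of bumps of the form
  \<open>exp (- \<beta> / (R\<^sup>2 - |z|\<^sup>2))\<close>: for large \<open>\<beta>\<close> such a bump is subharmonic off a
  prescribed smaller ball, and connectedness propagates the region of positivity from \<open>V\<close> to the
  whole manifold.\<close>

section \<open>Functions of class \<open>C\<^sup>k\<close> on open sets\<close>

text \<open>On a compact manifold the maximum principle forbids a function whose Laplacian is
  positive everywhere, so an exceptional set \<open>V\<close> is unavoidable. It is harmless because
  on \<open>V\<close> the form \<open>Ric(\<omega>)\<close> itself supplies positive directions for
  either sign. Off \<open>V\<close> only an inequality is needed, and therefore sums of explicit
  bumps can stand in for the solution of an elliptic equation. The choices depend on each other in
  one order: two test vectors and \<open>V\<close> come from \<open>Ric(\<omega>)\<close>, then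
  \<open>f\<close> from \<open>V\<close>, then \<epsilon> from \<open>f\<close>. The analytic
  preparation is forced by the definitions. Transition maps are assumed complex differentiable only
  pointwise, so their smoothness has to be extracted from Cauchy's formula; and the invariance of
  curvature and Laplacian under a change of chart rests on the second derivative of a holomorphic
  map being complex bilinear, a type of form that the Levi form does not see.\<close>

abbreviation fderiv :: "('v::real_normed_vector \<Rightarrow> 'w::real_normed_vector) \<Rightarrow> 'v \<Rightarrow> 'v \<Rightarrow> 'w"
  where "fderiv f x \<equiv> frechet_derivative f (at x)"

lemma has_derivative_imp_fderiv: "(f has_derivative D) (at x) \<Longrightarrow> fderiv f x = D"
  using frechet_derivative_at by metis

lemma differentiable_fderiv: "f differentiable (at x) \<Longrightarrow> (f has_derivative fderiv f x) (at x)"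
  using frechet_derivative_works by blast

lemma fderiv_cong:
  assumes "open S" "x \<in> S" "\<And>y. y \<in> S \<Longrightarrow> f y = g y"
  shows "fderiv f x = fderiv g x"
proof -
  have "(f has_derivative D) (at x) = (g has_derivative D) (at x)" for D
    using has_derivative_transform_within_open[OF _ assms(1,2), of f D UNIV g]
      has_derivative_transform_within_open[OF _ assms(1,2), of g D UNIV f] assms(3) by auto
  then show ?thesis unfolding frechet_derivative_def by simp
qed

lemma differentiable_cong_open:
  assumes "open S" "x \<in> S" "\<And>y. y \<in> S \<Longrightarrow> f y = g y" "f differentiable (at x)"
  shows "g differentiable (at x)"
  using assms has_derivative_transform_within_open[OF _ assms(1,2), of f _ UNIV g]
  unfolding differentiable_def by blast

lemma Ck_on_cong:
  assumes "open S" "\<And>x. x \<in> S \<Longrightarrow> f x = g x"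
  shows "Ck_on k f S \<longleftrightarrow> Ck_on k g S"
proof -
  have "Ck_on k f S \<Longrightarrow> Ck_on k g S" if "\<And>x. x \<in> S \<Longrightarrow> f x = g x" for f g :: "'a \<Rightarrow> 'b"
    using that
  proof (induction k arbitrary: f g)
    case 0
    then show ?case using continuous_on_cong by (metis Ck_on.simps(1))
  next
    case (Suc k)
    have "fderiv f x = fderiv g x" if "x \<in> S" for x
      using fderiv_cong[OF assms(1) that] Suc.prems(2) by blast
    then have "Ck_on k (\<lambda>x. fderiv g x v) S" for v
      using Suc.IH[of "\<lambda>x. fderiv f x v" "\<lambda>x. fderiv g x v"] Suc.prems(1) by simp
    then show ?case using Suc.prems differentiable_cong_open[OF assms(1)]
      by (metis Ck_on.simps(2))
  qed
  then show ?thesis using assms(2) by metis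
qed

lemma Ck_on_Suc_D:
  assumes "Ck_on (Suc k) f S"
  shows "Ck_on k f S"
  using assms
proof (induction k arbitrary: f)
  case 0
  then show ?case
    by (auto intro!: differentiable_imp_continuous_on simp: differentiable_on_def differentiable_at_withinI)
next
  case (Suc k)
  then show ?case by simp
qed

lemma Ck_on_subset: "Ck_on k f S \<Longrightarrow> T \<subseteq> S \<Longrightarrow> Ck_on k f T"
  by (induction k arbitrary: f) (auto intro: continuous_on_subset)

lemma Ck_on_differentiable: "Ck_on (Suc k) f S \<Longrightarrow> x \<in> S \<Longrightarrow> f differentiable (at x)"
  by simp

lemma Ck_on_fderiv: "Ck_on (Suc k) f S \<Longrightarrow> Ck_on k (\<lambda>x. fderiv f x v) S"
  by simp

text \<open>Inductions over \<open>Ck_on\<close> run through this rule: a derivative given by a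
  formula replaces \<open>frechet_derivative\<close>. Openness of \<open>S\<close> is what makes the
  two interchangeable under further differentiation.\<close>

lemma Ck_on_SucI:
  assumes "open S" "\<And>x. x \<in> S \<Longrightarrow> (f has_derivative D x) (at x)" "\<And>v. Ck_on k (\<lambda>x. D x v) S"
  shows "Ck_on (Suc k) f S"
proof -
  have "fderiv f x v = D x v" if "x \<in> S" for x v
    using has_derivative_imp_fderiv[OF assms(2)[OF that]] by simp
  then have "Ck_on k (\<lambda>x. fderiv f x v) S" for v
    using Ck_on_cong[OF assms(1), of "\<lambda>x. fderiv f x v" "\<lambda>x. D x v"] assms(3) by simp
  then show ?thesis using assms(2) by (auto simp: differentiable_def)
qed

lemma Ck_on_Un: "open S \<Longrightarrow> open T \<Longrightarrow> Ck_on k f S \<Longrightarrow> Ck_on k f T \<Longrightarrow> Ck_on k f (S \<union> T)"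
  by (induction k arbitrary: f) (auto intro: continuous_on_open_Un)

lemma Ck_on_const [intro]: "open S \<Longrightarrow> Ck_on k (\<lambda>x. c) S"
proof (induction k arbitrary: c)
  case (Suc k)
  then show ?case by (intro Ck_on_SucI[where D = "\<lambda>_ _. 0"]) auto
qed auto

lemma Ck_on_bounded_linear:
  assumes "bounded_linear L" "open S" "Ck_on k f S"
  shows "Ck_on k (\<lambda>x. L (f x)) S"
  using assms(3)
proof (induction k arbitrary: f)
  case 0
  then show ?case using assms(1) by (auto intro: bounded_linear.continuous_on)
next
  case (Suc k)
  show ?case
  proof (rule Ck_on_SucI[OF assms(2), where D = "\<lambda>x v. L (fderiv f x v)"])
    show "((\<lambda>x. L (f x)) has_derivative (\<lambda>v. L (fderiv f x v))) (at x)" if "x \<in> S" for x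
      using Suc.prems that assms(1)
      by (auto intro!: bounded_linear.has_derivative[where f = L] differentiable_fderiv)
  qed (use Suc in auto)
qed

lemma Ck_on_linear:
  assumes "bounded_linear L" "open S"
  shows "Ck_on k L S"
proof (cases k)
  case 0
  then show ?thesis using assms(1) by (auto simp: linear_continuous_on)
next
  case (Suc j)
  show ?thesis unfolding Suc
    by (rule Ck_on_SucI[OF assms(2), where D = "\<lambda>x v. L v"])
      (use assms bounded_linear_imp_has_derivative in auto)
qed

lemma Ck_on_ident [intro]: "open S \<Longrightarrow> Ck_on k (\<lambda>x. x) S"
  by (rule Ck_on_linear) (auto simp: bounded_linear_ident)

lemma Ck_on_add:
  assumes "open S" "Ck_on k f S" "Ck_on k g S"
  shows "Ck_on k (\<lambda>x. f x + g x) S"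
  using assms(2,3)
proof (induction k arbitrary: f g)
  case 0
  then show ?case by (auto intro: continuous_on_add)
next
  case (Suc k)
  show ?case
  proof (rule Ck_on_SucI[OF assms(1), where D = "\<lambda>x v. fderiv f x v + fderiv g x v"])
    show "((\<lambda>x. f x + g x) has_derivative (\<lambda>v. fderiv f x v + fderiv g x v)) (at x)" if "x \<in> S" for x
      using Suc.prems that by (auto intro!: has_derivative_add differentiable_fderiv)
  qed (use Suc in auto)
qed

lemma Ck_on_sum:
  assumes "open S" "\<And>i. i \<in> I \<Longrightarrow> Ck_on k (f i) S"
  shows "Ck_on k (\<lambda>x. \<Sum>i\<in>I. f i x) S"
  using assms(2)
  by (induction I rule: infinite_finite_induct) (auto intro!: Ck_on_add assms(1))

lemma Ck_on_bilinear:
  assumes "bounded_bilinear B" "open S" "Ck_on k f S" "Ck_on k g S"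
  shows "Ck_on k (\<lambda>x. B (f x) (g x)) S"
  using assms(3,4)
proof (induction k arbitrary: f g)
  case 0
  then show ?case using bounded_bilinear.continuous_on[OF assms(1)] by auto
next
  case (Suc k)
  show ?case
  proof (rule Ck_on_SucI[OF assms(2), where D = "\<lambda>x v. B (f x) (fderiv g x v) + B (fderiv f x v) (g x)"])
    show "((\<lambda>x. B (f x) (g x)) has_derivative
        (\<lambda>v. B (f x) (fderiv g x v) + B (fderiv f x v) (g x))) (at x)" if "x \<in> S" for x
      using Suc.prems that
      by (auto intro!: bounded_bilinear.FDERIV[OF assms(1)] differentiable_fderiv)
    show "Ck_on k (\<lambda>x. B (f x) (fderiv g x v) + B (fderiv f x v) (g x)) S" for v
      using Suc.prems Ck_on_Suc_D[OF Suc.prems(1)] Ck_on_Suc_D[OF Suc.prems(2)]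
      by (intro Ck_on_add Suc.IH assms(2)) (auto)
  qed
qed

lemma Ck_on_mult:
  fixes f g :: "'v::real_normed_vector \<Rightarrow> 'a::real_normed_algebra"
  shows "open S \<Longrightarrow> Ck_on k f S \<Longrightarrow> Ck_on k g S \<Longrightarrow> Ck_on k (\<lambda>x. f x * g x) S"
  by (rule Ck_on_bilinear[OF bounded_bilinear_mult])

lemma Ck_on_prod:
  fixes f :: "'i \<Rightarrow> 'v::real_normed_vector \<Rightarrow> 'a::real_normed_field"
  assumes "open S" "\<And>i. i \<in> I \<Longrightarrow> Ck_on k (f i) S"
  shows "Ck_on k (\<lambda>x. \<Prod>i\<in>I. f i x) S"
  using assms(2)
  by (induction I rule: infinite_finite_induct) (auto intro!: Ck_on_mult assms(1))

lemma Ck_on_uminus: "open S \<Longrightarrow> Ck_on k f S \<Longrightarrow> Ck_on k (\<lambda>x. - f x) S"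
  by (rule Ck_on_bounded_linear[of uminus]) (auto simp: bounded_linear_minus bounded_linear_ident)

lemma Ck_on_diff: "open S \<Longrightarrow> Ck_on k f S \<Longrightarrow> Ck_on k g S \<Longrightarrow> Ck_on k (\<lambda>x. f x - g x) S"
  using Ck_on_add[of S k f "\<lambda>x. - g x"] Ck_on_uminus by auto

lemma Ck_on_componentwise:
  fixes f :: "'v::real_normed_vector \<Rightarrow> 'w::euclidean_space"
  assumes "open S" "\<And>b. b \<in> Basis \<Longrightarrow> Ck_on k (\<lambda>x. f x \<bullet> b) S"
  shows "Ck_on k f S"
proof -
  have "Ck_on k (\<lambda>x. \<Sum>b\<in>Basis. (f x \<bullet> b) *\<^sub>R b) S"
    by (intro Ck_on_sum assms(1) Ck_on_bilinear[OF bounded_bilinear_scaleR] assms Ck_on_const)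
  then show ?thesis by (simp add: euclidean_representation)
qed

lemma Ck_on_vec:
  fixes f :: "'v::real_normed_vector \<Rightarrow> 'w::euclidean_space ^ 'n"
  assumes "open S" "\<And>i. Ck_on k (\<lambda>x. f x $ i) S"
  shows "Ck_on k f S"
proof (rule Ck_on_componentwise[OF assms(1)])
  fix b :: "'w ^ 'n" assume "b \<in> Basis"
  then obtain u i where b: "b = axis i u" by (auto simp: Basis_vec_def)
  show "Ck_on k (\<lambda>x. f x \<bullet> b) S"
    unfolding b inner_axis
    by (rule Ck_on_bounded_linear[of "\<lambda>y. y \<bullet> u", OF _ assms(1) assms(2)])
      (simp add: bounded_linear_inner_left)
qed

lemma Ck_on_vec_nth: "open S \<Longrightarrow> Ck_on k f S \<Longrightarrow> Ck_on k (\<lambda>x. f x $ i) S"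
  by (rule Ck_on_bounded_linear[of "\<lambda>y. y $ i"]) (auto simp: bounded_linear_vec_nth)

lemma linear_Basis_sum:
  fixes L :: "'w::euclidean_space \<Rightarrow> 'u::real_vector"
  assumes "linear L"
  shows "L v = (\<Sum>b\<in>Basis. (v \<bullet> b) *\<^sub>R L b)"
proof -
  have "L v = L (\<Sum>b\<in>Basis. (v \<bullet> b) *\<^sub>R b)" by (simp add: euclidean_representation)
  also have "\<dots> = (\<Sum>b\<in>Basis. (v \<bullet> b) *\<^sub>R L b)"
    by (simp add: linear_sum[OF assms] linear_cmul[OF assms])
  finally show ?thesis .
qed

lemma Ck_on_compose:
  fixes f :: "'v::real_normed_vector \<Rightarrow> 'w::euclidean_space"
  assumes "open S" "open T" "f ` S \<subseteq> T" "Ck_on k g T" "Ck_on k f S"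
  shows "Ck_on k (\<lambda>x. g (f x)) S"
  using assms(4,5)
proof (induction k arbitrary: g)
  case 0
  then show ?case using assms(3) by (auto intro: continuous_on_compose2)
next
  case (Suc k)
  have f: "Ck_on k f S" using Ck_on_Suc_D[OF Suc.prems(2)] .
  show ?case
  proof (rule Ck_on_SucI[OF assms(1), where D = "\<lambda>x v. fderiv g (f x) (fderiv f x v)"])
    show "((\<lambda>x. g (f x)) has_derivative (\<lambda>v. fderiv g (f x) (fderiv f x v))) (at x)"
      if "x \<in> S" for x
      using Suc.prems that assms(3)
      by (intro has_derivative_compose[of f _ x UNIV g] differentiable_fderiv) auto
    show "Ck_on k (\<lambda>x. fderiv g (f x) (fderiv f x v)) S" for v
    proof -
      \<comment> \<open>The induction hypothesis treats \<open>fderiv g\<close> in a fixed direction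
        only, while \<open>fderiv f x v\<close> varies with \<open>x\<close>. Expansion in the basis
        moves the variation into scalar coefficients.\<close>
      have eq: "fderiv g (f x) (fderiv f x v) = (\<Sum>b\<in>Basis. (fderiv f x v \<bullet> b) *\<^sub>R fderiv g (f x) b)"
        if "x \<in> S" for x
        using Suc.prems that assms(3)
        by (intro linear_Basis_sum linear_frechet_derivative) auto
      have smooth: "Ck_on k (\<lambda>x. \<Sum>b\<in>Basis. (fderiv f x v \<bullet> b) *\<^sub>R fderiv g (f x) b) S"
      proof (intro Ck_on_sum assms(1) Ck_on_bilinear[OF bounded_bilinear_scaleR])
        show "Ck_on k (\<lambda>x. fderiv g (f x) b) S" for b
          by (rule Suc.IH[OF Ck_on_fderiv[OF Suc.prems(1)] f])
        show "Ck_on k (\<lambda>x. fderiv f x v \<bullet> b) S" for b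
          by (rule Ck_on_bounded_linear[OF bounded_linear_inner_left assms(1) Ck_on_fderiv[OF Suc.prems(2)]])
      qed
      have "Ck_on k (\<lambda>x. fderiv g (f x) (fderiv f x v)) S \<longleftrightarrow>
          Ck_on k (\<lambda>x. \<Sum>b\<in>Basis. (fderiv f x v \<bullet> b) *\<^sub>R fderiv g (f x) b) S"
        by (rule Ck_on_cong[OF assms(1)]) (rule eq)
      then show ?thesis using smooth by (rule iffD2)
    qed
  qed
qed

lemma Ck_on_real_compose:
  fixes F :: "real \<Rightarrow> real"
  assumes "open S" "open T" "\<And>x. x \<in> S \<Longrightarrow> f x \<in> T" "Ck_on k F T" "Ck_on k f S"
  shows "Ck_on k (\<lambda>x. F (f x)) S"
  by (rule Ck_on_compose[OF assms(1,2) _ assms(4,5)]) (use assms(3) in auto)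

section \<open>Functions of one real variable, and determinants\<close>

lemma Ck_on_realI:
  fixes F :: "real \<Rightarrow> real"
  assumes "open S" "\<And>x. x \<in> S \<Longrightarrow> (F has_real_derivative F' x) (at x)" "Ck_on k F' S"
  shows "Ck_on (Suc k) F S"
proof (rule Ck_on_SucI[OF assms(1), where D = "\<lambda>x v. F' x * v"])
  show "(F has_derivative (*) (F' x)) (at x)" if "x \<in> S" for x
    using assms(2)[OF that] by (simp add: has_field_derivative_def)
qed (use assms in \<open>auto intro: Ck_on_mult\<close>)

lemma Ck_on_exp: "Ck_on k (exp :: real \<Rightarrow> real) UNIV"
proof (induction k)
  case (Suc k)
  show ?case by (rule Ck_on_realI[OF _ _ Suc]) (auto intro!: derivative_eq_intros)
qed (auto intro!: continuous_intros)

lemma Ck_on_inverse: "Ck_on k (inverse :: real \<Rightarrow> real) (- {0})"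
proof (induction k)
  case (Suc k)
  show ?case
  proof (rule Ck_on_realI)
    show "(inverse has_real_derivative - (inverse x * inverse x)) (at x)" if "x \<in> - {0}" for x :: real
      using that by (auto intro!: derivative_eq_intros simp: power2_eq_square)
  qed (auto intro!: Ck_on_uminus Ck_on_mult Suc)
qed (auto intro!: continuous_intros)

lemma Ck_on_ln: "Ck_on k (ln :: real \<Rightarrow> real) {0<..}"
proof (cases k)
  case (Suc j)
  show ?thesis unfolding Suc
  proof (rule Ck_on_realI)
    show "Ck_on j inverse {0::real<..}" by (rule Ck_on_subset[OF Ck_on_inverse]) auto
    show "(ln has_real_derivative inverse x) (at x)" if "x \<in> {0<..}" for x :: real
      using that by (auto intro!: DERIV_ln)
  qed auto
qed (auto intro!: continuous_intros)

lemma Ck_on_det: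
  fixes M :: "'v::real_normed_vector \<Rightarrow> complex ^ 'n ^ 'n"
  assumes "open S" "Ck_on k M S"
  shows "Ck_on k (\<lambda>x. det (M x)) S"
  unfolding det_def
  by (intro Ck_on_sum Ck_on_mult Ck_on_prod Ck_on_const Ck_on_vec_nth assms)

text \<open>The powers of \<open>1 / t\<close> make the family closed under differentiation.\<close>

definition flat :: "nat \<Rightarrow> real \<Rightarrow> real" where
  "flat m t = (if t > 0 then exp (- 1 / t) / t ^ m else 0)"

text \<open>With \<open>x = 1 / t\<close> this is the decay of \<open>x ^ m / exp x\<close> at
  infinity.\<close>

lemma flat_tendsto: "((\<lambda>t. exp (- 1 / t) / t ^ m) \<longlongrightarrow> 0) (at_right (0::real))"
proof -
  have "((\<lambda>x. x ^ m / exp x) \<longlongrightarrow> 0) (at_top :: real filter)"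
    by (rule tendsto_power_div_exp_0)
  then have "((\<lambda>t. inverse t ^ m / exp (inverse t)) \<longlongrightarrow> 0) (at_right (0::real))"
    by (rule filterlim_compose[OF _ filterlim_inverse_at_top_right])
  then show ?thesis
    by (simp add: exp_minus field_simps)
qed

lemma flat_has_derivative:
  "(flat m has_real_derivative (flat (m + 2) t - m * flat (m + 1) t)) (at t)"
proof -
  consider "t < 0" | "t = 0" | "t > 0" by linarith
  then show ?thesis
  proof cases
    case 1
    have "((\<lambda>_. 0) has_real_derivative 0) (at t)" by simp
    then have "(flat m has_real_derivative 0) (at t)"
      by (rule has_field_derivative_transform_within_open[where S = "{..<0}"]) (use 1 in \<open>auto simp: flat_def\<close>)
    then show ?thesis using 1 by (simp add: flat_def)
  next
    case 3
    have "((\<lambda>t. exp (- 1 / t) / t ^ m) has_real_derivative (flat (m + 2) t - m * flat (m + 1) t)) (at t)"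
    proof -
      have "((\<lambda>t. exp (- 1 / t) / t ^ m) has_real_derivative
          ((exp (- 1 / t) * (1 / t ^ 2)) * t ^ m - exp (- 1 / t) * (m * t ^ (m - 1))) / (t ^ m * t ^ m)) (at t)"
        using 3 by (auto intro!: derivative_eq_intros simp: power2_eq_square)
      moreover have "((exp (- 1 / t) * (1 / t ^ 2)) * t ^ m - exp (- 1 / t) * (m * t ^ (m - 1))) / (t ^ m * t ^ m)
        = flat (m + 2) t - m * flat (m + 1) t"
        using 3 by (cases m) (auto simp: flat_def divide_simps power2_eq_square algebra_simps)
      ultimately show ?thesis by simp
    qed
    then show ?thesis
      by (rule has_field_derivative_transform_within_open[where S = "{0<..}"]) (use 3 in \<open>auto simp: flat_def\<close>)
  next
    case 2
    have "((\<lambda>h. (flat m (0 + h) - flat m 0) / h) \<longlongrightarrow> 0) (at_right 0)"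
    \<comment> \<open>The right difference quotient at 0 is again a member of the family, its
      exponent raised by the division by \<open>h\<close>.\<close>
    proof (rule Lim_transform_eventually[OF flat_tendsto[of "Suc m"]])
      show "\<forall>\<^sub>F h in at_right 0. exp (- 1 / h) / h ^ Suc m = (flat m (0 + h) - flat m 0) / h"
        by (auto simp: eventually_at_filter flat_def)
    qed
    moreover have "((\<lambda>h. (flat m (0 + h) - flat m 0) / h) \<longlongrightarrow> 0) (at_left 0)"
      by (rule tendsto_eventually) (auto simp: eventually_at_filter flat_def)
    ultimately have "((\<lambda>h. (flat m (0 + h) - flat m 0) / h) \<longlongrightarrow> 0) (at 0)"
      using filterlim_at_split by blast
    then have "(flat m has_real_derivative 0) (at 0)" by (simp add: DERIV_def)
    then show ?thesis using 2 by (simp add: flat_def)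
  qed
qed

lemma Ck_on_flat: "Ck_on k (flat m) UNIV"
proof (induction k arbitrary: m)
  case 0
  show ?case
    using DERIV_isCont[OF flat_has_derivative[of m]] by (auto intro!: continuous_at_imp_continuous_on)
next
  case (Suc k)
  show ?case
    by (rule Ck_on_realI[OF _ flat_has_derivative])
      (auto intro!: Ck_on_diff Ck_on_mult Suc Ck_on_const)
qed

section \<open>Second derivatives\<close>

definition hess :: "('v::real_normed_vector \<Rightarrow> 'w::real_normed_vector) \<Rightarrow> 'v \<Rightarrow> 'v \<Rightarrow> 'v \<Rightarrow> 'w" where
  "hess f z a b = fderiv (\<lambda>y. fderiv f y b) z a"

lemma hess_cong:
  assumes "open S" "z \<in> S" "\<And>y. y \<in> S \<Longrightarrow> f y = g y"
  shows "hess f z a b = hess g z a b"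
  unfolding hess_def
  using fderiv_cong[OF assms(1,2), of "\<lambda>y. fderiv f y b" "\<lambda>y. fderiv g y b"]
    fderiv_cong[OF assms(1) _ assms(3)] by simp

lemma fderiv_linear: "f differentiable (at x) \<Longrightarrow> linear (fderiv f x)"
  by (rule linear_frechet_derivative)

lemma hess_bilinear:
  assumes "Ck_on 2 f S" "open S" "z \<in> S"
  shows "bilinear (hess f z)"
proof -
  have d: "y \<in> S \<Longrightarrow> f differentiable (at y)" for y
    using assms(1) by (auto simp: numeral_2_eq_2)
  have dd: "(\<lambda>y. fderiv f y b) differentiable (at z)" for b
    using assms(1,3) by (auto simp: numeral_2_eq_2)
  have "linear (\<lambda>b. hess f z a b)" for a
  proof (rule linearI)
    fix b c :: 'a and r :: real
    have "fderiv f y (b + c) = fderiv f y b + fderiv f y c" if "y \<in> S" for y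
      using linear_add[OF fderiv_linear[OF d[OF that]]] .
    then have "fderiv (\<lambda>y. fderiv f y (b + c)) z = fderiv (\<lambda>y. fderiv f y b + fderiv f y c) z"
      by (intro fderiv_cong[OF assms(2,3)])
    also have "\<dots> = (\<lambda>a. hess f z a b + hess f z a c)"
      unfolding hess_def
      by (intro has_derivative_imp_fderiv has_derivative_add differentiable_fderiv dd)
    finally show "hess f z a (b + c) = hess f z a b + hess f z a c"
      by (simp add: hess_def)
    have "fderiv f y (r *\<^sub>R b) = r *\<^sub>R fderiv f y b" if "y \<in> S" for y
      using linear_cmul[OF fderiv_linear[OF d[OF that]]] .
    then have "fderiv (\<lambda>y. fderiv f y (r *\<^sub>R b)) z = fderiv (\<lambda>y. r *\<^sub>R fderiv f y b) z"
      by (intro fderiv_cong[OF assms(2,3)])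
    also have "\<dots> = (\<lambda>a. r *\<^sub>R hess f z a b)"
      unfolding hess_def
      by (intro has_derivative_imp_fderiv has_derivative_scaleR_right differentiable_fderiv dd)
    finally show "hess f z a (r *\<^sub>R b) = r *\<^sub>R hess f z a b"
      by (simp add: hess_def)
  qed
  moreover have "linear (\<lambda>a. hess f z a b)" for b
    unfolding hess_def by (rule fderiv_linear[OF dd])
  ultimately show ?thesis by (simp add: bilinear_def)
qed

lemma hess_continuous: "Ck_on 2 f S \<Longrightarrow> continuous_on S (\<lambda>z. hess f z a b)"
  by (simp add: numeral_2_eq_2 hess_def)

text \<open>Two applications of the mean value theorem: to the difference \<open>\<phi>\<close>
  along \<open>a\<close>, then to the derivative \<open>\<psi>\<close> along \<open>b\<close>. The
  second difference is symmetric in \<open>a\<close> and \<open>b\<close>, which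
  \<open>hess_sym\<close> exploits.\<close>

lemma second_difference:
  fixes f :: "'v::real_normed_vector \<Rightarrow> real"
  assumes "Ck_on 2 f S" "h > 0"
    and seg: "\<And>s t. 0 \<le> s \<Longrightarrow> s \<le> h \<Longrightarrow> 0 \<le> t \<Longrightarrow> t \<le> h \<Longrightarrow> z + s *\<^sub>R a + t *\<^sub>R b \<in> S"
  shows "\<exists>s t. 0 \<le> s \<and> s \<le> h \<and> 0 \<le> t \<and> t \<le> h \<and>
    f (z + h *\<^sub>R a + h *\<^sub>R b) - f (z + h *\<^sub>R a) - f (z + h *\<^sub>R b) + f z =
      h * h * hess f (z + s *\<^sub>R a + t *\<^sub>R b) b a"
proof -
  let ?w = "\<lambda>s t. z + s *\<^sub>R a + t *\<^sub>R b"
  have d: "y \<in> S \<Longrightarrow> (f has_derivative fderiv f y) (at y)" for y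
    using assms(1) by (auto simp: numeral_2_eq_2 intro: differentiable_fderiv)
  have dd: "y \<in> S \<Longrightarrow> ((\<lambda>y. fderiv f y a) has_derivative (\<lambda>b. hess f y b a)) (at y)" for y
    using assms(1) unfolding hess_def by (auto simp: numeral_2_eq_2 intro: differentiable_fderiv)
  define \<phi> where "\<phi> s = f (?w s h) - f (z + s *\<^sub>R a)" for s
  have D\<phi>: "(\<phi> has_derivative (\<lambda>r. fderiv f (?w s h) (r *\<^sub>R a) - fderiv f (z + s *\<^sub>R a) (r *\<^sub>R a))) (at s)"
    if "0 \<le> s" "s \<le> h" for s
    unfolding \<phi>_def
  proof (rule has_derivative_diff)
    show "((\<lambda>s. f (?w s h)) has_derivative
        (\<lambda>r. fderiv f (?w s h) (r *\<^sub>R a))) (at s)"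
      using that assms(2)
      by (intro has_derivative_compose[of "\<lambda>s. ?w s h" _ _ _ f] d seg)
        (auto intro!: derivative_eq_intros)
    have "z + s *\<^sub>R a \<in> S" using seg[of s 0] that assms(2) by simp
    then show "((\<lambda>s. f (z + s *\<^sub>R a)) has_derivative (\<lambda>r. fderiv f (z + s *\<^sub>R a) (r *\<^sub>R a))) (at s)"
      by (intro has_derivative_compose[of "\<lambda>s. z + s *\<^sub>R a" _ _ _ f] d)
        (auto intro!: derivative_eq_intros)
  qed
  have "\<exists>s\<in>{0<..<h}. \<phi> h - \<phi> 0 = fderiv f (?w s h) ((h - 0) *\<^sub>R a) - fderiv f (z + s *\<^sub>R a) ((h - 0) *\<^sub>R a)"
    using mvt_simple[OF assms(2), of \<phi> "\<lambda>s r. fderiv f (?w s h) (r *\<^sub>R a) - fderiv f (z + s *\<^sub>R a) (r *\<^sub>R a)"]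
      D\<phi> by (force intro: has_derivative_at_withinI)
  then obtain s where s: "0 < s" "s < h"
    and eq1: "\<phi> h - \<phi> 0 = fderiv f (?w s h) (h *\<^sub>R a) - fderiv f (z + s *\<^sub>R a) (h *\<^sub>R a)"
    by auto
  define \<psi> where "\<psi> t = fderiv f (?w s t) a" for t
  have D\<psi>: "(\<psi> has_derivative (\<lambda>r. hess f (?w s t) (r *\<^sub>R b) a)) (at t)"
    if "0 \<le> t" "t \<le> h" for t
    unfolding \<psi>_def
    using s that
    by (intro has_derivative_compose[of "?w s" _ _ _ "\<lambda>y. fderiv f y a"] dd seg)
      (auto intro!: derivative_eq_intros)
  have "\<exists>t\<in>{0<..<h}. \<psi> h - \<psi> 0 = hess f (?w s t) ((h - 0) *\<^sub>R b) a"
    using mvt_simple[OF assms(2), of \<psi> "\<lambda>t r. hess f (?w s t) (r *\<^sub>R b) a"]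
      D\<psi> by (force intro: has_derivative_at_withinI)
  then obtain t where t: "0 < t" "t < h"
    and eq2: "\<psi> h - \<psi> 0 = hess f (?w s t) (h *\<^sub>R b) a" by auto
  have in1: "?w s t \<in> S" "?w s h \<in> S" "z + s *\<^sub>R a \<in> S"
    using seg[of s t] seg[of s h] seg[of s 0] s t assms(2) by auto
  have "hess f (?w s t) (h *\<^sub>R b) a = h * hess f (?w s t) b a"
    using linear_cmul[OF has_derivative_linear[OF dd[OF in1(1)]], of h b] by simp
  moreover have "fderiv f (?w s h) (h *\<^sub>R a) = h * fderiv f (?w s h) a"
    "fderiv f (z + s *\<^sub>R a) (h *\<^sub>R a) = h * fderiv f (z + s *\<^sub>R a) a"
    using linear_cmul[OF has_derivative_linear[OF d[OF in1(2)]], of h a]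
      linear_cmul[OF has_derivative_linear[OF d[OF in1(3)]], of h a] by auto
  ultimately have "\<phi> h - \<phi> 0 = h * h * hess f (?w s t) b a"
    using eq1 eq2 unfolding \<psi>_def by (simp add: algebra_simps)
  then show ?thesis
    unfolding \<phi>_def using s t by (intro exI[of _ s] exI[of _ t]) (auto simp: algebra_simps)
qed

text \<open>Schwarz's theorem. Exchanging \<open>a\<close> and \<open>b\<close> does not change the
  second difference, so the two mixed derivatives take a common value at points arbitrarily close to
  \<open>z\<close>; continuity then forces them to agree at \<open>z\<close>.\<close>

lemma hess_sym:
  fixes f :: "'v::real_normed_vector \<Rightarrow> real"
  assumes "Ck_on 2 f S" "open S" "z \<in> S"
  shows "hess f z a b = hess f z b a"
proof (rule ccontr)
  let ?w = "\<lambda>s t. z + s *\<^sub>R a + t *\<^sub>R b" and ?w' = "\<lambda>s t. z + s *\<^sub>R b + t *\<^sub>R a"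
  assume ne: "hess f z a b \<noteq> hess f z b a"
  define e where "e = \<bar>hess f z a b - hess f z b a\<bar> / 2"
  have "e > 0" using ne by (simp add: e_def)
  have cont: "isCont (\<lambda>y. hess f y a b) z" "isCont (\<lambda>y. hess f y b a) z"
    using hess_continuous[OF assms(1)] assms(2,3) continuous_on_eq_continuous_at by blast+
  obtain d1 where d1: "d1 > 0" "\<And>y. dist y z < d1 \<Longrightarrow> \<bar>hess f y a b - hess f z a b\<bar> < e"
    using cont(1) \<open>e > 0\<close> unfolding continuous_at_eps_delta by (metis dist_real_def)
  obtain d2 where d2: "d2 > 0" "\<And>y. dist y z < d2 \<Longrightarrow> \<bar>hess f y b a - hess f z b a\<bar> < e"
    using cont(2) \<open>e > 0\<close> unfolding continuous_at_eps_delta by (metis dist_real_def)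
  obtain d3 where d3: "d3 > 0" "ball z d3 \<subseteq> S" using assms(2,3) open_contains_ball by blast
  define d where "d = min d1 (min d2 d3)"
  \<comment> \<open>The summand 1 keeps \<open>N\<close> positive for \<open>a = b = 0\<close>; with
    \<open>h = d / (2 * N)\<close> the whole parallelogram stays within distance
    \<open>d / 2\<close> of \<open>z\<close>.\<close>
  define N where "N = norm a + norm b + 1"
  have N: "N > 0" by (simp add: N_def add_nonneg_pos)
  define h where "h = d / (2 * N)"
  let ?D = "f (z + h *\<^sub>R a + h *\<^sub>R b) - f (z + h *\<^sub>R a) - f (z + h *\<^sub>R b) + f z"
  let ?D' = "f (z + h *\<^sub>R b + h *\<^sub>R a) - f (z + h *\<^sub>R b) - f (z + h *\<^sub>R a) + f z"
  have h: "h > 0" using d1 d2 d3 N by (auto simp: h_def d_def)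
  have small: "dist (?w s t) z < d" if "0 \<le> s" "s \<le> h" "0 \<le> t" "t \<le> h" for s t
  proof -
    have "dist (?w s t) z = norm (s *\<^sub>R a + t *\<^sub>R b)"
      by (simp add: dist_norm add.assoc)
    also have "\<dots> \<le> s * norm a + t * norm b" using that norm_triangle_ineq[of "s *\<^sub>R a" "t *\<^sub>R b"] by simp
    also have "\<dots> \<le> h * norm a + h * norm b" using that by (intro add_mono mult_right_mono) auto
    also have "\<dots> \<le> h * N" using h by (simp add: N_def algebra_simps)
    also have "\<dots> = d / 2" using N unfolding h_def by simp
    also have "\<dots> < d" using d1(1) d2(1) d3(1) unfolding d_def by linarith
    finally show ?thesis .
  qed
  have inS: "?w s t \<in> S" if "0 \<le> s" "s \<le> h" "0 \<le> t" "t \<le> h" for s t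
    using small[OF that] d3(2) by (auto simp: d_def dist_commute)
  obtain s t where st: "0 \<le> s" "s \<le> h" "0 \<le> t" "t \<le> h"
    and eq1: "?D =
      h * h * hess f (?w s t) b a"
    using second_difference[OF assms(1) h, of z a b] inS by blast
  have inS': "?w' s t \<in> S" if "0 \<le> s" "s \<le> h" "0 \<le> t" "t \<le> h" for s t
    using inS[of t s] that by (simp add: algebra_simps)
  obtain s' t' where st': "0 \<le> s'" "s' \<le> h" "0 \<le> t'" "t' \<le> h"
    and eq2: "?D' =
      h * h * hess f (?w' s' t') a b"
    using second_difference[OF assms(1) h, of z b a] inS' by blast
  have "?D' =
    ?D"
    by (simp add: algebra_simps)
  then have "h * h * hess f (?w s t) b a = h * h * hess f (?w' s' t') a b"
    using eq1 eq2 by linarith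
  then have eq: "hess f (?w s t) b a = hess f (?w' s' t') a b"
    using h by simp
  have "\<bar>hess f (?w s t) b a - hess f z b a\<bar> < e"
    using d2(2) small[OF st] by (simp add: d_def)
  moreover have "\<bar>hess f (?w' s' t') a b - hess f z a b\<bar> < e"
    using d1(2) small[of t' s'] st' by (simp add: d_def algebra_simps)
  ultimately have "\<bar>hess f z a b - hess f z b a\<bar> < 2 * e" using eq by linarith
  then show False by (simp add: e_def)
qed

lemma fderiv_compose:
  assumes "f differentiable (at z)" "u differentiable (at (f z))"
  shows "fderiv (\<lambda>y. u (f y)) z = (\<lambda>v. fderiv u (f z) (fderiv f z v))"
  by (intro has_derivative_imp_fderiv has_derivative_compose[of f _ z UNIV u] differentiable_fderiv assms)

text \<open>Second-order chain rule. The inner derivative is expanded in the basis, as in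
  \<open>Ck_on_compose\<close>, because its direction depends on the point; the product rule then
  yields the two sums \<open>?S1\<close> and \<open>?S2\<close>.\<close>

lemma hess_compose:
  fixes f :: "'v::real_normed_vector \<Rightarrow> 'w::euclidean_space" and u :: "'w \<Rightarrow> 'u::real_normed_vector"
  assumes "open S" "open T" "f ` S \<subseteq> T" "Ck_on 2 u T" "Ck_on 2 f S" "z \<in> S"
  shows "hess (\<lambda>y. u (f y)) z a b =
    hess u (f z) (fderiv f z a) (fderiv f z b) + fderiv u (f z) (hess f z a b)"
proof -
  let ?S1 = "\<Sum>c\<in>Basis. (fderiv f z b \<bullet> c) *\<^sub>R hess u (f z) (fderiv f z a) c"
  let ?S2 = "\<Sum>c\<in>Basis. (hess f z a b \<bullet> c) *\<^sub>R fderiv u (f z) c"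
  have fd: "y \<in> S \<Longrightarrow> f differentiable (at y)" for y
    using assms(5) by (auto simp: numeral_2_eq_2)
  have ud: "y \<in> S \<Longrightarrow> u differentiable (at (f y))" for y
    using assms(3,4) by (auto simp: numeral_2_eq_2)
  have fdd: "(\<lambda>y. fderiv f y b) differentiable (at z)"
    using assms(5,6) by (auto simp: numeral_2_eq_2)
  have udd: "(\<lambda>w. fderiv u w c) differentiable (at (f z))" for c
    using assms(3,4,6) by (auto simp: numeral_2_eq_2)
  have "fderiv (\<lambda>y. fderiv (\<lambda>y. u (f y)) y b) z =
      fderiv (\<lambda>y. \<Sum>c\<in>Basis. (fderiv f y b \<bullet> c) *\<^sub>R fderiv u (f y) c) z"
  proof (rule fderiv_cong[OF assms(1,6)])
    fix y assume y: "y \<in> S"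
    show "fderiv (\<lambda>y. u (f y)) y b = (\<Sum>c\<in>Basis. (fderiv f y b \<bullet> c) *\<^sub>R fderiv u (f y) c)"
      unfolding fderiv_compose[OF fd[OF y] ud[OF y]] by (rule linear_Basis_sum[OF fderiv_linear[OF ud[OF y]]])
  qed
  also have "\<dots> = (\<lambda>a. \<Sum>c\<in>Basis. (fderiv f z b \<bullet> c) *\<^sub>R hess u (f z) (fderiv f z a) c
      + (hess f z a b \<bullet> c) *\<^sub>R fderiv u (f z) c)"
  proof (rule has_derivative_imp_fderiv, rule has_derivative_sum, rule has_derivative_scaleR)
    fix c :: 'w
    show "((\<lambda>y. fderiv f y b \<bullet> c) has_derivative (\<lambda>a. hess f z a b \<bullet> c)) (at z)"
      unfolding hess_def by (rule has_derivative_inner_left[OF differentiable_fderiv[OF fdd]])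
    show "((\<lambda>y. fderiv u (f y) c) has_derivative (\<lambda>a. hess u (f z) (fderiv f z a) c)) (at z)"
      unfolding hess_def
      by (rule has_derivative_compose[OF differentiable_fderiv[OF fd[OF assms(6)]] differentiable_fderiv[OF udd]])
  qed
  finally have eq: "hess (\<lambda>y. u (f y)) z a b = ?S1 + ?S2"
    by (simp add: hess_def sum.distrib)
  have eq1: "hess u (f z) (fderiv f z a) (fderiv f z b) = ?S1"
  proof (rule linear_Basis_sum)
    have "f z \<in> T" using assms(3,6) by blast
    then show "linear (hess u (f z) (fderiv f z a))"
      using hess_bilinear[OF assms(4,2)] unfolding bilinear_def by blast
  qed
  have eq2: "fderiv u (f z) (hess f z a b) = ?S2"
    by (rule linear_Basis_sum[OF fderiv_linear[OF ud[OF assms(6)]]])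
  show ?thesis by (rule trans[OF eq arg_cong2[where f = "(+)", OF eq1[symmetric] eq2[symmetric]]])
qed

section \<open>Holomorphic functions of several variables\<close>

lemma bounded_linear_scalar_left: "bounded_linear (\<lambda>a::complex. a *s (v :: complex ^ 'n::finite))"
  unfolding linear_conv_bounded_linear[symmetric]
  by (rule linearI) (simp_all add: vec_eq_iff algebra_simps)

lemma bounded_linear_scalar_right: "bounded_linear (\<lambda>v :: complex ^ 'n::finite. (a::complex) *s v)"
  unfolding linear_conv_bounded_linear[symmetric]
  by (rule linearI) (simp_all add: vec_eq_iff algebra_simps)

lemma norm_scalar_vec: "norm (a *s v) = cmod a * norm (v :: complex ^ 'n::finite)"
  by (simp add: norm_vec_def norm_mult L2_set_right_distrib)

lemma scaleR_eq_scalar: "r *\<^sub>R v = complex_of_real r *s (v :: complex ^ 'n::finite)"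
  by (simp add: vec_eq_iff complex_eq_iff)

lemma mv_holomorphicD:
  assumes "mv_holomorphic_on f S" "z \<in> S"
  shows "(f has_derivative fderiv f z) (at z)" "fderiv f z (a *s v) = a * fderiv f z v"
proof -
  obtain D where D: "(f has_derivative D) (at z)" "\<forall>a v. D (a *s v) = a * D v"
    using assms unfolding mv_holomorphic_on_def by blast
  have "fderiv f z = D" using has_derivative_imp_fderiv[OF D(1)] .
  then show "(f has_derivative fderiv f z) (at z)" "fderiv f z (a *s v) = a * fderiv f z v"
    using D by auto
qed

lemma mv_holomorphic_continuous: "mv_holomorphic_on f S \<Longrightarrow> continuous_on S f"
  by (meson mv_holomorphicD(1) has_derivative_continuous continuous_at_imp_continuous_on)

text \<open>Restriction to a complex line reduces several variables to one, where Cauchy's theory is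
  available.\<close>

lemma mv_holomorphic_slice:
  assumes "mv_holomorphic_on f S" "z + \<zeta> *s v \<in> S"
  shows "((\<lambda>\<zeta>. f (z + \<zeta> *s v)) has_field_derivative fderiv f (z + \<zeta> *s v) v) (at \<zeta>)"
proof -
  have "((\<lambda>\<zeta>. z + \<zeta> *s v) has_derivative (\<lambda>a. a *s v)) (at \<zeta>)"
    using bounded_linear_imp_has_derivative[OF bounded_linear_scalar_left]
    by (auto intro!: derivative_eq_intros)
  from has_derivative_compose[OF this mv_holomorphicD(1)[OF assms]]
  have "((\<lambda>\<zeta>. f (z + \<zeta> *s v)) has_derivative (\<lambda>a. fderiv f (z + \<zeta> *s v) (a *s v))) (at \<zeta>)" .
  moreover have "(\<lambda>a. fderiv f (z + \<zeta> *s v) (a *s v)) = (*) (fderiv f (z + \<zeta> *s v) v)"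
    by (simp add: mv_holomorphicD(2)[OF assms] fun_eq_iff)
  ultimately show ?thesis by (simp add: has_field_derivative_def)
qed

abbreviation circ :: "real \<Rightarrow> real \<Rightarrow> complex" where
  "circ \<rho> t \<equiv> complex_of_real \<rho> * exp (2 * complex_of_real pi * \<i> * complex_of_real t)"

lemma norm_circ: "\<rho> > 0 \<Longrightarrow> cmod (circ \<rho> t) = \<rho>"
  by (simp add: norm_mult)

text \<open>Cauchy's formula for the derivative of the slice at 0, with the circle parametrised. The
  right side contains only values of \<open>f\<close>, so regularity in \<open>z\<close> can be read
  off from the integral.\<close>

lemma mv_holomorphic_Cauchy:
  assumes "mv_holomorphic_on f S" "\<rho> > 0" "\<And>\<zeta>. cmod \<zeta> \<le> \<rho> \<Longrightarrow> z + \<zeta> *s v \<in> S"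
  shows "fderiv f z v = integral {0..1} (\<lambda>t. f (z + circ \<rho> t *s v) / circ \<rho> t)"
proof -
  define g where "g \<zeta> = f (z + \<zeta> *s v)" for \<zeta>
  have g': "(g has_field_derivative fderiv f (z + \<zeta> *s v) v) (at \<zeta>)" if "cmod \<zeta> \<le> \<rho>" for \<zeta>
    unfolding g_def using mv_holomorphic_slice[OF assms(1) assms(3)[OF that]] .
  have hol: "g holomorphic_on ball 0 \<rho>"
  proof (rule holomorphic_onI)
    fix x :: complex assume "x \<in> ball 0 \<rho>"
    then have "cmod x \<le> \<rho>" by simp
    from has_field_derivative_at_within[OF g'[OF this]]
    show "g field_differentiable at x within ball 0 \<rho>" unfolding field_differentiable_def by blast
  qed
  have cont: "continuous_on (cball 0 \<rho>) g"
    by (rule continuous_at_imp_continuous_on, rule ballI, rule DERIV_isCont[OF g']) simp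
  have "fderiv f z v = deriv g 0"
    using DERIV_imp_deriv[OF g'[of 0]] assms(2) by simp
  also have "\<dots> = 1 / (2 * pi * \<i>) * contour_integral (circlepath 0 \<rho>) (\<lambda>u. g u / u\<^sup>2)"
    using Cauchy_higher_derivative_integral_circlepath(2)[OF cont hol, of 0 1] assms(2)
    by (simp add: numeral_2_eq_2)
  \<comment> \<open>Along the circle \<open>du = 2 \<pi> \<i> u dt\<close>, so one of the two powers
    of \<open>u\<close> cancels and the constant in front disappears.\<close>
  also have "contour_integral (circlepath 0 \<rho>) (\<lambda>u. g u / u\<^sup>2) =
      integral {0..1} (\<lambda>t. 2 * pi * \<i> * (g (circ \<rho> t) / circ \<rho> t))"
    unfolding contour_integral_integral
  proof (rule integral_cong)
    fix t :: real
    have "circlepath 0 \<rho> t = circ \<rho> t" by (simp add: circlepath)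
    moreover have "circ \<rho> t \<noteq> 0" using assms(2) by simp
    ultimately show "g (circlepath 0 \<rho> t) / (circlepath 0 \<rho> t)\<^sup>2 * vector_derivative (circlepath 0 \<rho>) (at t) =
        2 * pi * \<i> * (g (circ \<rho> t) / circ \<rho> t)"
      by (simp add: vector_derivative_circlepath power2_eq_square divide_simps)
  qed
  also have "1 / (2 * pi * \<i>) * integral {0..1} (\<lambda>t. 2 * pi * \<i> * (g (circ \<rho> t) / circ \<rho> t))
      = integral {0..1} (\<lambda>t. g (circ \<rho> t) / circ \<rho> t)"
    by (subst integral_mult_right) simp
  finally show ?thesis by (simp add: g_def)
qed

text \<open>One radius has to work for all \<open>z\<close> near \<open>z0\<close>, so that the
  circle in Cauchy's formula stays fixed while \<open>z\<close> varies.\<close>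

lemma circle_room:
  fixes z0 v :: "complex ^ 'n::finite"
  assumes "open S" "z0 \<in> S"
  obtains \<rho> e where "\<rho> > 0" "e > 0" "ball z0 e \<subseteq> S"
    "\<And>z \<zeta>. z \<in> ball z0 e \<Longrightarrow> cmod \<zeta> \<le> \<rho> \<Longrightarrow> z + \<zeta> *s v \<in> S"
proof -
  obtain e where e: "e > 0" "ball z0 e \<subseteq> S" using assms open_contains_ball by blast
  define \<rho> where "\<rho> = e / (2 * (norm v + 1))"
  have nv: "norm v + 1 > 0" by (simp add: add_nonneg_pos)
  have \<rho>: "\<rho> > 0" unfolding \<rho>_def using e nv by simp
  have "z + \<zeta> *s v \<in> S" if "z \<in> ball z0 (e/2)" "cmod \<zeta> \<le> \<rho>" for z \<zeta>
  proof -
    have "norm (\<zeta> *s v) \<le> \<rho> * norm v" using that(2) by (simp add: norm_scalar_vec mult_right_mono)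
    also have "\<dots> \<le> \<rho> * (norm v + 1)" using \<rho> by simp
    also have "\<dots> = e / 2" using nv unfolding \<rho>_def by (simp add: field_simps)
    finally have "norm (\<zeta> *s v) \<le> e / 2" .
    moreover have "norm (z0 - z) < e / 2" using that(1) by (simp add: dist_norm)
    moreover have "norm (z0 - (z + \<zeta> *s v)) \<le> norm (z0 - z) + norm (\<zeta> *s v)"
      using norm_triangle_ineq4[of "z0 - z" "\<zeta> *s v"] by (simp add: algebra_simps)
    ultimately have "dist z0 (z + \<zeta> *s v) < e"
      unfolding dist_norm by linarith
    then show ?thesis using e(2) by auto
  qed
  moreover have "ball z0 (e/2) \<subseteq> S" using e by auto
  ultimately show ?thesis using that[of \<rho> "e/2"] \<rho> e by auto
qed

lemma continuous_circ_arg: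
  assumes "continuous_on S h" "\<And>z t. z \<in> U \<Longrightarrow> z + circ \<rho> t *s v \<in> S" "\<rho> > 0"
  shows "continuous_on (U \<times> cbox 0 1) (\<lambda>(z, t). h (z + circ \<rho> t *s v) / circ \<rho> t)"
proof -
  have "continuous_on (U \<times> cbox 0 1) (\<lambda>p. fst p + circ \<rho> (snd p) *s v)"
    by (intro continuous_intros bounded_linear.continuous_on[OF bounded_linear_scalar_left])
  then have "continuous_on (U \<times> cbox 0 1) (\<lambda>p. h (fst p + circ \<rho> (snd p) *s v))"
    using assms(2) by (intro continuous_on_compose2[OF assms(1)]) auto
  then show ?thesis using assms(3)
    by (auto simp: case_prod_unfold intro!: continuous_intros)
qed

text \<open>In Cauchy's formula the integrand is jointly continuous in \<open>z\<close> and
  \<open>t\<close> as soon as \<open>f\<close> is continuous, and an integral over a compact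
  interval inherits continuity in the parameter.\<close>

lemma mv_holomorphic_continuous_fderiv:
  assumes "mv_holomorphic_on f S" "open S"
  shows "continuous_on S (\<lambda>z. fderiv f z v)"
proof (rule continuous_at_imp_continuous_on, rule ballI)
  fix z0 assume "z0 \<in> S"
  then obtain \<rho> e where r: "\<rho> > 0" "e > 0" "ball z0 e \<subseteq> S"
    "\<And>z \<zeta>. z \<in> ball z0 e \<Longrightarrow> cmod \<zeta> \<le> \<rho> \<Longrightarrow> z + \<zeta> *s v \<in> S"
    using circle_room[OF assms(2)] by metis
  have in_S: "z + circ \<rho> t *s v \<in> S" if "z \<in> ball z0 e" for z t
    using r(4)[OF that] norm_circ[OF r(1)] by simp
  have "continuous_on (ball z0 e) (\<lambda>z. integral (cbox 0 1) (\<lambda>t. f (z + circ \<rho> t *s v) / circ \<rho> t))"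
    by (intro integral_continuous_on_param continuous_circ_arg[OF mv_holomorphic_continuous[OF assms(1)]] in_S r(1))
  then have "continuous_on (ball z0 e) (\<lambda>z. fderiv f z v)"
    by (rule iffD1[OF continuous_on_cong, rotated -1])
      (use mv_holomorphic_Cauchy[OF assms(1) r(1,4)] in auto)
  then show "isCont (\<lambda>z. fderiv f z v) z0"
    using r(2) by (simp add: continuous_on_eq_continuous_at)
qed

text \<open>A holomorphic function is only assumed to be pointwise differentiable. Differentiating Cauchy's
  formula under the integral sign needs continuous first derivatives, which Cauchy's formula itself
  provides by \<open>mv_holomorphic_continuous_fderiv\<close>.\<close>

theorem mv_holomorphic_fderiv:
  assumes "mv_holomorphic_on f S" "open S"
  shows "mv_holomorphic_on (\<lambda>z. fderiv f z v) S"
  unfolding mv_holomorphic_on_def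
proof
  fix z0 assume z0: "z0 \<in> S"
  then obtain \<rho> e where r: "\<rho> > 0" "e > 0" "ball z0 e \<subseteq> S"
    "\<And>z \<zeta>. z \<in> ball z0 e \<Longrightarrow> cmod \<zeta> \<le> \<rho> \<Longrightarrow> z + \<zeta> *s v \<in> S"
    using circle_room[OF assms(2)] by metis
  have in_S: "z + circ \<rho> t *s v \<in> S" if "z \<in> ball z0 e" for z t
    using r(4)[OF that] norm_circ[OF r(1)] by simp
  \<comment> \<open>Differentiation under the integral takes the derivative of the integrand as a
    bounded linear map; its continuity in \<open>z\<close> and \<open>t\<close> may be checked for
    one direction \<open>w\<close> at a time.\<close>
  define fx where "fx z t = Blinfun (\<lambda>w. fderiv f (z + circ \<rho> t *s v) w / circ \<rho> t)" for z t
  have blin: "bounded_linear (\<lambda>w. fderiv f (z + circ \<rho> t *s v) w / circ \<rho> t)"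
    if "z \<in> ball z0 e" for z t
    by (intro bounded_linear_divide[THEN bounded_linear_compose]
        has_derivative_bounded_linear[OF mv_holomorphicD(1)[OF assms(1)]] in_S that)
  have fx: "blinfun_apply (fx z t) = (\<lambda>w. fderiv f (z + circ \<rho> t *s v) w / circ \<rho> t)"
    if "z \<in> ball z0 e" for z t
    unfolding fx_def using bounded_linear_Blinfun_apply[OF blin[OF that]] .
  have cont: "continuous_on (ball z0 e \<times> cbox 0 1) (\<lambda>(z, t). fx z t)"
  proof (rule continuous_on_blinfun_componentwise)
    fix w :: "complex ^ 'a"
    have "continuous_on (ball z0 e \<times> cbox 0 1)
        (\<lambda>(z, t). fderiv f (z + circ \<rho> t *s v) w / circ \<rho> t)"
      by (intro continuous_circ_arg[OF mv_holomorphic_continuous_fderiv[OF assms]] in_S r(1))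
    then show "continuous_on (ball z0 e \<times> cbox 0 1) (\<lambda>x. blinfun_apply (case x of (z, t) \<Rightarrow> fx z t) w)"
      by (rule iffD1[OF continuous_on_cong, rotated -1]) (auto simp: fx)
  qed
  have z0e: "z0 \<in> ball z0 e" using r by simp
  have "((\<lambda>z. integral (cbox 0 1) (\<lambda>t. f (z + circ \<rho> t *s v) / circ \<rho> t)) has_derivative
      integral (cbox 0 1) (fx z0)) (at z0 within ball z0 e)"
  proof (rule leibniz_rule[OF _ _ cont z0e convex_ball])
    fix z t assume z: "z \<in> ball z0 e"
    have "((\<lambda>z. f (z + circ \<rho> t *s v)) has_derivative fderiv f (z + circ \<rho> t *s v)) (at z)"
      by (rule has_derivative_compose[where f = "\<lambda>z. z + circ \<rho> t *s v" and f' = "\<lambda>w. w",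
            OF _ mv_holomorphicD(1)[OF assms(1) in_S[OF z]]]) (auto intro!: derivative_eq_intros)
    then have "((\<lambda>z. f (z + circ \<rho> t *s v) / circ \<rho> t) has_derivative fx z t) (at z)"
      unfolding fx[OF z] by (rule bounded_linear.has_derivative[OF bounded_linear_divide])
    then show "((\<lambda>z. f (z + circ \<rho> t *s v) / circ \<rho> t) has_derivative fx z t) (at z within ball z0 e)"
      by (rule has_derivative_at_withinI)
  next
    fix z assume z: "z \<in> ball z0 e"
    have "continuous_on (cbox 0 1) (\<lambda>t. (\<lambda>(z, t). f (z + circ \<rho> t *s v) / circ \<rho> t) (z, t))"
      by (rule continuous_on_compose2[OF
            continuous_circ_arg[OF mv_holomorphic_continuous[OF assms(1)] in_S r(1), of "ball z0 e"]])
        (use z in \<open>auto intro!: continuous_intros\<close>)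
    then show "(\<lambda>t. f (z + circ \<rho> t *s v) / circ \<rho> t) integrable_on cbox 0 1"
      by (intro integrable_continuous) simp
  qed
  then have "((\<lambda>z. integral (cbox 0 1) (\<lambda>t. f (z + circ \<rho> t *s v) / circ \<rho> t)) has_derivative
      integral (cbox 0 1) (fx z0)) (at z0)"
    using at_within_open[OF z0e] by simp
  then have der: "((\<lambda>z. fderiv f z v) has_derivative integral (cbox 0 1) (fx z0)) (at z0)"
    by (rule has_derivative_transform_within_open[OF _ open_ball z0e])
      (use mv_holomorphic_Cauchy[OF assms(1) r(1,4)] in auto)
  have "continuous_on (cbox 0 1) (\<lambda>t. (\<lambda>(z, t). fx z t) (z0, t))"
    by (rule continuous_on_compose2[OF cont]) (use z0e in \<open>auto intro!: continuous_intros\<close>)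
  then have int: "fx z0 integrable_on cbox 0 1" by (intro integrable_continuous) simp
  \<comment> \<open>Each integrand is complex linear in the direction, and integration commutes with
    multiplication by \<open>a\<close>.\<close>
  have "blinfun_apply (integral (cbox 0 1) (fx z0)) (a *s w) =
      a * blinfun_apply (integral (cbox 0 1) (fx z0)) w" for a w
    unfolding blinfun_apply_integral[OF int] fx[OF z0e]
    by (simp add: mv_holomorphicD(2)[OF assms(1) in_S[OF z0e]] flip: integral_mult_right)
  then show "\<exists>D. ((\<lambda>z. fderiv f z v) has_derivative D) (at z0) \<and> (\<forall>a v. D (a *s v) = a * D v)"
    using der by blast
qed

lemma mv_holomorphic_Ck_on:
  assumes "mv_holomorphic_on f S" "open S"
  shows "Ck_on k f S"
  using assms(1)
proof (induction k arbitrary: f)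
  case 0
  then show ?case using mv_holomorphic_continuous by simp
next
  case (Suc k)
  show ?case
    by (rule Ck_on_SucI[OF assms(2) mv_holomorphicD(1)[OF Suc.prems]])
      (auto intro: Suc.IH mv_holomorphic_fderiv[OF Suc.prems assms(2)])
qed

lemma mv_holomorphic_subset: "mv_holomorphic_on f S \<Longrightarrow> T \<subseteq> S \<Longrightarrow> mv_holomorphic_on f T"
  unfolding mv_holomorphic_on_def by blast

lemma mv_holomorphic_cong:
  assumes "open S" "\<And>z. z \<in> S \<Longrightarrow> f z = g z" "mv_holomorphic_on f S"
  shows "mv_holomorphic_on g S"
  unfolding mv_holomorphic_on_def
proof
  fix z assume z: "z \<in> S"
  have "(g has_derivative fderiv f z) (at z)"
    by (rule has_derivative_transform_within_open[OF mv_holomorphicD(1)[OF assms(3) z] assms(1) z assms(2)])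
  then show "\<exists>D. (g has_derivative D) (at z) \<and> (\<forall>a v. D (a *s v) = a * D v)"
    using mv_holomorphicD(2)[OF assms(3) z] by blast
qed

lemma mv_holomorphic_const: "mv_holomorphic_on (\<lambda>z. c) S"
  unfolding mv_holomorphic_on_def by (auto intro!: exI[of _ "\<lambda>_. 0"])

lemma mv_holomorphicI:
  assumes "\<And>z. z \<in> S \<Longrightarrow> (f has_derivative D z) (at z)"
    "\<And>z a v. z \<in> S \<Longrightarrow> D z (a *s v) = a * D z v"
  shows "mv_holomorphic_on f S"
  using assms unfolding mv_holomorphic_on_def by blast

lemma mv_holomorphic_add:
  assumes "mv_holomorphic_on f S" "mv_holomorphic_on g S"
  shows "mv_holomorphic_on (\<lambda>z. f z + g z) S"
proof (rule mv_holomorphicI)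
  fix z assume z: "z \<in> S"
  show "((\<lambda>z. f z + g z) has_derivative (\<lambda>v. fderiv f z v + fderiv g z v)) (at z)"
    by (rule has_derivative_add[OF mv_holomorphicD(1)[OF assms(1) z] mv_holomorphicD(1)[OF assms(2) z]])
  show "fderiv f z (a *s v) + fderiv g z (a *s v) = a * (fderiv f z v + fderiv g z v)" for a v
    by (simp add: mv_holomorphicD(2)[OF assms(1) z] mv_holomorphicD(2)[OF assms(2) z] distrib_left)
qed

lemma mv_holomorphic_mult:
  assumes "mv_holomorphic_on f S" "mv_holomorphic_on g S"
  shows "mv_holomorphic_on (\<lambda>z. f z * g z) S"
proof (rule mv_holomorphicI)
  fix z assume z: "z \<in> S"
  show "((\<lambda>z. f z * g z) has_derivative (\<lambda>v. f z * fderiv g z v + fderiv f z v * g z)) (at z)"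
    by (rule has_derivative_mult[OF mv_holomorphicD(1)[OF assms(1) z] mv_holomorphicD(1)[OF assms(2) z]])
  show "f z * fderiv g z (a *s v) + fderiv f z (a *s v) * g z = a * (f z * fderiv g z v + fderiv f z v * g z)" for a v
    by (simp add: mv_holomorphicD(2)[OF assms(1) z] mv_holomorphicD(2)[OF assms(2) z] distrib_left)
qed

lemma mv_holomorphic_sum:
  "(\<And>i. i \<in> I \<Longrightarrow> mv_holomorphic_on (f i) S) \<Longrightarrow> mv_holomorphic_on (\<lambda>z. \<Sum>i\<in>I. f i z) S"
  by (induction I rule: infinite_finite_induct) (simp_all add: mv_holomorphic_const mv_holomorphic_add)

lemma mv_holomorphic_prod:
  "(\<And>i. i \<in> I \<Longrightarrow> mv_holomorphic_on (f i) S) \<Longrightarrow> mv_holomorphic_on (\<lambda>z. \<Prod>i\<in>I. f i z) S"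
  by (induction I rule: infinite_finite_induct) (simp_all add: mv_holomorphic_const mv_holomorphic_mult)

lemma mv_holomorphic_det:
  assumes "\<And>i j. mv_holomorphic_on (\<lambda>z. M z $ i $ j) S"
  shows "mv_holomorphic_on (\<lambda>z. det (M z :: complex ^ 'm ^ 'm)) S"
  unfolding det_def
  by (intro mv_holomorphic_sum mv_holomorphic_mult mv_holomorphic_prod mv_holomorphic_const assms)

lemma mv_holomorphic_inverse:
  assumes "mv_holomorphic_on f S" "\<And>z. z \<in> S \<Longrightarrow> f z \<noteq> 0"
  shows "mv_holomorphic_on (\<lambda>z. inverse (f z)) S"
proof (rule mv_holomorphicI)
  fix z assume z: "z \<in> S"
  show "((\<lambda>z. inverse (f z)) has_derivative (\<lambda>v. - (inverse (f z) * fderiv f z v * inverse (f z)))) (at z)"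
    by (rule Deriv.has_derivative_inverse[OF assms(2)[OF z] mv_holomorphicD(1)[OF assms(1) z]])
  show "- (inverse (f z) * fderiv f z (a *s v) * inverse (f z)) =
      a * - (inverse (f z) * fderiv f z v * inverse (f z))" for a v
    by (simp add: mv_holomorphicD(2)[OF assms(1) z])
qed

definition holomorphic_map :: "(complex ^ 'n::finite \<Rightarrow> complex ^ 'm::finite) \<Rightarrow> (complex ^ 'n) set \<Rightarrow> bool" where
  "holomorphic_map T S \<longleftrightarrow> (\<forall>k. mv_holomorphic_on (\<lambda>z. T z $ k) S)"

lemma holomorphic_map_subset: "holomorphic_map T S \<Longrightarrow> U \<subseteq> S \<Longrightarrow> holomorphic_map T U"
  unfolding holomorphic_map_def using mv_holomorphic_subset by blast

lemma has_derivative_vecI: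
  fixes T :: "'v::real_normed_vector \<Rightarrow> 'w::euclidean_space ^ 'm::finite"
  assumes "\<And>k. ((\<lambda>z. T z $ k) has_derivative (\<lambda>v. D v $ k)) (at z)"
  shows "(T has_derivative D) (at z)"
proof -
  have "((\<lambda>z. T z \<bullet> b) has_derivative (\<lambda>v. D v \<bullet> b)) (at z within UNIV)" if bB: "b \<in> Basis" for b
  proof -
    obtain u i where b: "b = axis i u" using bB by (auto simp: Basis_vec_def)
    show ?thesis unfolding b inner_axis
      using has_derivative_inner_left[OF assms, of i u] by simp
  qed
  then show ?thesis using has_derivative_componentwise_within[of T D z UNIV] by blast
qed

lemma holomorphic_mapD:
  assumes "holomorphic_map T S" "z \<in> S"
  shows "(T has_derivative fderiv T z) (at z)" "fderiv T z (a *s v) = a *s fderiv T z v"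
    "fderiv T z v $ k = fderiv (\<lambda>z. T z $ k) z v"
proof -
  have c: "mv_holomorphic_on (\<lambda>z. T z $ k) S" for k
    using assms(1) by (simp add: holomorphic_map_def)
  define D where "D v = (\<chi> k. fderiv (\<lambda>z. T z $ k) z v)" for v
  have D: "(T has_derivative D) (at z)"
    by (rule has_derivative_vecI) (use mv_holomorphicD(1)[OF c assms(2)] in \<open>simp add: D_def\<close>)
  have "fderiv T z = D" using has_derivative_imp_fderiv[OF D] .
  then show "(T has_derivative fderiv T z) (at z)" "fderiv T z (a *s v) = a *s fderiv T z v"
    "fderiv T z v $ k = fderiv (\<lambda>z. T z $ k) z v"
    using D by (auto simp: D_def vec_eq_iff mv_holomorphicD(2)[OF c assms(2)])
qed

lemma holomorphic_map_Ck_on: "holomorphic_map T S \<Longrightarrow> open S \<Longrightarrow> Ck_on k T S"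
  by (intro Ck_on_vec mv_holomorphic_Ck_on) (auto simp: holomorphic_map_def)

lemma mv_holomorphic_compose:
  assumes "holomorphic_map T S" "mv_holomorphic_on f U" "T ` S \<subseteq> U"
  shows "mv_holomorphic_on (\<lambda>z. f (T z)) S"
proof (rule mv_holomorphicI)
  fix z assume z: "z \<in> S"
  then have Tz: "T z \<in> U" using assms(3) by blast
  show "((\<lambda>z. f (T z)) has_derivative (\<lambda>v. fderiv f (T z) (fderiv T z v))) (at z)"
    by (rule has_derivative_compose[OF holomorphic_mapD(1)[OF assms(1) z] mv_holomorphicD(1)[OF assms(2) Tz]])
  show "fderiv f (T z) (fderiv T z (a *s v)) = a * fderiv f (T z) (fderiv T z v)" for a v
    by (simp add: holomorphic_mapD(2)[OF assms(1) z] mv_holomorphicD(2)[OF assms(2) Tz])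
qed

lemma mv_holomorphic_hess:
  assumes "mv_holomorphic_on f S" "open S" "z \<in> S"
  shows "hess f z (c *s a) b = c * hess f z a b" "hess f z a (c *s b) = c * hess f z a b"
proof -
  show "hess f z (c *s a) b = c * hess f z a b"
    unfolding hess_def by (rule mv_holomorphicD(2)[OF mv_holomorphic_fderiv[OF assms(1,2)] assms(3)])
  have "fderiv (\<lambda>y. fderiv f y (c *s b)) z = fderiv (\<lambda>y. c * fderiv f y b) z"
    by (rule fderiv_cong[OF assms(2,3)]) (rule mv_holomorphicD(2)[OF assms(1)])
  also have "\<dots> = (\<lambda>a. c * hess f z a b)"
    unfolding hess_def
    by (rule has_derivative_imp_fderiv)
      (intro has_derivative_mult_right mv_holomorphicD(1)[OF mv_holomorphic_fderiv[OF assms(1,2)] assms(3)])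
  finally show "hess f z a (c *s b) = c * hess f z a b" by (simp add: hess_def)
qed

text \<open>Needed in \<open>levi_compose_holomorphic\<close>: a complex bilinear second derivative
  contributes nothing to the Levi form of a composition.\<close>

lemma holomorphic_map_hess:
  assumes "holomorphic_map T S" "open S" "z \<in> S"
  shows "hess T z (c *s a) b = c *s hess T z a b" "hess T z a (c *s b) = c *s hess T z a b"
proof -
  have c: "mv_holomorphic_on (\<lambda>z. T z $ k) S" for k
    using assms(1) by (simp add: holomorphic_map_def)
  have nth: "hess T z a b $ k = hess (\<lambda>z. T z $ k) z a b" for a b k
  proof -
    have "(\<lambda>y. fderiv T y b) differentiable (at z)"
      using holomorphic_map_Ck_on[OF assms(1,2), of 2] assms(3) by (auto simp: numeral_2_eq_2)
    from bounded_linear.has_derivative[OF bounded_linear_vec_nth differentiable_fderiv[OF this], of k]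
    have "fderiv (\<lambda>y. fderiv T y b $ k) z = (\<lambda>a. hess T z a b $ k)"
      unfolding hess_def by (rule has_derivative_imp_fderiv)
    moreover have "fderiv (\<lambda>y. fderiv T y b $ k) z = fderiv (\<lambda>y. fderiv (\<lambda>z. T z $ k) y b) z"
      by (rule fderiv_cong[OF assms(2,3)]) (rule holomorphic_mapD(3)[OF assms(1)])
    ultimately show ?thesis by (simp add: hess_def fun_eq_iff)
  qed
  show "hess T z (c *s a) b = c *s hess T z a b" "hess T z a (c *s b) = c *s hess T z a b"
    by (simp_all add: vec_eq_iff nth mv_holomorphic_hess[OF c assms(2,3)])
qed

section \<open>The Levi form\<close>

text \<open>The convention of \<open>form11\<close> and \<open>hermitian_pos_def\<close>: linear in
  the first argument, conjugate linear in the second.\<close>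

definition sesq :: "complex ^ 'n::finite ^ 'n \<Rightarrow> complex ^ 'n \<Rightarrow> complex ^ 'n \<Rightarrow> complex" where
  "sesq M a b = (\<Sum>i\<in>UNIV. \<Sum>j\<in>UNIV. M $ i $ j * a $ i * cnj (b $ j))"

text \<open>The component of a real bilinear form that is complex linear in the first and conjugate
  linear in the second argument. The factor 1/4 is the product of the two factors 1/2 in the
  Wirtinger derivatives, so a Hessian yields the coefficients of \<partial>\<partial>bar.\<close>

definition sesq_part :: "(complex ^ 'n::finite \<Rightarrow> complex ^ 'n \<Rightarrow> real) \<Rightarrow> complex ^ 'n \<Rightarrow> complex ^ 'n \<Rightarrow> complex" where
  "sesq_part H a b = Complex ((H a b + H (\<i> *s a) (\<i> *s b)) / 4) ((H a (\<i> *s b) - H (\<i> *s a) b) / 4)"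

definition levi :: "(complex ^ 'n::finite \<Rightarrow> real) \<Rightarrow> complex ^ 'n \<Rightarrow> complex ^ 'n ^ 'n" where
  "levi u z = (\<chi> i j. d_z i (d_zbar j (\<lambda>z. complex_of_real (u z))) z)"

lemma ddbar_eq_levi: "ddbar c f p = levi (\<lambda>z. f (chart_inv c z)) (snd c p)"
  by (simp add: ddbar_def levi_def)

lemma axis_imaginary: "axis k \<i> = \<i> *s axis k (1::complex)"
  by (simp add: vec_eq_iff axis_def)

lemma levi_entry:
  assumes "Ck_on 2 u S" "open S" "z \<in> S"
  shows "levi u z $ i $ j = sesq_part (hess u z) (axis i 1) (axis j 1)"
proof -
  have d: "y \<in> S \<Longrightarrow> (u has_derivative fderiv u y) (at y)" for y
    using assms(1) by (auto simp: numeral_2_eq_2 intro: differentiable_fderiv)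
  have dd: "((\<lambda>y. fderiv u y b) has_derivative (\<lambda>a. hess u z a b)) (at z)" for b
    using assms(1,3) unfolding hess_def by (auto simp: numeral_2_eq_2 intro: differentiable_fderiv)
  have 1: "d_zbar j (\<lambda>z. complex_of_real (u z)) y =
      (of_real (fderiv u y (axis j 1)) + \<i> * of_real (fderiv u y (axis j \<i>))) / 2" if "y \<in> S" for y
  proof -
    have "fderiv (\<lambda>z. complex_of_real (u z)) y = (\<lambda>v. of_real (fderiv u y v))"
      by (rule has_derivative_imp_fderiv[OF has_derivative_of_real[OF d[OF that]]])
    then show ?thesis by (simp add: d_zbar_def)
  qed
  have "fderiv (d_zbar j (\<lambda>z. complex_of_real (u z))) z =
      fderiv (\<lambda>y. (of_real (fderiv u y (axis j 1)) + \<i> * of_real (fderiv u y (axis j \<i>))) / 2) z"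
    by (rule fderiv_cong[OF assms(2,3) 1])
  also have "\<dots> = (\<lambda>a. (of_real (hess u z a (axis j 1)) + \<i> * of_real (hess u z a (axis j \<i>))) / 2)"
    by (rule has_derivative_imp_fderiv)
      (intro bounded_linear.has_derivative[OF bounded_linear_divide] has_derivative_add
        has_derivative_mult_right has_derivative_of_real dd)
  finally show ?thesis
    by (simp add: levi_def d_z_def sesq_part_def axis_imaginary complex_eq_iff)
qed

lemma scalar_split: "(c::complex) *s (v :: complex ^ 'n::finite) = Re c *\<^sub>R v + Im c *\<^sub>R (\<i> *s v)"
  by (simp add: vec_eq_iff complex_eq_iff)

lemma sesq_part_scalar:
  assumes "bilinear H"
  shows "sesq_part H (c *s a) b = c * sesq_part H a b" "sesq_part H a (c *s b) = cnj c * sesq_part H a b"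
proof -
  have i: "\<i> *s (Re c *\<^sub>R v + Im c *\<^sub>R (\<i> *s v)) = Re c *\<^sub>R (\<i> *s v) - Im c *\<^sub>R v" for v :: "complex ^ 'a"
    by (simp add: vec_eq_iff complex_eq_iff)
  note simps = bilinear_ladd[OF assms] bilinear_radd[OF assms] bilinear_lmul[OF assms]
    bilinear_rmul[OF assms] bilinear_lsub[OF assms] bilinear_rsub[OF assms]
  show "sesq_part H (c *s a) b = c * sesq_part H a b"
    unfolding sesq_part_def scalar_split[of c a] i
    by (simp add: simps complex_eq_iff algebra_simps add_divide_distrib diff_divide_distrib)
  show "sesq_part H a (c *s b) = cnj c * sesq_part H a b"
    unfolding sesq_part_def scalar_split[of c b] i
    by (simp add: simps complex_eq_iff algebra_simps add_divide_distrib diff_divide_distrib)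
qed

lemma scalar_add_right: "(c::complex) *s ((v :: complex ^ 'n::finite) + w) = c *s v + c *s w"
  by (simp add: vec_eq_iff algebra_simps)

lemma sesq_part_add:
  assumes "bilinear H"
  shows "sesq_part H (a + a') b = sesq_part H a b + sesq_part H a' b"
    "sesq_part H a (b + b') = sesq_part H a b + sesq_part H a b'"
  by (simp_all add: sesq_part_def bilinear_ladd[OF assms] bilinear_radd[OF assms] scalar_add_right
      complex_eq_iff field_simps)

lemma vec_axis_expansion: "(v :: complex ^ 'n::finite) = (\<Sum>i\<in>UNIV. v $ i *s axis i 1)"
  by (simp add: vec_eq_iff axis_def if_distrib sum.delta cong: if_cong)

lemma sesq_expansion:
  assumes add1: "\<And>a a' b. F (a + a') b = F a b + F a' b" and add2: "\<And>a b b'. F a (b + b') = F a b + F a b'"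
    and c1: "\<And>c a b. F (c *s a) b = c * F a b" and c2: "\<And>c a b. F a (c *s b) = cnj c * F a b"
  shows "F a b = sesq (\<chi> i j. F (axis i 1) (axis j 1)) a b"
proof -
  have z1: "F 0 b = 0" for b using c1[of 0 0 b] by simp
  have z2: "F a 0 = 0" for a using c2[of a 0 0] by simp
  have s1: "F (\<Sum>i\<in>I. g i) b = (\<Sum>i\<in>I. F (g i) b)" for g b and I :: "'a set"
    by (induction I rule: infinite_finite_induct) (auto simp: z1 add1)
  have s2: "F a (\<Sum>i\<in>I. g i) = (\<Sum>i\<in>I. F a (g i))" for g a and I :: "'a set"
    by (induction I rule: infinite_finite_induct) (auto simp: z2 add2)
  have "F a b = F (\<Sum>i\<in>UNIV. a $ i *s axis i 1) (\<Sum>j\<in>UNIV. b $ j *s axis j 1)"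
    using vec_axis_expansion[of a] vec_axis_expansion[of b] by simp
  also have "\<dots> = (\<Sum>j\<in>UNIV. \<Sum>i\<in>UNIV. F (axis i 1) (axis j 1) * a $ i * cnj (b $ j))"
    by (simp only: s1 c1 s2 c2 sum_distrib_left mult_ac)
  finally show ?thesis unfolding sesq_def by (subst sum.swap) simp
qed

text \<open>Frees \<open>levi\<close> from coordinates, so that the chain rule can be applied
  without indices. Both sides are sesquilinear, hence agreement on \<open>axis\<close> vectors is
  enough.\<close>

lemma levi_sesq:
  assumes "Ck_on 2 u S" "open S" "z \<in> S"
  shows "sesq (levi u z) a b = sesq_part (hess u z) a b"
proof -
  note bl = hess_bilinear[OF assms]
  have "levi u z = (\<chi> i j. sesq_part (hess u z) (axis i 1) (axis j 1))"
    by (simp add: vec_eq_iff levi_entry[OF assms])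
  then show ?thesis
    using sesq_expansion[of "sesq_part (hess u z)" a b, OF sesq_part_add[OF bl] sesq_part_scalar[OF bl]]
    by simp
qed

lemma levi_eq_0I:
  assumes "Ck_on 2 u S" "open S" "z \<in> S" "\<And>a b. sesq_part (hess u z) a b = 0"
  shows "levi u z = 0"
  by (simp add: vec_eq_iff levi_entry[OF assms(1-3)] assms(4))

lemma levi_cong:
  assumes "open S" "z \<in> S" "\<And>y. y \<in> S \<Longrightarrow> u y = w y" "Ck_on 2 u S"
  shows "levi u z = levi w z"
proof -
  have "hess u z = hess w z" using hess_cong[OF assms(1-3)] by (simp add: fun_eq_iff)
  moreover have "Ck_on 2 w S" by (rule iffD1[OF Ck_on_cong[OF assms(1), where f = u and g = w] assms(4)]) (rule assms(3))
  ultimately show ?thesis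
    by (simp add: vec_eq_iff levi_entry[OF assms(4,1,2)] levi_entry[of w, OF _ assms(1,2)])
qed

definition hermitian :: "complex ^ 'n ^ 'n \<Rightarrow> bool" where
  "hermitian M \<longleftrightarrow> (\<forall>i j. M $ j $ i = cnj (M $ i $ j))"

text \<open>Symmetry of the real Hessian, read through \<open>sesq_part\<close>. It is what later
  turns positive directions of a curvature into positive eigenvalues.\<close>

lemma levi_hermitian:
  assumes "Ck_on 2 u S" "open S" "z \<in> S"
  shows "hermitian (levi u z)"
proof -
  have "levi u z $ j $ i = cnj (levi u z $ i $ j)" for i j
    unfolding levi_entry[OF assms] sesq_part_def
    using hess_sym[OF assms, of "axis i 1" "axis j 1"]
      hess_sym[OF assms, of "\<i> *s axis i 1" "\<i> *s axis j 1"]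
      hess_sym[OF assms, of "axis i 1" "\<i> *s axis j 1"]
      hess_sym[OF assms, of "\<i> *s axis i 1" "axis j 1"]
    by (simp add: complex_eq_iff field_simps)
  then show ?thesis unfolding hermitian_def by blast
qed

lemma hess_add:
  assumes "open S" "z \<in> S" "Ck_on 2 u S" "Ck_on 2 w S"
  shows "hess (\<lambda>y. u y + w y) z a b = hess u z a b + hess w z a b"
proof -
  have d: "y \<in> S \<Longrightarrow> u differentiable (at y)" "y \<in> S \<Longrightarrow> w differentiable (at y)" for y
    using assms(3,4) by (auto simp: numeral_2_eq_2)
  have dd: "(\<lambda>y. fderiv u y b) differentiable (at z)" "(\<lambda>y. fderiv w y b) differentiable (at z)"
    using assms by (auto simp: numeral_2_eq_2)
  have "fderiv (\<lambda>y. fderiv (\<lambda>y. u y + w y) y b) z = fderiv (\<lambda>y. fderiv u y b + fderiv w y b) z"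
  proof (rule fderiv_cong[OF assms(1,2)])
    fix y assume "y \<in> S"
    from has_derivative_imp_fderiv[OF has_derivative_add[OF differentiable_fderiv[OF d(1)[OF this]]
          differentiable_fderiv[OF d(2)[OF this]]]]
    show "fderiv (\<lambda>y. u y + w y) y b = fderiv u y b + fderiv w y b" by simp
  qed
  also have "\<dots> = (\<lambda>a. hess u z a b + hess w z a b)"
    unfolding hess_def
    by (rule has_derivative_imp_fderiv[OF has_derivative_add[OF differentiable_fderiv[OF dd(1)]
          differentiable_fderiv[OF dd(2)]]])
  finally show ?thesis by (simp add: hess_def)
qed

lemma hess_cmult:
  fixes u :: "'v::real_normed_vector \<Rightarrow> real"
  assumes "open S" "z \<in> S" "Ck_on 2 u S"
  shows "hess (\<lambda>y. c * u y) z a b = c * hess u z a b"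
proof -
  have d: "y \<in> S \<Longrightarrow> u differentiable (at y)" for y
    using assms(3) by (auto simp: numeral_2_eq_2)
  have dd: "(\<lambda>y. fderiv u y b) differentiable (at z)"
    using assms by (auto simp: numeral_2_eq_2)
  have "fderiv (\<lambda>y. fderiv (\<lambda>y. c * u y) y b) z = fderiv (\<lambda>y. c * fderiv u y b) z"
  proof (rule fderiv_cong[OF assms(1,2)])
    fix y assume "y \<in> S"
    from has_derivative_imp_fderiv[OF has_derivative_mult_right[OF differentiable_fderiv[OF d[OF this]]]]
    show "fderiv (\<lambda>y. c * u y) y b = c * fderiv u y b" by simp
  qed
  also have "\<dots> = (\<lambda>a. c * hess u z a b)"
    unfolding hess_def
    by (rule has_derivative_imp_fderiv[OF has_derivative_mult_right[OF differentiable_fderiv[OF dd]]])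
  finally show ?thesis by (simp add: hess_def)
qed

lemma levi_add:
  assumes "open S" "z \<in> S" "Ck_on 2 u S" "Ck_on 2 w S"
  shows "levi (\<lambda>y. u y + w y) z = levi u z + levi w z"
  by (simp add: vec_eq_iff levi_entry[OF _ assms(1,2)] Ck_on_add assms sesq_part_def
      hess_add[OF assms] complex_eq_iff field_simps)

lemma levi_cmult:
  assumes "open S" "z \<in> S" "Ck_on 2 u S"
  shows "levi (\<lambda>y. c * u y) z = c *\<^sub>R levi u z"
proof -
  have "Ck_on 2 (\<lambda>y. c * u y) S"
    by (intro Ck_on_mult Ck_on_const assms)
  then show ?thesis
    by (simp add: vec_eq_iff levi_entry[OF _ assms(1,2)] assms(3) sesq_part_def
        hess_cmult[OF assms] complex_eq_iff field_simps)
qed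

lemma levi_minus:
  assumes "open S" "z \<in> S" "Ck_on 2 u S"
  shows "levi (\<lambda>y. - u y) z = - levi u z"
  using levi_cmult[OF assms, of "-1"] by simp

lemma levi_diff:
  assumes "open S" "z \<in> S" "Ck_on 2 u S" "Ck_on 2 w S"
  shows "levi (\<lambda>y. u y - w y) z = levi u z - levi w z"
  using levi_add[OF assms(1-3) Ck_on_uminus[OF assms(1,4)]] levi_minus[OF assms(1,2,4)] by simp

lemma levi_continuous:
  assumes "Ck_on 2 u S" "open S"
  shows "continuous_on S (\<lambda>z. levi u z $ i $ j)"
proof -
  have "continuous_on S (\<lambda>z. complex_of_real ((hess u z (axis i 1) (axis j 1) + hess u z (axis i \<i>) (axis j \<i>)) / 4)
      + \<i> * complex_of_real ((hess u z (axis i 1) (axis j \<i>) - hess u z (axis i \<i>) (axis j 1)) / 4))"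
    by (intro continuous_intros hess_continuous[OF assms(1)]) auto
  then show ?thesis
    by (rule iffD1[OF continuous_on_cong, rotated -1])
      (auto simp: levi_entry[OF assms] sesq_part_def axis_imaginary complex_eq_iff)
qed

lemma sesq_axis: "sesq M (axis i 1) (axis j 1) = M $ i $ j"
proof -
  have "M $ k $ l * axis i 1 $ k * cnj (axis j 1 $ l) = (if l = j then (if k = i then M $ k $ l else 0) else 0)"
    for k l by (simp add: axis_def)
  then show ?thesis by (simp add: sesq_def)
qed

lemma matrix_eq_sesqI: "(\<And>a b. sesq M a b = sesq N a b) \<Longrightarrow> M = N"
  by (simp add: vec_eq_iff flip: sesq_axis)

text \<open>The matrix form of a coordinate change is substitution of vectors into the sesquilinear
  form; transformation rules are proved on the vector side.\<close>

lemma sesq_congruence: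
  "sesq (transpose J ** M ** cnj_matrix J) a b = sesq M (J *v a) (J *v b)"
proof -
  let ?F = "\<lambda>i j k l. M $ k $ l * (J $ k $ i * a $ i) * cnj (J $ l $ j * b $ j)"
  have "sesq (transpose J ** M ** cnj_matrix J) a b =
      (\<Sum>i\<in>UNIV. \<Sum>j\<in>UNIV. \<Sum>l\<in>UNIV. \<Sum>k\<in>UNIV. ?F i j k l)"
    unfolding sesq_def matrix_matrix_mult_def transpose_def cnj_matrix_def
    by (simp add: sum_distrib_left sum_distrib_right mult_ac)
  also have "\<dots> = (\<Sum>i\<in>UNIV. \<Sum>l\<in>UNIV. \<Sum>j\<in>UNIV. \<Sum>k\<in>UNIV. ?F i j k l)"
    by (intro sum.cong refl sum.swap)
  also have "\<dots> = (\<Sum>l\<in>UNIV. \<Sum>i\<in>UNIV. \<Sum>k\<in>UNIV. \<Sum>j\<in>UNIV. ?F i j k l)"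
    by (rule trans[OF sum.swap]) (intro sum.cong refl sum.swap)
  also have "\<dots> = (\<Sum>l\<in>UNIV. \<Sum>k\<in>UNIV. \<Sum>i\<in>UNIV. \<Sum>j\<in>UNIV. ?F i j k l)"
    by (intro sum.cong refl sum.swap)
  also have "\<dots> = (\<Sum>k\<in>UNIV. \<Sum>l\<in>UNIV. \<Sum>i\<in>UNIV. \<Sum>j\<in>UNIV. ?F i j k l)"
    by (rule sum.swap)
  also have "\<dots> = sesq M (J *v a) (J *v b)"
    unfolding sesq_def matrix_vector_mult_def
    by (simp add: sum_distrib_left sum_distrib_right mult_ac)
  finally show ?thesis .
qed

lemma fderiv_eq_matrix:
  assumes "holomorphic_map T S" "z \<in> S"
  shows "matrix (fderiv T z) *v v = fderiv T z v"
proof -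
  have lin: "linear (fderiv T z)" using holomorphic_mapD(1)[OF assms] has_derivative_linear by blast
  have "fderiv T z v = fderiv T z (\<Sum>i\<in>UNIV. v $ i *s axis i 1)"
    using vec_axis_expansion[of v] by simp
  also have "\<dots> = (\<Sum>i\<in>UNIV. v $ i *s fderiv T z (axis i 1))"
    by (simp add: linear_sum[OF lin] holomorphic_mapD(2)[OF assms])
  also have "\<dots> = matrix (fderiv T z) *v v"
    by (simp add: vec_eq_iff matrix_vector_mult_def matrix_def mult.commute)
  finally show ?thesis by simp
qed

text \<open>The chain rule has two terms. \<open>fderiv T z\<close> commutes with
  \<open>\<i>\<close>, so the first is the pulled back form. In the second, rotating both arguments
  by \<open>\<i>\<close> changes the sign and a single \<open>\<i>\<close> may be moved from one
  argument to the other, so \<open>sesq_part\<close> annihilates it.\<close>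

lemma levi_compose_holomorphic:
  assumes T: "holomorphic_map T S" "open S" "T ` S \<subseteq> U" and U: "open U" "Ck_on 2 u U" and z: "z \<in> S"
  shows "levi (\<lambda>y. u (T y)) z =
    transpose (matrix (fderiv T z)) ** levi u (T z) ** cnj_matrix (matrix (fderiv T z))"
proof (rule matrix_eq_sesqI)
  fix a b
  have T2: "Ck_on 2 T S" by (rule holomorphic_map_Ck_on[OF T(1,2)])
  have uT: "Ck_on 2 (\<lambda>y. u (T y)) S" by (rule Ck_on_compose[OF T(2) U(1) T(3) U(2) T2])
  have Tz: "T z \<in> U" using T(3) z by blast
  have lin: "linear (fderiv u (T z))"
    by (rule fderiv_linear) (use U(2) Tz in \<open>auto simp: numeral_2_eq_2\<close>)
  note H = hess_compose[OF T(2) U(1) T(3) U(2) T2 z]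
  note i = holomorphic_mapD(2)[OF T(1) z] holomorphic_map_hess[OF T(1,2) z]
  have ii: "\<i> *s (\<i> *s w) = - w" for w :: "complex ^ 'c" by (simp add: vec_eq_iff)
  have "sesq_part (hess (\<lambda>y. u (T y)) z) a b = sesq_part (hess u (T z)) (fderiv T z a) (fderiv T z b)"
    unfolding sesq_part_def H i ii by (simp add: linear_neg[OF lin])
  then show "sesq (levi (\<lambda>y. u (T y)) z) a b =
      sesq (transpose (matrix (fderiv T z)) ** levi u (T z) ** cnj_matrix (matrix (fderiv T z))) a b"
    by (simp add: sesq_congruence levi_sesq[OF uT T(2) z] levi_sesq[OF U(2,1) Tz] fderiv_eq_matrix[OF T(1) z])
qed

section \<open>Pluriharmonicity of the logarithm of a squared modulus\<close>

lemma Ck_on_cmod_power2: "Ck_on k (\<lambda>w::complex. (cmod w)\<^sup>2) S" if "open S"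
  unfolding cmod_power2 unfolding power2_eq_square
  by (intro Ck_on_add Ck_on_mult Ck_on_linear that bounded_linear_Re bounded_linear_Im)

text \<open>Locally the function is \<open>2 * Re (log w)\<close>; this form needs no branch of the
  logarithm.\<close>

lemma log_cmod_derivative:
  assumes "w \<noteq> 0"
  shows "((\<lambda>w. ln ((cmod w)\<^sup>2)) has_derivative (\<lambda>b. 2 * Re (b * inverse w))) (at w)"
proof -
  have "(cmod w)\<^sup>2 > 0" using assms by simp
  have "((\<lambda>w. (cmod w)\<^sup>2) has_derivative (\<lambda>b. 2 * (Re w * Re b + Im w * Im b))) (at w)"
    unfolding cmod_power2 unfolding power2_eq_square
    by (auto intro!: derivative_eq_intros simp: algebra_simps)
  moreover have "(ln has_derivative (*) (1 / (cmod w)\<^sup>2)) (at ((cmod w)\<^sup>2))"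
    using DERIV_ln_divide[OF \<open>(cmod w)\<^sup>2 > 0\<close>] by (simp add: has_field_derivative_def)
  ultimately have "((\<lambda>w. ln ((cmod w)\<^sup>2)) has_derivative
      (\<lambda>b. 1 / (cmod w)\<^sup>2 * (2 * (Re w * Re b + Im w * Im b)))) (at w)"
    by (rule has_derivative_compose)
  moreover have "1 / (cmod w)\<^sup>2 * (2 * (Re w * Re b + Im w * Im b)) = 2 * Re (b * inverse w)" for b
    by (simp add: cmod_power2 add_divide_distrib algebra_simps)
  ultimately show ?thesis by simp
qed

lemma log_cmod_hess:
  assumes "w \<noteq> 0"
  shows "hess (\<lambda>w. ln ((cmod w)\<^sup>2)) w a b = - 2 * Re (a * b * (inverse w)\<^sup>2)"
proof -
  have "fderiv (\<lambda>y. fderiv (\<lambda>w. ln ((cmod w)\<^sup>2)) y b) w = fderiv (\<lambda>y. 2 * Re (b * inverse y)) w"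
    by (rule fderiv_cong[of "- {0}"]) (use assms has_derivative_imp_fderiv[OF log_cmod_derivative] in auto)
  also have "\<dots> = (\<lambda>a. 2 * Re (b * - (inverse w * a * inverse w)))"
    by (rule has_derivative_imp_fderiv)
      (intro has_derivative_mult_right bounded_linear.has_derivative[OF bounded_linear_Re]
        Deriv.has_derivative_inverse has_derivative_ident assms)
  finally show ?thesis by (simp add: hess_def power2_eq_square mult_ac)
qed

lemma Ck_on_log_cmod: "Ck_on k (\<lambda>w::complex. ln ((cmod w)\<^sup>2)) (- {0})"
  by (rule Ck_on_real_compose[where T = "{0<..}", OF _ _ _ Ck_on_ln Ck_on_cmod_power2]) auto

lemma Ck_on_log_cmod_holomorphic:
  assumes "mv_holomorphic_on g S" "open S" "\<And>z. z \<in> S \<Longrightarrow> g z \<noteq> 0"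
  shows "Ck_on k (\<lambda>y. ln ((cmod (g y))\<^sup>2)) S"
  by (rule Ck_on_compose[where T = "- {0}", OF assms(2) _ _ Ck_on_log_cmod mv_holomorphic_Ck_on[OF assms(1,2)]])
    (use assms(3) in auto)

text \<open>Both terms of the second derivative are real parts of complex bilinear expressions in
  \<open>a\<close> and \<open>b\<close>, on which \<open>sesq_part\<close> vanishes. Applied to
  transition functions, this makes the curvature of a line bundle independent of the frame.\<close>

lemma levi_log_cmod:
  assumes g: "mv_holomorphic_on g S" "open S" "\<And>z. z \<in> S \<Longrightarrow> g z \<noteq> 0" and z: "z \<in> S"
  shows "levi (\<lambda>y. ln ((cmod (g y))\<^sup>2)) z = 0"
proof (rule levi_eq_0I[OF Ck_on_log_cmod_holomorphic[OF g] g(2) z])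
  let ?u = "\<lambda>y. ln ((cmod (g y))\<^sup>2)"
  fix a b
  have op: "open (- {0::complex})" and im: "g ` S \<subseteq> - {0}" using g(3) by auto
  define c where "c = (inverse (g z))\<^sup>2"
  define e where "e = inverse (g z)"
  have H: "hess ?u z a b =
      - 2 * Re (fderiv g z a * fderiv g z b * c) + 2 * Re (hess g z a b * e)" for a b
    unfolding hess_compose[OF g(2) op im Ck_on_log_cmod mv_holomorphic_Ck_on[OF g(1,2)] z]
      has_derivative_imp_fderiv[OF log_cmod_derivative[OF g(3)[OF z]]] log_cmod_hess[OF g(3)[OF z]] c_def e_def ..
  show "sesq_part (hess ?u z) a b = 0"
    unfolding sesq_part_def H mv_holomorphicD(2)[OF g(1) z] mv_holomorphic_hess[OF g(1,2) z]
    by (simp add: complex_eq_iff algebra_simps)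
qed

section \<open>Hermitian matrices\<close>

text \<open>Stands in for \<open>has_positive_eigenvalue\<close> in all estimates: it is stable
  under congruence and small perturbation, and for Hermitian matrices it yields an eigenvalue by
  \<open>pos_dir_imp_positive_eigenvalue\<close>.\<close>

definition pos_dir :: "complex ^ 'n::finite ^ 'n \<Rightarrow> bool" where
  "pos_dir M \<longleftrightarrow> (\<exists>v. Re (sesq M v v) > 0)"

lemma hermitian_pos_defD:
  assumes "hermitian_pos_def G"
  shows "hermitian G" "v \<noteq> 0 \<Longrightarrow> Re (sesq G v v) > 0"
  using assms unfolding hermitian_pos_def_def hermitian_def sesq_def by blast+

lemma sesq_hermitian:
  assumes "hermitian M"
  shows "sesq M b a = cnj (sesq M a b)"
proof -
  have "cnj (M $ i $ j) = M $ j $ i" for i j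
    using assms unfolding hermitian_def by metis
  then have "cnj (sesq M a b) = (\<Sum>i\<in>UNIV. \<Sum>j\<in>UNIV. M $ j $ i * cnj (a $ i) * b $ j)"
    by (simp add: sesq_def)
  also have "\<dots> = sesq M b a"
    unfolding sesq_def by (subst sum.swap) (simp add: mult_ac)
  finally show ?thesis by simp
qed

lemma sesq_linear:
  "sesq M (a + a') b = sesq M a b + sesq M a' b" "sesq M a (b + b') = sesq M a b + sesq M a b'"
  "sesq M (c *s a) b = c * sesq M a b" "sesq M a (c *s b) = cnj c * sesq M a b"
  by (simp_all add: sesq_def sum_distrib_left sum.distrib algebra_simps)

lemma sesq_matrix:
  "sesq (M + N) a b = sesq M a b + sesq N a b" "sesq (- M) a b = - sesq M a b"
  "sesq (r *\<^sub>R M) a b = r *\<^sub>R sesq M a b"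
  by (simp_all add: sesq_def sum_distrib_left sum.distrib algebra_simps sum_negf scaleR_sum_right)

lemma hermitian_minus: "hermitian M \<Longrightarrow> hermitian (- M)"
  unfolding hermitian_def by (metis complex_cnj_minus vector_uminus_component)

text \<open>Near 0 the linear term dominates the quadratic one;
  \<open>t = A / (\<bar>B\<bar> + 1)\<close> is small enough to see this. It provides the
  first-order condition at a maximum.\<close>

lemma linear_growth_zero:
  fixes A B :: real
  assumes "\<And>t. 2 * t * A + t\<^sup>2 * B \<le> 0"
  shows "A = 0"
proof (rule ccontr)
  assume A: "A \<noteq> 0"
  define t where "t = A / (\<bar>B\<bar> + 1)"
  have p: "\<bar>B\<bar> + 1 > 0" by simp
  have "t * A = A\<^sup>2 / (\<bar>B\<bar> + 1)" by (simp add: t_def power2_eq_square)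
  moreover have "t\<^sup>2 * (\<bar>B\<bar> + 1) = A\<^sup>2 / (\<bar>B\<bar> + 1)" using p by (simp add: t_def power2_eq_square)
  moreover have "t\<^sup>2 * B \<ge> - (t\<^sup>2 * (\<bar>B\<bar> + 1))"
  proof -
    have "- (\<bar>B\<bar> + 1) \<le> B" by linarith
    then have "t\<^sup>2 * - (\<bar>B\<bar> + 1) \<le> t\<^sup>2 * B" by (rule mult_left_mono) simp
    then show ?thesis by (simp only: mult_minus_right)
  qed
  moreover have "A\<^sup>2 / (\<bar>B\<bar> + 1) > 0" using A p by simp
  ultimately show False using assms[of t] by (simp add: mult.assoc)
qed

text \<open>The conjugations reconcile two conventions: \<open>sesq\<close> pairs the second index
  of \<open>M\<close> with a conjugated vector, while \<open>*v\<close> pairs it with the vector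
  itself.\<close>

lemma inner_matrix_vector: "(M *v v) \<bullet> w = Re (sesq M (\<chi> i. cnj (w $ i)) (\<chi> i. cnj (v $ i)))"
  by (simp add: sesq_def inner_vec_def matrix_vector_mult_def inner_complex_def sum_distrib_left sum_distrib_right
      Re_sum Im_sum algebra_simps sum.distrib sum_subtractf)

text \<open>Rayleigh quotient: a maximiser of \<open>L v \<bullet> v\<close> on the unit sphere is
  an eigenvector, and the given direction makes the maximum positive. The real inner product
  suffices because \<open>L\<close> is symmetric for it.\<close>

lemma pos_dir_imp_positive_eigenvalue:
  assumes "hermitian M" "pos_dir M"
  shows "has_positive_eigenvalue M"
proof -
  define L where "L v = M *v v" for v
  have lin: "linear L" unfolding L_def by (rule matrix_vector_mul_linear)
  have sym: "L v \<bullet> w = v \<bullet> L w" for v w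
    using sesq_hermitian[OF assms(1), of "\<chi> i. cnj (v $ i)" "\<chi> i. cnj (w $ i)"]
    by (simp add: L_def inner_matrix_vector inner_commute[of v])
  have comp: "compact (sphere (0::complex ^ 'a) 1)" by simp
  obtain v where "Re (sesq M v v) > 0" using assms(2) by (auto simp: pos_dir_def)
  moreover define v1 where "v1 = (\<chi> i. cnj (v $ i))"
  ultimately have v1: "L v1 \<bullet> v1 > 0" by (simp add: L_def inner_matrix_vector)
  then have "v1 \<noteq> 0" by auto
  have ne: "sphere (0::complex ^ 'a) 1 \<noteq> {}"
  proof -
    have "v1 /\<^sub>R norm v1 \<in> sphere 0 1" using \<open>v1 \<noteq> 0\<close> by simp
    then show ?thesis by blast
  qed
  have "continuous_on (sphere (0::complex ^ 'a) 1) (\<lambda>v. L v \<bullet> v)"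
    using linear_continuous_on[of L] lin by (intro continuous_intros) (simp add: linear_conv_bounded_linear)
  from continuous_attains_sup[OF comp ne this]
  obtain v0 where "v0 \<in> sphere 0 1" "\<forall>v\<in>sphere 0 1. L v \<bullet> v \<le> L v0 \<bullet> v0" by blast
  then have v0: "norm v0 = 1" "\<And>v. norm v = 1 \<Longrightarrow> L v \<bullet> v \<le> L v0 \<bullet> v0" by simp_all
  define l where "l = L v0 \<bullet> v0"
  have max: "L v \<bullet> v \<le> l * (v \<bullet> v)" for v
  proof (cases "v = 0")
    case True
    then show ?thesis by simp
  next
    case False
    have "L (v /\<^sub>R norm v) \<bullet> (v /\<^sub>R norm v) \<le> l"
      unfolding l_def using False by (intro v0) simp
    then have "(L v \<bullet> v) / (norm v)\<^sup>2 \<le> l"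
      by (simp add: linear_cmul[OF lin] power2_eq_square divide_inverse mult_ac)
    then show ?thesis using False by (simp add: dot_square_norm pos_divide_le_eq)
  qed
  have "l > 0"
  proof -
    have "0 < l * (v1 \<bullet> v1)" using max[of v1] v1 by linarith
    moreover have "0 < v1 \<bullet> v1" using \<open>v1 \<noteq> 0\<close> by simp
    ultimately show ?thesis by (rule zero_less_mult_pos2)
  qed
  \<comment> \<open>The maximiser is varied in direction \<open>w\<close>: the terms of order zero
    in \<open>t\<close> cancel, leaving a quadratic polynomial without constant term that is nowhere
    positive. The residual itself is then taken as \<open>w\<close>.\<close>
  have "(L v0 - l *\<^sub>R v0) \<bullet> w = 0" for w
  proof (rule linear_growth_zero)
    fix t :: real
    have vv: "v0 \<bullet> v0 = 1" using v0(1) by (simp add: dot_square_norm)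
    have "L (v0 + t *\<^sub>R w) \<bullet> (v0 + t *\<^sub>R w) \<le> l * ((v0 + t *\<^sub>R w) \<bullet> (v0 + t *\<^sub>R w))" by (rule max)
    moreover have "L (v0 + t *\<^sub>R w) \<bullet> (v0 + t *\<^sub>R w) = l + 2 * t * (L v0 \<bullet> w) + t\<^sup>2 * (L w \<bullet> w)"
    proof -
      have "L w \<bullet> v0 = L v0 \<bullet> w" using sym[of w v0] inner_commute[of w "L v0"] by simp
      then show ?thesis
        by (simp add: linear_add[OF lin] linear_cmul[OF lin] inner_add_left inner_add_right l_def
            power2_eq_square distrib_left)
    qed
    moreover have "(v0 + t *\<^sub>R w) \<bullet> (v0 + t *\<^sub>R w) = 1 + 2 * t * (v0 \<bullet> w) + t\<^sup>2 * (w \<bullet> w)"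
      using inner_commute[of w v0]
      by (simp add: inner_add_left inner_add_right vv power2_eq_square distrib_left)
    ultimately have "l + 2 * t * (L v0 \<bullet> w) + t\<^sup>2 * (L w \<bullet> w) \<le> l * (1 + 2 * t * (v0 \<bullet> w) + t\<^sup>2 * (w \<bullet> w))"
      by (simp only:)
    then show "2 * t * ((L v0 - l *\<^sub>R v0) \<bullet> w) + t\<^sup>2 * (L w \<bullet> w - l * (w \<bullet> w)) \<le> 0"
      by (simp add: inner_diff_left algebra_simps)
  qed
  from this[of "L v0 - l *\<^sub>R v0"] have "L v0 = l *\<^sub>R v0" by simp
  then have "M *v v0 = complex_of_real l *s v0" by (simp add: L_def scaleR_eq_scalar)
  moreover have "v0 \<noteq> 0" using v0(1) by auto
  ultimately show ?thesis using \<open>l > 0\<close> unfolding has_positive_eigenvalue_def by blast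
qed

lemma orthonormal_family:
  fixes G :: "complex ^ 'n::finite ^ 'n" and S :: "'n set"
  assumes "hermitian_pos_def G"
  shows "\<exists>v. \<forall>i\<in>S. \<forall>j\<in>S. sesq G (v i) (v j) = (if i = j then 1 else 0)"
proof -
  have "finite S" by simp
  then show ?thesis
  proof (induction S rule: finite_induct)
    case empty
    then show ?case by simp
  next
    case (insert k S)
    then obtain v where v: "\<forall>i\<in>S. \<forall>j\<in>S. sesq G (v i) (v j) = (if i = j then 1 else 0)" by blast
    \<comment> \<open>Coordinate \<open>k\<close> of \<open>L w\<close> is always 0, so
      \<open>L\<close> is not onto, hence not injective. A non-zero kernel vector is orthogonal to
      all earlier \<open>v i\<close> and only needs to be normalised.\<close>
    define L where "L w = (\<chi> i. if i \<in> S then sesq G w (v i) else 0)" for w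
    have lin: "linear L"
      by (rule linearI) (auto simp: L_def vec_eq_iff sesq_linear scaleR_eq_scalar complex_eq_iff)
    have "\<not> surj L"
    proof
      assume "surj L"
      then obtain w where "axis k 1 = L w" by (metis surjD)
      then have "axis k (1::complex) $ k = L w $ k" by simp
      then show False using insert.hyps by (simp add: L_def)
    qed
    then have "\<not> inj L" using linear_injective_imp_surjective[OF lin] by blast
    then obtain w where w: "w \<noteq> 0" "L w = 0" using linear_injective_0[OF lin] by blast
    have wS: "sesq G w (v i) = 0" if "i \<in> S" for i
      using w(2) that by (auto simp: L_def vec_eq_iff split: if_splits)
    have pos: "Re (sesq G w w) > 0" using hermitian_pos_defD(2)[OF assms w(1)] .
    have im: "Im (sesq G w w) = 0"
      using sesq_hermitian[OF hermitian_pos_defD(1)[OF assms], of w w] by (simp add: complex_eq_iff)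
    define r where "r = complex_of_real (1 / sqrt (Re (sesq G w w)))"
    define u where "u = r *s w"
    have "sesq G w w = complex_of_real (Re (sesq G w w))" using im by (simp add: complex_eq_iff)
    then have "sesq G u u = r * cnj r * complex_of_real (Re (sesq G w w))"
      by (simp add: u_def sesq_linear)
    also have "\<dots> = complex_of_real (1 / sqrt (Re (sesq G w w)) * (1 / sqrt (Re (sesq G w w))) * Re (sesq G w w))"
      unfolding r_def by (simp only: complex_cnj_complex_of_real of_real_mult)
    also have "1 / sqrt (Re (sesq G w w)) * (1 / sqrt (Re (sesq G w w))) * Re (sesq G w w) = 1"
      using pos by (simp add: field_simps)
    finally have uu: "sesq G u u = 1" by simp
    have uS: "sesq G u (v i) = 0" "sesq G (v i) u = 0" if "i \<in> S" for i
      using wS[OF that] sesq_hermitian[OF hermitian_pos_defD(1)[OF assms], of "v i" u]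
      by (auto simp: u_def sesq_linear)
    show ?case
      by (rule exI[of _ "v(k := u)"]) (use insert.hyps v uu uS in auto)
  qed
qed

lemma orthonormal_frame:
  assumes "hermitian_pos_def (G :: complex ^ 'n::finite ^ 'n)"
  obtains P where "transpose P ** G ** cnj_matrix P = mat 1"
proof -
  from orthonormal_family[OF assms, of UNIV]
  obtain v where v: "\<forall>i\<in>(UNIV :: 'n set). \<forall>j\<in>UNIV. sesq G (v i) (v j) = (if i = j then 1 else 0)" by blast
  define P where "P = (\<chi> k i. v i $ k)"
  have "P *v axis i 1 = v i" for i
    by (simp add: P_def vec_eq_iff matrix_vector_mult_def axis_def if_distrib sum.delta cong: if_cong)
  then have "(transpose P ** G ** cnj_matrix P) $ i $ j = (if i = j then 1 else 0)" for i j
    using sesq_congruence[of P G "axis i 1" "axis j 1"] v by (simp add: sesq_axis)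
  then have "transpose P ** G ** cnj_matrix P = mat 1" by (simp add: vec_eq_iff mat_def)
  then show ?thesis using that by blast
qed

lemma matrix_inv_inverse:
  fixes A :: "'a::semiring_1 ^ 'n ^ 'm"
  assumes "invertible A"
  shows "matrix_inv A ** A = mat 1" "A ** matrix_inv A = mat 1"
  using someI_ex[OF assms[unfolded invertible_def]] by (simp_all add: matrix_inv_def)

lemma matrix_inv_eqI:
  fixes A B :: "'a::field ^ 'n::finite ^ 'n"
  assumes "A ** B = mat 1"
  shows "matrix_inv A = B"
proof -
  have inv: "invertible A" using assms invertible_right_inverse by blast
  have "matrix_inv A = matrix_inv A ** (A ** B)" by (simp add: assms)
  also have "\<dots> = B" by (simp add: matrix_mul_assoc matrix_inv_inverse(1)[OF inv])
  finally show ?thesis .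
qed

lemma cnj_matrix_mult: "cnj_matrix (A ** B) = cnj_matrix A ** cnj_matrix (B :: complex ^ 'n::finite ^ 'n)"
  by (simp add: cnj_matrix_def matrix_matrix_mult_def vec_eq_iff)

lemma cnj_matrix_mat1: "cnj_matrix (mat 1 :: complex ^ 'n::finite ^ 'n) = mat 1"
  by (simp add: cnj_matrix_def mat_def vec_eq_iff)

lemma det_cnj_matrix: "det (cnj_matrix A) = cnj (det (A :: complex ^ 'n::finite ^ 'n))"
  by (simp add: det_def cnj_matrix_def)

lemma frame_inverse:
  fixes P G :: "complex ^ 'n::finite ^ 'n"
  assumes "transpose P ** G ** cnj_matrix P = mat 1"
  shows "matrix_inv G = cnj_matrix P ** transpose P" "invertible P"
proof -
  have "transpose P ** (G ** cnj_matrix P) = mat 1" using assms by (simp add: matrix_mul_assoc)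
  then have "(G ** cnj_matrix P) ** transpose P = mat 1"
    by (rule iffD1[OF matrix_left_right_inverse])
  then show "matrix_inv G = cnj_matrix P ** transpose P"
    by (intro matrix_inv_eqI) (simp add: matrix_mul_assoc)
  have "det (transpose P ** (G ** cnj_matrix P)) = 1" using assms by (simp add: matrix_mul_assoc)
  then have "det P \<noteq> 0" by (auto simp: det_mul)
  then show "invertible P" by (simp add: invertible_det_nz)
qed

text \<open>Since \<open>matrix_inv G = cnj_matrix P ** transpose P\<close>, cyclicity moves one
  factor around. The columns of \<open>P\<close> form a \<open>G\<close>-orthonormal frame, so
  information on the trace becomes information on directions.\<close>

lemma trace_frame:
  assumes "transpose P ** G ** cnj_matrix P = mat 1"
  shows "trace (matrix_inv G ** M) = (\<Sum>k\<in>UNIV. sesq M (P *v axis k 1) (P *v axis k 1))"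
proof -
  have "trace (matrix_inv G ** M) = trace (cnj_matrix P ** (transpose P ** M))"
    by (simp add: frame_inverse(1)[OF assms] matrix_mul_assoc)
  also have "\<dots> = trace (transpose P ** M ** cnj_matrix P)"
    by (rule trace_mul_sym)
  also have "\<dots> = (\<Sum>k\<in>UNIV. sesq M (P *v axis k 1) (P *v axis k 1))"
    by (simp add: trace_def sesq_axis flip: sesq_congruence)
  finally show ?thesis .
qed

lemma positive_trace_imp_pos_dir:
  assumes "hermitian_pos_def G" "Re (trace (matrix_inv G ** M)) > 0"
  shows "pos_dir M"
proof -
  obtain P where P: "transpose P ** G ** cnj_matrix P = mat 1"
    using orthonormal_frame[OF assms(1)] .
  have "(\<Sum>k\<in>UNIV. Re (sesq M (P *v axis k 1) (P *v axis k 1))) > 0"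
    using assms(2) trace_frame[OF P, of M] by simp
  then obtain k where "Re (sesq M (P *v axis k 1) (P *v axis k 1)) > 0"
    by (meson not_less sum_nonpos)
  then show ?thesis unfolding pos_dir_def by blast
qed

text \<open>In a \<open>G\<close>-orthonormal frame a form without positive direction has
  non-positive diagonal entries. Trace zero makes the diagonal vanish, and a semidefinite form with
  zero diagonal is zero.\<close>

lemma trace_free_imp_pos_dir:
  assumes G: "hermitian_pos_def G" and M: "hermitian M" "trace (matrix_inv G ** M) = 0" "M \<noteq> 0"
  shows "pos_dir M"
proof (rule ccontr)
  assume np: "\<not> pos_dir M"
  obtain P where P: "transpose P ** G ** cnj_matrix P = mat 1"
    using orthonormal_frame[OF G] .
  define N where "N = transpose P ** M ** cnj_matrix P"
  have sN: "sesq N a b = sesq M (P *v a) (P *v b)" for a b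
    unfolding N_def by (rule sesq_congruence)
  have np': "Re (sesq N v v) \<le> 0" for v
    using np unfolding pos_dir_def sN by (meson not_less)
  have "(\<Sum>k\<in>UNIV. Re (sesq N (axis k 1) (axis k 1))) = 0"
    using M(2) trace_frame[OF P, of M] by (simp add: sN flip: Re_sum)
  then have re: "Re (sesq N (axis k 1) (axis k 1)) = 0" for k
    using sum_nonneg_eq_0_iff[of UNIV "\<lambda>k. - Re (sesq N (axis k 1) (axis k 1))"] np'
    by (simp add: sum_negf)
  have hN: "sesq N b a = cnj (sesq N a b)" for a b
    unfolding sN by (rule sesq_hermitian[OF M(1)])
  have diag: "sesq N (axis k 1) (axis k 1) = 0" for k
    using re[of k] arg_cong[OF hN[of "axis k 1" "axis k 1"], of Im] by (simp add: complex_eq_iff)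
  have "sesq N (axis i 1) (axis j 1) = 0" for i j
  proof (rule ccontr)
    let ?c = "sesq N (axis i 1) (axis j 1)"
    assume c: "?c \<noteq> 0"
    \<comment> \<open>Once the diagonal is zero, the value on this vector is twice the squared
      modulus of the off-diagonal entry.\<close>
    have "sesq N (axis i 1 + ?c *s axis j 1) (axis i 1 + ?c *s axis j 1) = cnj ?c * ?c + ?c * cnj ?c"
      by (simp only: sesq_linear diag hN[of "axis i 1" "axis j 1"]) simp
    then have "Re (cnj ?c * ?c + ?c * cnj ?c) \<le> 0" using np' by metis
    then have "2 * (cmod ?c)\<^sup>2 \<le> 0" unfolding cmod_power2 by (simp add: power2_eq_square)
    then show False using c by simp
  qed
  then have N0: "N = 0" by (simp add: sesq_axis vec_eq_iff)
  have invP: "P ** matrix_inv P = mat 1" by (rule matrix_inv_inverse(2)[OF frame_inverse(2)[OF P]])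
  have "sesq M a b = 0" for a b
  proof -
    have "sesq M a b = sesq N (matrix_inv P *v a) (matrix_inv P *v b)"
      by (simp add: sN matrix_vector_mul_assoc invP)
    then show ?thesis by (simp add: N0 sesq_def)
  qed
  then have "M = 0" by (intro matrix_eq_sesqI) (simp add: sesq_def)
  then show False using M(3) by simp
qed

text \<open>This makes the trace with respect to a metric independent of the chart: \<open>G\<close>
  and \<open>M\<close> undergo the same congruence, and the factors cancel by cyclicity.\<close>

lemma trace_congruence:
  fixes J G M :: "complex ^ 'n::finite ^ 'n"
  assumes "invertible J" "invertible G"
  shows "trace (matrix_inv (transpose J ** G ** cnj_matrix J) ** (transpose J ** M ** cnj_matrix J)) =
    trace (matrix_inv G ** M)"
proof -
  define K where "K = matrix_inv J"
  have K: "J ** K = mat 1" "K ** J = mat 1"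
    unfolding K_def using matrix_inv_inverse(2)[OF assms(1)] matrix_inv_inverse(1)[OF assms(1)] by auto
  have cK: "cnj_matrix J ** cnj_matrix K = mat 1" "cnj_matrix K ** cnj_matrix J = mat 1"
    by (simp_all add: K cnj_matrix_mat1 flip: cnj_matrix_mult)
  have tK: "transpose J ** transpose K = mat 1" "transpose K ** transpose J = mat 1"
    by (simp_all add: K transpose_mat flip: matrix_transpose_mul)
  have "matrix_inv (transpose J ** G ** cnj_matrix J) = cnj_matrix K ** matrix_inv G ** transpose K"
  proof (rule matrix_inv_eqI)
    have "transpose J ** G ** cnj_matrix J ** (cnj_matrix K ** matrix_inv G ** transpose K) =
        transpose J ** (G ** ((cnj_matrix J ** cnj_matrix K) ** matrix_inv G)) ** transpose K"
      by (simp add: matrix_mul_assoc)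
    also have "\<dots> = mat 1" by (simp add: cK matrix_inv_inverse(2)[OF assms(2)] tK)
    finally show "transpose J ** G ** cnj_matrix J ** (cnj_matrix K ** matrix_inv G ** transpose K) = mat 1" .
  qed
  then have "matrix_inv (transpose J ** G ** cnj_matrix J) ** (transpose J ** M ** cnj_matrix J) =
      cnj_matrix K ** (matrix_inv G ** (transpose K ** transpose J) ** M ** cnj_matrix J)"
    by (simp add: matrix_mul_assoc)
  also have "\<dots> = cnj_matrix K ** (matrix_inv G ** M ** cnj_matrix J)" by (simp add: tK)
  also have "trace \<dots> = trace (matrix_inv G ** M ** (cnj_matrix J ** cnj_matrix K))"
    by (subst trace_mul_sym) (simp add: matrix_mul_assoc)
  finally show ?thesis by (simp add: cK)
qed

lemma pos_dir_congruence:
  fixes M J :: "complex ^ 'n::finite ^ 'n"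
  assumes "pos_dir M" "invertible J"
  shows "pos_dir (transpose J ** M ** cnj_matrix J)"
proof -
  obtain v where v: "Re (sesq M v v) > 0" using assms(1) by (auto simp: pos_dir_def)
  have "J *v (matrix_inv J *v v) = v"
    by (simp add: matrix_vector_mul_assoc matrix_inv_inverse[OF assms(2)])
  then have "Re (sesq (transpose J ** M ** cnj_matrix J) (matrix_inv J *v v) (matrix_inv J *v v)) > 0"
    using v by (simp add: sesq_congruence)
  then show ?thesis unfolding pos_dir_def by blast
qed

lemma matrix_add_trace: "trace (B ** (M + N)) = trace (B ** M) + trace (B ** (N :: complex ^ 'n::finite ^ 'n))"
  by (simp add: matrix_add_ldistrib trace_add)

lemma matrix_scale_trace: "trace (B ** (r *\<^sub>R M)) = r *\<^sub>R trace (B ** (M :: complex ^ 'n::finite ^ 'n))"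
  by (simp add: matrix_matrix_mult_def trace_def scaleR_sum_right)

text \<open>Cramer's rule writes the inverse through determinants, from which
  \<open>continuous_trace_matrix_inv\<close> reads off continuity.\<close>

lemma matrix_inv_entry:
  fixes A :: "'a::field ^ 'n::finite ^ 'n"
  assumes "det A \<noteq> 0"
  shows "matrix_inv A $ k $ j = det (\<chi> i l. if l = k then axis j 1 $ i else A $ i $ l) / det A"
proof -
  have "invertible A" using assms invertible_det_nz by blast
  then have "A *v (matrix_inv A *v axis j 1) = axis j 1"
    by (simp add: matrix_vector_mul_assoc matrix_inv_inverse(2))
  then have "matrix_inv A *v axis j 1 = (\<chi> k. det (\<chi> i l. if l = k then axis j 1 $ i else A $ i $ l) / det A)"
    using cramer[OF assms] by blast
  moreover have "(matrix_inv A *v axis j 1) $ k = matrix_inv A $ k $ j"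
    by (simp add: matrix_vector_mult_def axis_def if_distrib sum.delta cong: if_cong)
  ultimately show ?thesis by simp
qed

lemma continuous_trace_matrix_inv:
  fixes G M :: "'v::topological_space \<Rightarrow> complex ^ 'n::finite ^ 'n"
  assumes G: "\<And>i j. continuous_on S (\<lambda>z. G z $ i $ j)" "\<And>z. z \<in> S \<Longrightarrow> det (G z) \<noteq> 0"
    and M: "\<And>i j. continuous_on S (\<lambda>z. M z $ i $ j)"
  shows "continuous_on S (\<lambda>z. trace (matrix_inv (G z) ** M z))"
proof -
  have cd: "continuous_on S (\<lambda>z. det (F z))"
    if "\<And>i j. continuous_on S (\<lambda>z. F z $ i $ j)" for F :: "'v \<Rightarrow> complex ^ 'n ^ 'n"
    unfolding det_def by (intro continuous_intros that)
  have inv: "continuous_on S (\<lambda>z. matrix_inv (G z) $ k $ j)" for k j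
  proof -
    have "continuous_on S (\<lambda>z. (if l = k then axis j 1 $ i else G z $ i $ l))" for i l
      by (cases "l = k") (auto intro: G)
    then have "continuous_on S (\<lambda>z. det (\<chi> i l. if l = k then axis j 1 $ i else G z $ i $ l) / det (G z))"
      by (intro continuous_intros cd G) (auto simp: G)
    then show ?thesis
      by (rule iffD1[OF continuous_on_cong, rotated -1]) (auto simp: matrix_inv_entry[OF G(2)])
  qed
  show ?thesis
    unfolding trace_def matrix_matrix_mult_def by (simp, intro continuous_intros inv M)
qed

section \<open>Charts\<close>

definition chart_image :: "('a, 'n::finite) chart \<Rightarrow> 'a set \<Rightarrow> (complex ^ 'n) set" where
  "chart_image c U = snd c ` (fst c \<inter> U)"

lemma is_chartD:
  assumes "is_chart X c"
  shows "openin X (fst c)" "fst c \<subseteq> topspace X" "inj_on (snd c) (fst c)"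
    "homeomorphic_map (subtopology X (fst c)) (top_of_set (snd c ` fst c)) (snd c)"
proof -
  show o: "openin X (fst c)"
    and h: "homeomorphic_map (subtopology X (fst c)) (top_of_set (snd c ` fst c)) (snd c)"
    using assms by (auto simp: is_chart_def)
  show "fst c \<subseteq> topspace X" using o openin_subset by blast
  then show "inj_on (snd c) (fst c)"
    using homeomorphic_imp_injective_map[OF h] by (simp add: Int_absorb1)
qed

lemma chart_inv_left: "is_chart X c \<Longrightarrow> p \<in> fst c \<Longrightarrow> chart_inv c (snd c p) = p"
  using is_chartD(3) by (metis chart_inv_def inv_into_f_f)

lemma chart_inv_right: "z \<in> snd c ` fst c \<Longrightarrow> snd c (chart_inv c z) = z"
  by (simp add: chart_inv_def f_inv_into_f)

lemma chart_inv_in: "z \<in> snd c ` fst c \<Longrightarrow> chart_inv c z \<in> fst c"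
  by (simp add: chart_inv_def inv_into_into)

lemma open_chart_image:
  assumes "is_chart X c" "openin X U"
  shows "open (chart_image c U)"
proof -
  have "openin (subtopology X (fst c)) (fst c \<inter> U)"
    using assms(2) by (simp add: openin_subtopology_Int2)
  then have "openin (top_of_set (snd c ` fst c)) (snd c ` (fst c \<inter> U))"
    using homeomorphic_imp_open_map[OF is_chartD(4)[OF assms(1)]] by (simp add: open_map_def)
  moreover have "open (snd c ` fst c)" using assms(1) by (simp add: is_chart_def)
  ultimately show ?thesis unfolding chart_image_def using openin_open_trans by blast
qed

lemma openin_chart_preimage:
  assumes "is_chart X c" "open W"
  shows "openin X {p \<in> fst c. snd c p \<in> W}"
proof -
  have "openin (top_of_set (snd c ` fst c)) (snd c ` fst c \<inter> W)" using assms(2) by blast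
  then have "openin (subtopology X (fst c)) {p \<in> topspace (subtopology X (fst c)). snd c p \<in> snd c ` fst c \<inter> W}"
    using homeomorphic_imp_continuous_map[OF is_chartD(4)[OF assms(1)]]
    unfolding continuous_map_def by blast
  moreover have "{p \<in> topspace (subtopology X (fst c)). snd c p \<in> snd c ` fst c \<inter> W} = {p \<in> fst c. snd c p \<in> W}"
    using is_chartD(2)[OF assms(1)] by auto
  ultimately show ?thesis
    using is_chartD(1)[OF assms(1)] openin_trans_full by metis
qed

lemma chart_image_mono: "U \<subseteq> V \<Longrightarrow> chart_image c U \<subseteq> chart_image c V"
  by (auto simp: chart_image_def)

lemma chart_imageI: "p \<in> fst c \<Longrightarrow> p \<in> U \<Longrightarrow> snd c p \<in> chart_image c U"
  by (auto simp: chart_image_def)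

text \<open>In a Hausdorff space such a set is closed, which allows bumps supported in a chart to be
  extended by zero.\<close>

lemma compactin_chart_ball:
  assumes "is_chart X c" "K \<subseteq> snd c ` fst c" "compact K"
  shows "compactin X {p \<in> fst c. snd c p \<in> K}"
proof -
  obtain g where g: "homeomorphic_maps (subtopology X (fst c)) (top_of_set (snd c ` fst c)) (snd c) g"
    using is_chartD(4)[OF assms(1)] homeomorphic_map_maps by blast
  have "compactin (top_of_set (snd c ` fst c)) K"
    using assms(2,3) by (simp add: compactin_subtopology)
  moreover have "continuous_map (top_of_set (snd c ` fst c)) (subtopology X (fst c)) g"
    using g by (simp add: homeomorphic_maps_def)
  ultimately have "compactin (subtopology X (fst c)) (g ` K)" by (rule image_compactin)
  then have "compactin X (g ` K)" using compactin_subtopology by blast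
  moreover have "g ` K = {p \<in> fst c. snd c p \<in> K}"
  proof -
    have gs: "g (snd c p) = p" if "p \<in> fst c" for p
      using g that is_chartD(2)[OF assms(1)] by (auto simp: homeomorphic_maps_def)
    show ?thesis
    proof
      show "g ` K \<subseteq> {p \<in> fst c. snd c p \<in> K}"
        using assms(2) gs by (auto simp: image_iff)
      show "{p \<in> fst c. snd c p \<in> K} \<subseteq> g ` K"
        using gs by (force simp: image_iff)
    qed
  qed
  ultimately show ?thesis by simp
qed

lemma dual_bundle_simps [simp]:
  "lb_index (dual_bundle L) = lb_index L" "lb_dom (dual_bundle L) = lb_dom L"
  "lb_trans (dual_bundle L) = (\<lambda>i j p. inverse (lb_trans L i j p))"
  by (simp_all add: dual_bundle_def)

locale complex_mfd =
  fixes X :: "'a topology" and A :: "('a, 'n::finite) chart set"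
  assumes mfd: "complex_manifold X A"
begin

lemma charts: "c \<in> A \<Longrightarrow> is_chart X c"
  using mfd by (simp add: complex_manifold_def)

lemma charts_cover: "p \<in> topspace X \<Longrightarrow> \<exists>c\<in>A. p \<in> fst c"
  using mfd unfolding complex_manifold_def by blast

lemma in_topspace: "c \<in> A \<Longrightarrow> p \<in> fst c \<Longrightarrow> p \<in> topspace X"
  using is_chartD(2)[OF charts] by blast

lemma openin_chart: "c \<in> A \<Longrightarrow> openin X (fst c)"
  using is_chartD(1)[OF charts] .

lemma transition_holomorphic:
  "c \<in> A \<Longrightarrow> d \<in> A \<Longrightarrow> holomorphic_map (transition c d) (chart_image c (fst d))"
  using mfd by (simp add: complex_manifold_def holomorphic_map_def chart_image_def)

lemma transition_point: "c \<in> A \<Longrightarrow> p \<in> fst c \<Longrightarrow> transition c d (snd c p) = snd d p"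
  by (simp add: transition_def chart_inv_left[OF charts])

lemma chart_inv_transition:
  assumes "c \<in> A" "d \<in> A" "z \<in> chart_image c (fst d)"
  shows "chart_inv d (transition c d z) = chart_inv c z"
proof -
  obtain p where p: "p \<in> fst c" "p \<in> fst d" "z = snd c p"
    using assms(3) by (auto simp: chart_image_def)
  then show ?thesis
    by (simp add: transition_point[OF assms(1)] chart_inv_left[OF charts] assms)
qed

lemma transition_image: "c \<in> A \<Longrightarrow> d \<in> A \<Longrightarrow>
    transition c d ` chart_image c (fst d \<inter> U) \<subseteq> chart_image d U"
  by (auto simp: chart_image_def transition_point)

lemma transition_holomorphic_Int:
  "c \<in> A \<Longrightarrow> d \<in> A \<Longrightarrow> holomorphic_map (transition c d) (chart_image c (fst d \<inter> U))"
  by (rule holomorphic_map_subset[OF transition_holomorphic]) (auto intro: chart_image_mono[THEN subsetD])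

text \<open>Transition maps are holomorphic, hence smooth, so regularity in one chart carries over
  to every other on the overlap.\<close>

lemma Ck_transfer:
  assumes "c \<in> A" "d \<in> A" "openin X U" "Ck_on k (f \<circ> chart_inv d) (chart_image d U)"
  shows "Ck_on k (f \<circ> chart_inv c) (chart_image c (fst d \<inter> U))"
proof -
  have o: "open (chart_image c (fst d \<inter> U))" "open (chart_image d U)"
    using assms by (auto intro!: open_chart_image[OF charts] openin_chart)
  have "Ck_on k (\<lambda>z. (f \<circ> chart_inv d) (transition c d z)) (chart_image c (fst d \<inter> U))"
    by (rule Ck_on_compose[OF o transition_image[OF assms(1,2)] assms(4)
          holomorphic_map_Ck_on[OF transition_holomorphic_Int[OF assms(1,2)] o(1)]])
  moreover have "(f \<circ> chart_inv d) (transition c d z) = (f \<circ> chart_inv c) z"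
    if "z \<in> chart_image c (fst d \<inter> U)" for z
    using chart_inv_transition[OF assms(1,2)] that chart_image_mono[of "fst d \<inter> U" "fst d" c] by auto
  ultimately show ?thesis
    using Ck_on_cong[OF o(1), of "\<lambda>z. (f \<circ> chart_inv d) (transition c d z)" "f \<circ> chart_inv c"] by blast
qed

lemma smooth_on_manifold_chart:
  assumes "d \<in> A" "U \<subseteq> fst d" "openin X U" "smooth_on (f \<circ> chart_inv d) (chart_image d U)"
  shows "smooth_on_manifold A f U"
  unfolding smooth_on_manifold_def smooth_on_def
proof (intro ballI allI)
  fix c k assume "c \<in> A"
  from Ck_transfer[OF this assms(1,3), of k f] assms(2,4)
  show "Ck_on k (f \<circ> chart_inv c) (snd c ` (fst c \<inter> U))"
    by (simp add: smooth_on_def Int_absorb1 chart_image_def Int_absorb2)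
qed

lemma smooth_on_manifoldD:
  "smooth_on_manifold A f U \<Longrightarrow> c \<in> A \<Longrightarrow> Ck_on k (\<lambda>z. f (chart_inv c z)) (chart_image c U)"
  by (simp add: smooth_on_manifold_def smooth_on_def chart_image_def o_def)

section \<open>Jacobians of coordinate changes\<close>

lemma jacobian_mult:
  assumes "c \<in> A" "d \<in> A" "p \<in> fst c" "p \<in> fst d"
  shows "jacobian c d p *v v = d_transition c d p v"
  unfolding jacobian_def d_transition_def
  by (rule fderiv_eq_matrix[OF transition_holomorphic]) (auto intro: assms chart_imageI)

lemma d_transition_chain:
  assumes "c \<in> A" "d \<in> A" "e \<in> A" "p \<in> fst c" "p \<in> fst d" "p \<in> fst e"
  shows "d_transition c e p v = d_transition d e p (d_transition c d p v)"
proof -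
  let ?S = "chart_image c (fst d \<inter> fst e)"
  have o: "open ?S" using assms by (auto intro!: open_chart_image[OF charts] openin_chart)
  have pS: "snd c p \<in> ?S" using assms by (auto intro: chart_imageI)
  have 1: "(transition c d has_derivative d_transition c d p) (at (snd c p))"
    unfolding d_transition_def
    by (rule holomorphic_mapD(1)[OF transition_holomorphic]) (use assms in \<open>auto intro: chart_imageI\<close>)
  have 2: "(transition d e has_derivative d_transition d e p) (at (transition c d (snd c p)))"
    unfolding transition_point[OF assms(1,4)] d_transition_def
    by (rule holomorphic_mapD(1)[OF transition_holomorphic]) (use assms in \<open>auto intro: chart_imageI\<close>)
  from has_derivative_compose[OF 1 2]
  have "(transition c e has_derivative (\<lambda>v. d_transition d e p (d_transition c d p v))) (at (snd c p))"
  proof (rule has_derivative_transform_within_open[OF _ o pS])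
    fix z assume "z \<in> ?S"
    then have "z \<in> chart_image c (fst d)" using chart_image_mono[of "fst d \<inter> fst e" "fst d" c] by blast
    from chart_inv_transition[OF assms(1,2) this]
    show "transition d e (transition c d z) = transition c e z"
      by (simp add: transition_def)
  qed
  from has_derivative_imp_fderiv[OF this] show ?thesis by (simp add: d_transition_def)
qed

lemma jacobian_chain:
  assumes "c \<in> A" "d \<in> A" "e \<in> A" "p \<in> fst c" "p \<in> fst d" "p \<in> fst e"
  shows "jacobian c e p = jacobian d e p ** jacobian c d p"
  unfolding matrix_eq
  by (simp add: jacobian_mult assms d_transition_chain[OF assms] flip: matrix_vector_mul_assoc)

lemma jacobian_self:
  assumes "c \<in> A" "p \<in> fst c"
  shows "jacobian c c p = mat 1"
proof -
  let ?S = "chart_image c (fst c)"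
  have o: "open ?S" using assms by (auto intro!: open_chart_image[OF charts] openin_chart)
  have "((\<lambda>z. z) has_derivative (\<lambda>v. v)) (at (snd c p))" by simp
  then have "(transition c c has_derivative (\<lambda>v. v)) (at (snd c p))"
    by (rule has_derivative_transform_within_open[OF _ o])
      (use assms in \<open>auto intro!: chart_imageI simp: transition_point chart_image_def\<close>)
  from has_derivative_imp_fderiv[OF this] have "d_transition c c p = (\<lambda>v. v)" by (simp add: d_transition_def)
  then show ?thesis
    unfolding matrix_eq by (simp add: jacobian_mult assms)
qed

lemma jacobian_inverse:
  assumes "c \<in> A" "d \<in> A" "p \<in> fst c" "p \<in> fst d"
  shows "jacobian d c p ** jacobian c d p = mat 1"
  using jacobian_chain[of c d c p] jacobian_self[of c p] assms by simp

lemma jacobian_invertible: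
  assumes "c \<in> A" "d \<in> A" "p \<in> fst c" "p \<in> fst d"
  shows "invertible (jacobian c d p)"
  using jacobian_inverse[OF assms] jacobian_inverse[of d c p] assms unfolding invertible_def by blast

lemma ddbar_transform:
  assumes "c \<in> A" "d \<in> A" "p \<in> fst c" "p \<in> fst d" "p \<in> U" "openin X U"
    and "Ck_on 2 (\<lambda>z. f (chart_inv d z)) (chart_image d U)"
  shows "ddbar c f p = transpose (jacobian c d p) ** ddbar d f p ** cnj_matrix (jacobian c d p)"
proof -
  let ?S = "chart_image c (fst d \<inter> U)"
  have o: "open ?S" "open (chart_image d U)"
    using assms by (auto intro!: open_chart_image[OF charts] openin_chart)
  have pS: "snd c p \<in> ?S" using assms by (auto intro: chart_imageI)
  have "levi (\<lambda>z. f (chart_inv c z)) (snd c p) = levi (\<lambda>z. f (chart_inv d (transition c d z))) (snd c p)"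
  proof (rule levi_cong[OF o(1) pS])
    show "f (chart_inv c z) = f (chart_inv d (transition c d z))" if "z \<in> ?S" for z
      using chart_inv_transition[OF assms(1,2), of z] that chart_image_mono[of "fst d \<inter> U" "fst d" c] by auto
    show "Ck_on 2 (\<lambda>z. f (chart_inv c z)) ?S"
      using Ck_transfer[OF assms(1,2,6), of 2 f] assms(7) by (simp add: o_def)
  qed
  also have "\<dots> = transpose (jacobian c d p) ** ddbar d f p ** cnj_matrix (jacobian c d p)"
    using levi_compose_holomorphic[OF transition_holomorphic_Int[OF assms(1,2)] o(1)
        transition_image[OF assms(1,2)] o(2) assms(7) pS]
    by (simp add: jacobian_def d_transition_def ddbar_eq_levi transition_point[OF assms(1,3)])
  finally show ?thesis by (simp add: ddbar_eq_levi)
qed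

section \<open>The canonical bundle and curvature of line bundles\<close>

text \<open>The entries of \<open>jacobian d e\<close> are derivatives of holomorphic functions in
  the coordinates of \<open>d\<close>; composition with \<open>transition c d\<close> carries this
  to an arbitrary chart \<open>c\<close>.\<close>

lemma det_jacobian_holomorphic:
  assumes "d \<in> A" "e \<in> A"
  shows "holomorphic_on_manifold A (\<lambda>p. det (jacobian d e p)) (fst d \<inter> fst e)"
  unfolding holomorphic_on_manifold_def
proof
  fix c assume c: "c \<in> A"
  let ?J = "\<lambda>w. matrix (fderiv (transition d e) w)"
  have o: "open (chart_image d (fst e))" "open (chart_image c (fst d \<inter> fst e))"
    using assms c by (auto intro!: open_chart_image[OF charts] openin_chart)
  have hol: "mv_holomorphic_on (\<lambda>w. det (?J w)) (chart_image d (fst e))"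
  proof (rule mv_holomorphic_det)
    fix i j
    have "mv_holomorphic_on (\<lambda>w. fderiv (\<lambda>z. transition d e z $ i) w (axis j 1)) (chart_image d (fst e))"
      using transition_holomorphic[OF assms] o(1)
      by (intro mv_holomorphic_fderiv) (auto simp: holomorphic_map_def)
    then show "mv_holomorphic_on (\<lambda>w. ?J w $ i $ j) (chart_image d (fst e))"
      by (rule mv_holomorphic_cong[OF o(1), rotated])
        (simp add: matrix_def holomorphic_mapD(3)[OF transition_holomorphic[OF assms]])
  qed
  have "mv_holomorphic_on (\<lambda>z. det (?J (transition c d z))) (chart_image c (fst d \<inter> fst e))"
    by (rule mv_holomorphic_compose[OF transition_holomorphic_Int[OF c assms(1)] hol transition_image[OF c assms(1)]])
  then have "mv_holomorphic_on ((\<lambda>p. det (jacobian d e p)) \<circ> chart_inv c) (chart_image c (fst d \<inter> fst e))"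
  proof (rule mv_holomorphic_cong[OF o(2), rotated])
    fix z assume "z \<in> chart_image c (fst d \<inter> fst e)"
    then show "det (?J (transition c d z)) = ((\<lambda>p. det (jacobian d e p)) \<circ> chart_inv c) z"
      by (auto simp: chart_image_def jacobian_def d_transition_def transition_point c chart_inv_left[OF charts])
  qed
  then show "mv_holomorphic_on ((\<lambda>p. det (jacobian d e p)) \<circ> chart_inv c) (snd c ` (fst c \<inter> (fst d \<inter> fst e)))"
    by (simp add: chart_image_def)
qed

lemma det_jacobian_nonzero:
  "c \<in> A \<Longrightarrow> d \<in> A \<Longrightarrow> p \<in> fst c \<Longrightarrow> p \<in> fst d \<Longrightarrow> det (jacobian c d p) \<noteq> 0"
  using jacobian_invertible invertible_det_nz by blast

lemma canonical_bundle_simps [simp]: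
  "lb_index (canonical_bundle A) = A" "lb_dom (canonical_bundle A) = fst"
  "lb_trans (canonical_bundle A) = (\<lambda>c d p. det (jacobian c d p))"
  by (simp_all add: canonical_bundle_def)

abbreviation "K_dual \<equiv> dual_bundle (canonical_bundle A)"

lemma canonical_bundle_holomorphic: "holomorphic_line_bundle X A (canonical_bundle A)"
  unfolding holomorphic_line_bundle_def canonical_bundle_simps
proof (intro conjI ballI)
  show "(\<Union>i\<in>A. fst i) = topspace X" using mfd by (simp add: complex_manifold_def)
next
  fix c d e p assume "c \<in> A" "d \<in> A" "e \<in> A" "p \<in> fst c \<inter> fst d \<inter> fst e"
  \<comment> \<open>The cocycle condition is the chain rule; the opposite order of the matrix
    factors is immaterial for determinants.\<close>
  then show "det (jacobian c e p) = det (jacobian c d p) * det (jacobian d e p)"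
    using jacobian_chain[of c d e p] by (simp add: det_mul mult.commute)
qed (auto simp: openin_chart det_jacobian_holomorphic det_jacobian_nonzero jacobian_self)

lemma dual_bundle_holomorphic:
  assumes "holomorphic_line_bundle X A L"
  shows "holomorphic_line_bundle X A (dual_bundle L)"
  unfolding holomorphic_line_bundle_def dual_bundle_simps
proof (intro conjI ballI)
  fix i j assume ij: "i \<in> lb_index L" "j \<in> lb_index L"
  have nz: "p \<in> lb_dom L i \<inter> lb_dom L j \<Longrightarrow> lb_trans L i j p \<noteq> 0" for p
    using assms ij unfolding holomorphic_line_bundle_def by blast
  show "holomorphic_on_manifold A (\<lambda>p. inverse (lb_trans L i j p)) (lb_dom L i \<inter> lb_dom L j)"
    unfolding holomorphic_on_manifold_def o_def
  proof (intro ballI mv_holomorphic_inverse)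
    fix c assume c: "c \<in> A"
    show "mv_holomorphic_on (\<lambda>z. lb_trans L i j (chart_inv c z)) (snd c ` (fst c \<inter> (lb_dom L i \<inter> lb_dom L j)))"
      using assms ij c unfolding holomorphic_line_bundle_def holomorphic_on_manifold_def o_def by blast
    fix z assume "z \<in> snd c ` (fst c \<inter> (lb_dom L i \<inter> lb_dom L j))"
    then show "lb_trans L i j (chart_inv c z) \<noteq> 0"
      using nz by (auto simp: chart_inv_left[OF charts[OF c]])
  qed
  show "inverse (lb_trans L i j p) \<noteq> 0" if "p \<in> lb_dom L i \<inter> lb_dom L j" for p
    using nz[OF that] by simp
next
  fix i j k p assume "i \<in> lb_index L" "j \<in> lb_index L" "k \<in> lb_index L"
    "p \<in> lb_dom L i \<inter> lb_dom L j \<inter> lb_dom L k"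
  then have "lb_trans L i k p = lb_trans L i j p * lb_trans L j k p"
    using assms unfolding holomorphic_line_bundle_def by blast
  then show "inverse (lb_trans L i k p) = inverse (lb_trans L i j p) * inverse (lb_trans L j k p)"
    by (simp only: inverse_mult_distrib)
next
  fix i p assume "i \<in> lb_index L" "p \<in> lb_dom L i"
  then have "lb_trans L i i p = 1" using assms unfolding holomorphic_line_bundle_def by blast
  then show "inverse (lb_trans L i i p) = 1" by simp
qed (use assms in \<open>unfold holomorphic_line_bundle_def, blast+\<close>)

section \<open>Metrics on line bundles and their curvature\<close>

lemma line_metricD:
  assumes "line_metric A L h" "i \<in> lb_index L"
  shows "p \<in> lb_dom L i \<Longrightarrow> h i p > 0" "smooth_on_manifold A (h i) (lb_dom L i)"
    "j \<in> lb_index L \<Longrightarrow> p \<in> lb_dom L i \<inter> lb_dom L j \<Longrightarrow> h j p = (cmod (lb_trans L i j p))\<^sup>2 * h i p"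
  using assms unfolding line_metric_def by blast+

lemma line_metric_log:
  assumes L: "holomorphic_line_bundle X A L" "line_metric A L h"
    and i: "i \<in> lb_index L" and c: "c \<in> A"
  shows "Ck_on k (\<lambda>z. ln (h i (chart_inv c z))) (chart_image c (lb_dom L i))"
proof (rule Ck_on_real_compose[where T = "{0<..}", OF _ _ _ Ck_on_ln])
  show "open (chart_image c (lb_dom L i))"
    using L(1) i by (intro open_chart_image[OF charts[OF c]]) (auto simp: holomorphic_line_bundle_def)
  show "Ck_on k (\<lambda>z. h i (chart_inv c z)) (chart_image c (lb_dom L i))"
    by (rule smooth_on_manifoldD[OF line_metricD(2)[OF L(2) i] c])
  show "h i (chart_inv c z) \<in> {0<..}" if "z \<in> chart_image c (lb_dom L i)" for z
    using line_metricD(1)[OF L(2) i] that by (auto simp: chart_image_def chart_inv_left[OF charts[OF c]])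
qed simp

text \<open>On an overlap the logarithms of the local norms differ by
  \<open>ln ((cmod t)\<^sup>2)\<close> for a nowhere vanishing holomorphic \<open>t\<close>, whose
  Levi form is zero.\<close>

lemma line_curvature_frame:
  assumes L: "holomorphic_line_bundle X A L" "line_metric A L h"
    and ij: "i \<in> lb_index L" "j \<in> lb_index L" and c: "c \<in> A" "p \<in> fst c" "p \<in> lb_dom L i" "p \<in> lb_dom L j"
  shows "line_curvature h j c p = line_curvature h i c p"
proof -
  let ?U = "lb_dom L i \<inter> lb_dom L j" let ?S = "chart_image c ?U"
  let ?t = "\<lambda>z. lb_trans L i j (chart_inv c z)"
  have op: "openin X (lb_dom L i)" "openin X (lb_dom L j)"
    using L(1) ij by (auto simp: holomorphic_line_bundle_def)
  then have o: "open ?S" by (intro open_chart_image[OF charts[OF c(1)]]) auto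
  have pS: "snd c p \<in> ?S" using c by (auto intro: chart_imageI)
  have inU: "chart_inv c z \<in> ?U" if "z \<in> ?S" for z
    using that by (auto simp: chart_image_def chart_inv_left[OF charts[OF c(1)]])
  have t: "mv_holomorphic_on ?t ?S"
    using L(1) ij c(1) unfolding holomorphic_line_bundle_def holomorphic_on_manifold_def o_def chart_image_def by blast
  have t0: "?t z \<noteq> 0" if "z \<in> ?S" for z
    using inU[OF that] L(1) ij unfolding holomorphic_line_bundle_def by blast
  have hi: "Ck_on 2 (\<lambda>z. ln (h i (chart_inv c z))) ?S"
    by (rule Ck_on_subset[OF line_metric_log[OF L ij(1) c(1)]]) (auto intro!: chart_image_mono)
  have hj: "Ck_on 2 (\<lambda>z. ln (h j (chart_inv c z))) ?S"
    by (rule Ck_on_subset[OF line_metric_log[OF L ij(2) c(1)]]) (auto intro!: chart_image_mono)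
  have eq: "ln (h j (chart_inv c z)) = ln ((cmod (?t z))\<^sup>2) + ln (h i (chart_inv c z))" if "z \<in> ?S" for z
  proof -
    have "h j (chart_inv c z) = (cmod (?t z))\<^sup>2 * h i (chart_inv c z)"
      using line_metricD(3)[OF L(2) ij] inU[OF that] by blast
    moreover have "h i (chart_inv c z) > 0"
      using line_metricD(1)[OF L(2) ij(1)] inU[OF that] by blast
    ultimately show ?thesis using t0[OF that] by (simp add: ln_mult)
  qed
  have "levi (\<lambda>z. ln (h j (chart_inv c z))) (snd c p) =
      levi (\<lambda>z. ln ((cmod (?t z))\<^sup>2) + ln (h i (chart_inv c z))) (snd c p)"
    by (rule levi_cong[OF o pS eq hj])
  also have "\<dots> = levi (\<lambda>z. ln ((cmod (?t z))\<^sup>2)) (snd c p) + levi (\<lambda>z. ln (h i (chart_inv c z))) (snd c p)"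
    by (rule levi_add[OF o pS Ck_on_log_cmod_holomorphic[OF t o t0] hi])
  also have "levi (\<lambda>z. ln ((cmod (?t z))\<^sup>2)) (snd c p) = 0"
    by (rule levi_log_cmod[OF t o t0 pS])
  finally show ?thesis by (simp add: line_curvature_def ddbar_eq_levi)
qed

lemma line_curvature_transform:
  assumes L: "holomorphic_line_bundle X A L" "line_metric A L h" and i: "i \<in> lb_index L" "p \<in> lb_dom L i"
    and cd: "c \<in> A" "d \<in> A" "p \<in> fst c" "p \<in> fst d"
  shows "line_curvature h i c p =
    transpose (jacobian c d p) ** line_curvature h i d p ** cnj_matrix (jacobian c d p)"
proof -
  have op: "openin X (lb_dom L i)" using L(1) i by (auto simp: holomorphic_line_bundle_def)
  have neg: "transpose J ** (- M) ** K = - (transpose J ** M ** K)" for J M K :: "complex ^ 'n ^ 'n"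
    by (simp add: matrix_matrix_mult_def vec_eq_iff sum_negf)
  show ?thesis
    unfolding line_curvature_def neg
    using ddbar_transform[OF cd i(2) op line_metric_log[OF L i(1) cd(2)]] by simp
qed

text \<open>\<open>RC_positive\<close> quantifies over all charts and frames. Curvature is
  independent of the frame and changes by congruence with the chart, so one suitable pair at each
  point is enough.\<close>

lemma RC_positiveI:
  assumes L: "holomorphic_line_bundle X A L" "line_metric A L h"
    and pos: "\<And>p. p \<in> topspace X \<Longrightarrow> \<exists>c\<in>A. \<exists>i\<in>lb_index L. p \<in> fst c \<and> p \<in> lb_dom L i \<and> pos_dir (line_curvature h i c p)"
  shows "RC_positive X A L"
proof -
  have "has_positive_eigenvalue (line_curvature h j d p)"
    if d: "d \<in> A" "j \<in> lb_index L" "p \<in> fst d" "p \<in> lb_dom L j" for d j p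
  proof -
    obtain c i where c: "c \<in> A" "i \<in> lb_index L" "p \<in> fst c" "p \<in> lb_dom L i" "pos_dir (line_curvature h i c p)"
      using pos[OF in_topspace[OF d(1,3)]] by blast
    have "pos_dir (line_curvature h i d p)"
      unfolding line_curvature_transform[OF L c(2,4) d(1) c(1) d(3) c(3)]
      by (rule pos_dir_congruence[OF c(5) jacobian_invertible[OF d(1) c(1) d(3) c(3)]])
    then have "pos_dir (line_curvature h j d p)"
      using line_curvature_frame[OF L c(2) d(2) d(1,3) c(4) d(4)] by simp
    moreover have "hermitian (line_curvature h j d p)"
    proof -
      have "openin X (lb_dom L j)" using L(1) d by (auto simp: holomorphic_line_bundle_def)
      then show ?thesis
        unfolding line_curvature_def ddbar_eq_levi
        by (intro hermitian_minus levi_hermitian[OF line_metric_log[OF L d(2,1)]])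
          (use d in \<open>auto intro: chart_imageI open_chart_image[OF charts]\<close>)
    qed
    ultimately show ?thesis by (rule pos_dir_imp_positive_eigenvalue[rotated])
  qed
  then show ?thesis unfolding RC_positive_def using L by blast
qed

end

text \<open>In an orthonormal frame the determinant is 1, and the change of frame multiplies it by
  the positive number \<open>(cmod (det P))\<^sup>2\<close>.\<close>

lemma det_hermitian_pos_def:
  assumes "hermitian_pos_def (G :: complex ^ 'n::finite ^ 'n)"
  shows "Re (det G) > 0"
proof -
  obtain P where P: "transpose P ** G ** cnj_matrix P = mat 1"
    using orthonormal_frame[OF assms] .
  have "det (transpose P ** G ** cnj_matrix P) = 1" by (simp add: P)
  then have eq: "det P * det G * cnj (det P) = 1" by (simp add: det_mul det_cnj_matrix)
  then have nz: "det P \<noteq> 0" by auto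
  have "complex_of_real ((cmod (det P))\<^sup>2) * det G = 1"
    using eq unfolding complex_norm_square by (simp add: mult_ac)
  then have "det G = complex_of_real (1 / (cmod (det P))\<^sup>2)"
    using nz by (simp add: field_simps)
  then show "Re (det G) > 0" using nz by auto
qed

lemma cmod_inverse_square: "(cmod (inverse x))\<^sup>2 = inverse ((cmod x)\<^sup>2)"
  by (simp only: norm_inverse power_inverse)

section \<open>A function with positive Laplacian off a small set\<close>

locale hermitian_mfd = complex_mfd X A
  for X :: "'a topology" and A :: "('a, 'n::finite) chart set" +
  fixes \<omega> :: "('a, 'n) metric"
  assumes metric: "hermitian_metric A \<omega>"
begin

lemma metric_pos: "c \<in> A \<Longrightarrow> p \<in> fst c \<Longrightarrow> hermitian_pos_def (\<omega> c p)"
  using metric unfolding hermitian_metric_def by blast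

lemma metric_transform: "c \<in> A \<Longrightarrow> d \<in> A \<Longrightarrow> p \<in> fst c \<Longrightarrow> p \<in> fst d \<Longrightarrow>
    \<omega> c p = transpose (jacobian c d p) ** \<omega> d p ** cnj_matrix (jacobian c d p)"
  using metric unfolding hermitian_metric_def by blast

lemma metric_Ck: "c \<in> A \<Longrightarrow> Ck_on k (\<lambda>z. \<omega> c (chart_inv c z)) (snd c ` fst c)"
  using metric unfolding hermitian_metric_def smooth_on_def o_def by blast

lemma open_chart_range: "c \<in> A \<Longrightarrow> open (snd c ` fst c)"
  using charts by (simp add: is_chart_def)

lemma metric_entry_continuous: "c \<in> A \<Longrightarrow> continuous_on (snd c ` fst c) (\<lambda>z. \<omega> c (chart_inv c z) $ i $ j)"
  using Ck_on_vec_nth[OF open_chart_range Ck_on_vec_nth[OF open_chart_range metric_Ck]] Ck_on.simps(1) by blast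

text \<open>Up to a constant the local density of the volume form, and at the same time the squared
  norm of the local frame of the anticanonical bundle for the metric induced by
  \<open>\<omega>\<close>.\<close>

definition vol :: "('a, 'n) chart \<Rightarrow> 'a \<Rightarrow> real" where
  "vol c p = Re (det (\<omega> c p))"

lemma vol_pos: "c \<in> A \<Longrightarrow> p \<in> fst c \<Longrightarrow> vol c p > 0"
  unfolding vol_def by (rule det_hermitian_pos_def[OF metric_pos])

lemma metric_det_nonzero: "c \<in> A \<Longrightarrow> p \<in> fst c \<Longrightarrow> det (\<omega> c p) \<noteq> 0"
  using vol_pos[of c p] unfolding vol_def by auto

lemma metric_invertible: "c \<in> A \<Longrightarrow> p \<in> fst c \<Longrightarrow> invertible (\<omega> c p)"
  using metric_det_nonzero invertible_det_nz by blast

lemma vol_transform: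
  assumes "c \<in> A" "d \<in> A" "p \<in> fst c" "p \<in> fst d"
  shows "vol c p = (cmod (det (jacobian c d p)))\<^sup>2 * vol d p"
proof -
  have "det (\<omega> c p) = det (jacobian c d p) * det (\<omega> d p) * cnj (det (jacobian c d p))"
    unfolding metric_transform[OF assms] by (simp add: det_mul det_cnj_matrix)
  also have "\<dots> = complex_of_real ((cmod (det (jacobian c d p)))\<^sup>2) * det (\<omega> d p)"
    unfolding complex_norm_square by (simp add: mult_ac)
  finally show ?thesis unfolding vol_def by simp
qed

lemma vol_Ck: "c \<in> A \<Longrightarrow> Ck_on k (\<lambda>z. vol c (chart_inv c z)) (snd c ` fst c)"
  unfolding vol_def
  by (rule Ck_on_bounded_linear[OF bounded_linear_Re open_chart_range Ck_on_det[OF open_chart_range metric_Ck]])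

lemma log_vol_Ck:
  assumes "c \<in> A"
  shows "Ck_on k (\<lambda>z. ln (vol c (chart_inv c z))) (snd c ` fst c)"
  by (rule Ck_on_real_compose[OF open_chart_range[OF assms] _ _ Ck_on_ln vol_Ck[OF assms]])
    (auto simp: vol_pos assms chart_inv_in)

lemma ricci_eq: "ricci \<omega> c p = - levi (\<lambda>z. ln (vol c (chart_inv c z))) (snd c p)"
  by (simp add: ricci_def ddbar_eq_levi vol_def)

section \<open>Globally smooth functions and their Laplacian\<close>

definition global_smooth :: "('a \<Rightarrow> real) \<Rightarrow> bool" where
  "global_smooth f \<longleftrightarrow> (\<forall>c\<in>A. smooth_on (\<lambda>z. f (chart_inv c z)) (snd c ` fst c))"

lemma global_smoothD: "global_smooth f \<Longrightarrow> c \<in> A \<Longrightarrow> Ck_on k (\<lambda>z. f (chart_inv c z)) (snd c ` fst c)"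
  by (simp add: global_smooth_def smooth_on_def)

lemma global_smooth_add: "global_smooth f \<Longrightarrow> global_smooth g \<Longrightarrow> global_smooth (\<lambda>p. f p + g p)"
  by (auto simp: global_smooth_def smooth_on_def intro!: Ck_on_add open_chart_range)

lemma global_smooth_cmult: "global_smooth f \<Longrightarrow> global_smooth (\<lambda>p. r * f p)"
  by (auto simp: global_smooth_def smooth_on_def intro!: Ck_on_mult Ck_on_const open_chart_range)

lemma global_smooth_0: "global_smooth (\<lambda>p. 0)"
  by (auto simp: global_smooth_def smooth_on_def intro!: Ck_on_const open_chart_range)

abbreviation metric_trace :: "('a, 'n) chart \<Rightarrow> 'a \<Rightarrow> complex ^ 'n ^ 'n \<Rightarrow> real" where
  "metric_trace c p M \<equiv> Re (trace (matrix_inv (\<omega> c p) ** M))"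

text \<open>The complex Laplacian of the metric, computed in the chart \<open>c\<close>; for a
  globally smooth function the chart does not matter by \<open>lap_chart\<close>.\<close>

definition lap :: "('a, 'n) chart \<Rightarrow> ('a \<Rightarrow> real) \<Rightarrow> 'a \<Rightarrow> real" where
  "lap c f p = metric_trace c p (ddbar c f p)"

lemma lap_chart:
  assumes "global_smooth f" "c \<in> A" "d \<in> A" "p \<in> fst c" "p \<in> fst d"
  shows "lap c f p = lap d f p"
proof -
  have "Ck_on 2 (\<lambda>z. f (chart_inv d z)) (chart_image d (fst d))"
    using global_smoothD[OF assms(1,3)] by (simp add: chart_image_def)
  from ddbar_transform[OF assms(2-5) assms(5) openin_chart[OF assms(3)] this]
  show ?thesis
    unfolding lap_def metric_transform[OF assms(2-5)]
    by (simp add: trace_congruence[OF jacobian_invertible[OF assms(2-5)] metric_invertible[OF assms(3,5)]])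
qed

lemma lap_add:
  assumes "global_smooth f" "global_smooth g" "c \<in> A" "p \<in> fst c"
  shows "lap c (\<lambda>p. f p + g p) p = lap c f p + lap c g p"
  unfolding lap_def ddbar_eq_levi
  using levi_add[OF open_chart_range[OF assms(3)] _ global_smoothD[OF assms(1,3)] global_smoothD[OF assms(2,3)], of "snd c p"]
    assms(4) by (simp add: matrix_add_trace)

lemma lap_cmult:
  assumes "global_smooth f" "c \<in> A" "p \<in> fst c"
  shows "lap c (\<lambda>p. r * f p) p = r * lap c f p"
  unfolding lap_def ddbar_eq_levi
  using levi_cmult[OF open_chart_range[OF assms(2)] _ global_smoothD[OF assms(1,2)], of "snd c p"]
    assms(3) by (simp add: matrix_scale_trace)

lemma lap_sum:
  assumes "finite I" "\<And>i. i \<in> I \<Longrightarrow> global_smooth (f i)" "c \<in> A" "p \<in> fst c"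
  shows "global_smooth (\<lambda>p. \<Sum>i\<in>I. f i p)" "lap c (\<lambda>p. \<Sum>i\<in>I. f i p) p = (\<Sum>i\<in>I. lap c (f i) p)"
proof -
  have "global_smooth (\<lambda>p. \<Sum>i\<in>I. f i p) \<and> lap c (\<lambda>p. \<Sum>i\<in>I. f i p) p = (\<Sum>i\<in>I. lap c (f i) p)"
    using assms(1,2)
  proof (induction I rule: finite_induct)
    case empty
    have "lap c (\<lambda>p. 0) p = 0" using lap_cmult[OF global_smooth_0 assms(3,4), of 0] by simp
    then show ?case by (simp add: global_smooth_0)
  next
    case (insert i I)
    then show ?case by (simp add: global_smooth_add lap_add[OF _ _ assms(3,4)])
  qed
  then show "global_smooth (\<lambda>p. \<Sum>i\<in>I. f i p)" "lap c (\<lambda>p. \<Sum>i\<in>I. f i p) p = (\<Sum>i\<in>I. lap c (f i) p)"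
    by auto
qed

lemma trace_metric_continuous:
  assumes "c \<in> A" "S \<subseteq> snd c ` fst c" "\<And>i j. continuous_on S (\<lambda>z. M z $ i $ j)"
  shows "continuous_on S (\<lambda>z. metric_trace c (chart_inv c z) (M z))"
proof (intro continuous_on_Re continuous_trace_matrix_inv assms(3)
    continuous_on_subset[OF metric_entry_continuous[OF assms(1)] assms(2)])
  show "det (\<omega> c (chart_inv c z)) \<noteq> 0" if "z \<in> S" for z
    using metric_det_nonzero[OF assms(1) chart_inv_in] assms(2) that by blast
qed

lemma lap_continuous:
  assumes "global_smooth f" "c \<in> A"
  shows "continuous_on (snd c ` fst c) (\<lambda>z. lap c f (chart_inv c z))"
proof -
  have "continuous_on (snd c ` fst c)
      (\<lambda>z. metric_trace c (chart_inv c z) (levi (\<lambda>z. f (chart_inv c z)) z))"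
    by (rule trace_metric_continuous[OF assms(2) subset_refl levi_continuous[OF global_smoothD[OF assms] open_chart_range[OF assms(2)]]])
  then show ?thesis
    by (rule iffD1[OF continuous_on_cong, rotated -1]) (auto simp: lap_def ddbar_eq_levi chart_inv_right)
qed

lemma lap_pos_open:
  assumes "global_smooth f" "c \<in> A"
  shows "openin X {p \<in> fst c. lap c f p > 0}"
proof -
  have "open {z \<in> snd c ` fst c. lap c f (chart_inv c z) > 0}"
    using continuous_openin_preimage_gen[OF lap_continuous[OF assms], of "{0<..}"]
      openin_open_trans[OF _ open_chart_range[OF assms(2)]] by (simp add: vimage_def Collect_conj_eq)
  note openin_chart_preimage[OF charts[OF assms(2)] this]
  moreover have "{p \<in> fst c. snd c p \<in> {z \<in> snd c ` fst c. lap c f (chart_inv c z) > 0}} = {p \<in> fst c. lap c f p > 0}"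
  proof (rule Collect_cong)
    fix p show "p \<in> fst c \<and> snd c p \<in> {z \<in> snd c ` fst c. lap c f (chart_inv c z) > 0} \<longleftrightarrow> p \<in> fst c \<and> lap c f p > 0"
    proof (cases "p \<in> fst c")
      case True
      then have "snd c p \<in> snd c ` fst c" by blast
      then show ?thesis by (simp add: True chart_inv_left[OF charts[OF assms(2)] True])
    qed simp
  qed
  ultimately show ?thesis by simp
qed

end

section \<open>The Levi form of a radial bump\<close>

lemma flat_deriv: "(flat m has_derivative (\<lambda>v. (flat (m + 2) t - m * flat (m + 1) t) * v)) (at t)"
  using flat_has_derivative by (simp add: has_field_derivative_def)

lemma flat0_fderiv: "fderiv (flat 0) t v = flat 2 t * v"
  using has_derivative_imp_fderiv[OF flat_deriv[of 0 t]] by (simp add: numeral_2_eq_2)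

lemma flat0_hess: "hess (flat 0) t a b = (flat 4 t - 2 * flat 3 t) * a * b"
proof -
  have "((\<lambda>t. flat 2 t * b) has_derivative (\<lambda>v. (flat (2 + 2) t - real 2 * flat (2 + 1) t) * v * b)) (at t)"
    by (rule has_derivative_mult_left[OF flat_deriv])
  from has_derivative_imp_fderiv[OF this] show ?thesis
    by (simp add: hess_def flat0_fderiv)
qed

text \<open>Division by \<open>\<beta>\<close> lets the single function \<open>flat 0\<close> serve
  for bumps of every steepness.\<close>

definition bump_arg :: "'v::real_inner \<Rightarrow> real \<Rightarrow> real \<Rightarrow> 'v \<Rightarrow> real" where
  "bump_arg z0 R \<beta> z = (R\<^sup>2 - (z - z0) \<bullet> (z - z0)) / \<beta>"

lemma bump_arg_derivative:
  "(bump_arg z0 R \<beta> has_derivative (\<lambda>v. - (2 / \<beta>) * ((z - z0) \<bullet> v))) (at z)"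
proof -
  have "((\<lambda>z. (1 / \<beta>) * (R\<^sup>2 - (z - z0) \<bullet> (z - z0))) has_derivative
      (\<lambda>v. (1 / \<beta>) * (0 - ((z - z0) \<bullet> (v - 0) + (v - 0) \<bullet> (z - z0))))) (at z)"
    by (intro has_derivative_mult_right has_derivative_diff has_derivative_const has_derivative_inner
        has_derivative_ident)
  moreover have "(1 / \<beta>) * (0 - ((z - z0) \<bullet> (v - 0) + (v - 0) \<bullet> (z - z0))) = - (2 / \<beta>) * ((z - z0) \<bullet> v)" for v
    by (simp add: inner_commute[of v] field_simps)
  moreover have "(\<lambda>z. (1 / \<beta>) * (R\<^sup>2 - (z - z0) \<bullet> (z - z0))) = bump_arg z0 R \<beta>"
    by (simp add: bump_arg_def fun_eq_iff)
  ultimately show ?thesis by simp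
qed

lemma bump_arg_fderiv: "fderiv (bump_arg z0 R \<beta>) z v = - (2 / \<beta>) * ((z - z0) \<bullet> v)"
  using has_derivative_imp_fderiv[OF bump_arg_derivative] by metis

lemma bump_arg_hess: "hess (bump_arg z0 R \<beta>) z a b = - (2 / \<beta>) * (a \<bullet> b)"
proof -
  have "((\<lambda>z. - (2 / \<beta>) * ((z - z0) \<bullet> b)) has_derivative (\<lambda>a. - (2 / \<beta>) * ((a - 0) \<bullet> b))) (at z)"
    by (intro has_derivative_mult_right has_derivative_inner_left has_derivative_diff has_derivative_const has_derivative_ident)
  from has_derivative_imp_fderiv[OF this] show ?thesis by (simp add: hess_def bump_arg_fderiv)
qed

lemma bump_arg_Ck: "open S \<Longrightarrow> Ck_on k (bump_arg z0 R \<beta>) S"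
  unfolding bump_arg_def divide_inverse
  by (intro Ck_on_mult Ck_on_diff Ck_on_const Ck_on_bilinear[OF bounded_bilinear_inner] Ck_on_ident) auto

lemma flat_bump_Ck: "open S \<Longrightarrow> Ck_on k (\<lambda>z. flat 0 (bump_arg z0 R \<beta> z)) S"
  by (rule Ck_on_real_compose[OF _ open_UNIV _ Ck_on_flat bump_arg_Ck]) auto

text \<open>As a form, this is the squared modulus of the Hermitian pairing with \<open>w\<close>;
  it arises from the product of the first derivatives of \<open>bump_arg\<close>.\<close>

abbreviation rank_one :: "complex ^ 'n::finite \<Rightarrow> complex ^ 'n ^ 'n" where
  "rank_one w \<equiv> \<chi> i j. cnj (w $ i) * w $ j"

text \<open>Chain rule with outer function \<open>flat 0\<close>: its second derivative multiplies
  the gradient term, its first derivative multiplies the Levi form of \<open>bump_arg\<close>, which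
  is \<open>- 1 / \<beta>\<close> times the identity.\<close>

lemma levi_flat_bump:
  assumes "\<beta> > 0"
  shows "levi (\<lambda>z. flat 0 (bump_arg z0 R \<beta> z)) z =
    ((flat 4 (bump_arg z0 R \<beta> z) - 2 * flat 3 (bump_arg z0 R \<beta> z)) / \<beta>\<^sup>2) *\<^sub>R
      rank_one (z - z0)
    + (- flat 2 (bump_arg z0 R \<beta> z) / \<beta>) *\<^sub>R mat 1"
proof -
  have H: "hess (\<lambda>z. flat 0 (bump_arg z0 R \<beta> z)) z a b =
      (flat 4 (bump_arg z0 R \<beta> z) - 2 * flat 3 (bump_arg z0 R \<beta> z)) * (4 / \<beta>\<^sup>2) * ((z - z0) \<bullet> a) * ((z - z0) \<bullet> b)
      - flat 2 (bump_arg z0 R \<beta> z) * (2 / \<beta>) * (a \<bullet> b)" for a b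
  proof -
    have "hess (\<lambda>z. flat 0 (bump_arg z0 R \<beta> z)) z a b =
        hess (flat 0) (bump_arg z0 R \<beta> z) (fderiv (bump_arg z0 R \<beta>) z a) (fderiv (bump_arg z0 R \<beta>) z b)
        + fderiv (flat 0) (bump_arg z0 R \<beta> z) (hess (bump_arg z0 R \<beta>) z a b)"
      by (rule hess_compose[OF open_UNIV open_UNIV subset_UNIV Ck_on_flat bump_arg_Ck[OF open_UNIV] UNIV_I])
    then show ?thesis
      by (simp add: flat0_hess flat0_fderiv bump_arg_hess bump_arg_fderiv power2_eq_square
          algebra_simps diff_divide_distrib add_divide_distrib)
  qed
  have ax: "w \<bullet> axis i (1::complex) = Re (w $ i)" "w \<bullet> (\<i> *s axis i (1::complex)) = Im (w $ i)"
    "(\<i> *s axis i (1::complex)) \<bullet> w = Im (w $ i)" "axis i (1::complex) \<bullet> w = Re (w $ i)"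
    for w :: "complex ^ 'a" and i
    by (simp_all add: inner_axis inner_axis' flip: axis_imaginary)
  define s2 where "s2 = flat 4 (bump_arg z0 R \<beta> z) - 2 * flat 3 (bump_arg z0 R \<beta> z)"
  define s1 where "s1 = flat 2 (bump_arg z0 R \<beta> z)"
  have "levi (\<lambda>z. flat 0 (bump_arg z0 R \<beta> z)) z $ i $ j =
      (s2 / \<beta>\<^sup>2) *\<^sub>R (cnj ((z - z0) $ i) * (z - z0) $ j) + (- s1 / \<beta>) *\<^sub>R (if i = j then 1 else 0)" for i j
    unfolding levi_entry[OF flat_bump_Ck[OF open_UNIV] open_UNIV UNIV_I] sesq_part_def H ax
      s2_def[symmetric] s1_def[symmetric]
    using assms by (auto simp: complex_eq_iff axis_def field_simps)
  then show ?thesis unfolding s1_def s2_def by (simp add: vec_eq_iff mat_def)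
qed

context hermitian_mfd
begin

text \<open>Compactness turns pointwise positivity into a uniform bound. The centre has to be
  excluded because \<open>rank_one (z - z0)\<close> vanishes there; this is why a bump is controlled
  only off an inner ball.\<close>

lemma annulus_bounds:
  assumes c: "c \<in> A" and K: "compact K" "K \<subseteq> snd c ` fst c" "z0 \<notin> K"
  obtains m B where "m > 0" "B > 0"
    "\<And>z. z \<in> K \<Longrightarrow> m \<le> metric_trace c (chart_inv c z) (rank_one (z - z0))"
    "\<And>z. z \<in> K \<Longrightarrow> metric_trace c (chart_inv c z) (mat 1) \<le> B"
proof (cases "K = {}")
  case True
  then show ?thesis using that[of 1 1] by simp
next
  case False
  define t1 where "t1 z = metric_trace c (chart_inv c z) (rank_one (z - z0))" for z
  define t2 where "t2 z = metric_trace c (chart_inv c z) (mat 1)" for z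
  have c1: "continuous_on K t1"
    unfolding t1_def
    by (rule trace_metric_continuous[OF c K(2)]) (simp, intro continuous_intros)
  have c2: "continuous_on K t2"
    unfolding t2_def by (rule trace_metric_continuous[OF c K(2)]) (intro continuous_intros)
  have pos: "t1 z > 0" if "z \<in> K" for z
  proof -
    let ?G = "\<omega> c (chart_inv c z)" let ?w = "z - z0"
    let ?E = "rank_one ?w :: complex ^ 'n ^ 'n"
    have G: "hermitian_pos_def ?G" using K(2) that by (intro metric_pos[OF c] chart_inv_in) auto
    obtain P where P: "transpose P ** ?G ** cnj_matrix P = mat 1" using orthonormal_frame[OF G] .
    define l where "l v = (\<Sum>i\<in>UNIV. cnj (?w $ i) * v $ i)" for v :: "complex ^ 'n"
    have E: "sesq ?E v v = l v * cnj (l v)" for v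
      by (simp add: sesq_def l_def sum_product mult_ac) (rule sum.swap)
    have E': "sesq ?E v v = complex_of_real ((cmod (l v))\<^sup>2)" for v
      unfolding E complex_norm_square ..
    \<comment> \<open>A linear form that vanishes on a frame vanishes identically, whereas
      \<open>l ?w\<close> is the squared norm of \<open>?w\<close>, which is not 0 since
      \<open>z0\<close> lies outside \<open>K\<close>.\<close>
    have "\<exists>k. l (P *v axis k 1) \<noteq> 0"
    proof (rule ccontr)
      assume "\<not> ?thesis"
      then have 0: "l (P *v axis k 1) = 0" for k by blast
      define u where "u = matrix_inv P *v ?w"
      have "?w = P *v u"
        by (simp add: u_def matrix_vector_mul_assoc matrix_inv_inverse[OF frame_inverse(2)[OF P]])
      moreover have "l (P *v u) = (\<Sum>k\<in>UNIV. u $ k * l (P *v axis k 1))"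
      proof -
        have "P *v axis k 1 = column k P" for k by (simp add: matrix_vector_mul_component vec_eq_iff column_def matrix_vector_mult_def axis_def if_distrib sum.delta cong: if_cong)
        then show ?thesis
          unfolding l_def matrix_vector_mult_def column_def
          by (simp add: sum_distrib_left mult_ac) (rule sum.swap)
      qed
      ultimately have "l ?w = 0" by (simp add: 0)
      then have "(\<Sum>i\<in>UNIV. complex_of_real ((cmod (?w $ i))\<^sup>2)) = 0"
        unfolding l_def complex_norm_square by (simp add: mult.commute)
      then have "(\<Sum>i\<in>UNIV. (cmod (?w $ i))\<^sup>2) = 0"
        by (metis of_real_eq_0_iff of_real_sum)
      then have "?w = 0" by (simp add: sum_nonneg_eq_0_iff vec_eq_iff)
      then show False using K(3) that by simp
    qed
    then obtain k where k: "l (P *v axis k 1) \<noteq> 0" by blast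
    have "t1 z = (\<Sum>k\<in>UNIV. (cmod (l (P *v axis k 1)))\<^sup>2)"
      unfolding t1_def trace_frame[OF P] E' by simp
    also have "\<dots> > 0" by (rule sum_pos2[of _ k]) (use k in auto)
    finally show ?thesis .
  qed
  obtain z1 where z1: "z1 \<in> K" "\<forall>z\<in>K. t1 z1 \<le> t1 z"
    using continuous_attains_inf[OF K(1) False c1] by blast
  obtain z2 where z2: "z2 \<in> K" "\<forall>z\<in>K. t2 z \<le> t2 z2"
    using continuous_attains_sup[OF K(1) False c2] by blast
  show ?thesis
  proof (rule that[of "t1 z1" "\<bar>t2 z2\<bar> + 1"])
    show "metric_trace c (chart_inv c z) (mat 1) \<le> \<bar>t2 z2\<bar> + 1" if "z \<in> K" for z
      using z2(2) that unfolding t2_def by (smt (verit))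
  qed (use pos[OF z1(1)] z1(2) in \<open>auto simp: t1_def\<close>)
qed

text \<open>For the bump \<open>exp (- 1 / s)\<close> with \<open>s = (R\<^sup>2 - |z - z0|\<^sup>2) / \<beta>\<close>, the quotient of the second and the first
  derivative in \<open>s\<close> is \<open>(1 - 2 s) / s\<^sup>2\<close>, and \<open>s \<le> R\<^sup>2 / \<beta>\<close>. So for large \<open>\<beta>\<close> the gradient term of the Laplacian,
  bounded below off the inner ball, dominates the term with the first derivative.\<close>

lemma bump_exists:
  assumes c: "c \<in> A" and R: "0 < \<delta>" "\<delta> < R" "cball z0 R \<subseteq> snd c ` fst c" and haus: "Hausdorff_space X"
  shows "\<exists>b. global_smooth b \<and>
    (\<forall>d\<in>A. \<forall>p\<in>fst d. p \<notin> {q \<in> fst c. snd c q \<in> ball z0 R} \<longrightarrow> lap d b p = 0) \<and>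
    (\<forall>p\<in>fst c. snd c p \<in> ball z0 R - ball z0 \<delta> \<longrightarrow> lap c b p > 0)"
proof -
  obtain m B where mB: "m > 0" "B > 0"
    "\<And>z. z \<in> cball z0 R - ball z0 \<delta> \<Longrightarrow> m \<le> metric_trace c (chart_inv c z) (rank_one (z - z0))"
    "\<And>z. z \<in> cball z0 R - ball z0 \<delta> \<Longrightarrow> metric_trace c (chart_inv c z) (mat 1) \<le> B"
    by (rule annulus_bounds[OF c, of "cball z0 R - ball z0 \<delta>" z0])
      (use R in \<open>auto intro!: compact_diff\<close>)
  \<comment> \<open>With \<open>s * \<beta> \<le> R\<^sup>2\<close>, the first entry gives
    \<open>s \<le> 1 / 4\<close>, hence \<open>(1 - 2 * s) * m \<ge> m / 2\<close>; the second gives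
    \<open>s\<^sup>2 * \<beta> * B \<le> m / 4\<close>, which is smaller.\<close>
  define \<beta> where "\<beta> = max (4 * R\<^sup>2) (4 * R ^ 4 * B / m)"
  have \<beta>: "\<beta> > 0" "\<beta> \<ge> 4 * R\<^sup>2" "\<beta> * m \<ge> 4 * R ^ 4 * B"
    using R mB by (auto simp: \<beta>_def less_max_iff_disj max_mult_distrib_right)
  let ?s = "bump_arg z0 R \<beta>"
  define b where "b p = (if p \<in> fst c then flat 0 (?s (snd c p)) else 0)" for p
  define K where "K = {p \<in> fst c. snd c p \<in> cball z0 R}"
  have s_pos: "?s z > 0 \<longleftrightarrow> dist z0 z < R" for z
  proof -
    have "?s z > 0 \<longleftrightarrow> (norm (z - z0))\<^sup>2 < R\<^sup>2"
      using \<beta>(1) by (simp add: bump_arg_def dot_square_norm zero_less_divide_iff)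
    also have "\<dots> \<longleftrightarrow> dist z0 z < R"
      using R power2_less_imp_less[of "norm (z - z0)" R] power_strict_mono[of "norm (z - z0)" R 2]
      by (auto simp: dist_norm norm_minus_commute)
    finally show ?thesis .
  qed
  have bK: "b p = 0" if "p \<notin> {q \<in> fst c. snd c q \<in> ball z0 R}" for p
    using that s_pos[of "snd c p"] by (auto simp: b_def flat_def)
  \<comment> \<open>The chart domain and the complement of \<open>K\<close> are two open sets
    covering the manifold. On the first \<open>b\<close> is the smooth bump, on the second it is
    zero, so \<open>b\<close> is globally smooth.\<close>
  have closedK: "closedin X K"
    unfolding K_def using compactin_imp_closedin[OF haus compactin_chart_ball[OF charts[OF c] R(3) compact_cball]] .
  have oK: "openin X (topspace X - K)" using closedK by blast
  have b_off_K: "b (chart_inv d z) = 0" if d: "d \<in> A" and z: "z \<in> chart_image d (topspace X - K)" for d z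
  proof -
    obtain q where q: "q \<in> fst d" "q \<notin> K" "z = snd d q" using z by (auto simp: chart_image_def)
    have "q \<notin> {q \<in> fst c. snd c q \<in> ball z0 R}" using q(2) by (auto simp: K_def)
    from bK[OF this] show ?thesis by (simp add: q(3) chart_inv_left[OF charts[OF d] q(1)])
  qed
  have b_in_c: "Ck_on k (b \<circ> chart_inv c) (chart_image c (fst c))" for k
  proof -
    have "Ck_on k (\<lambda>z. flat 0 (?s z)) (snd c ` fst c)" by (rule flat_bump_Ck[OF open_chart_range[OF c]])
    then show ?thesis
      using Ck_on_cong[OF open_chart_range[OF c], of "\<lambda>z. flat 0 (?s z)" "b \<circ> chart_inv c" k]
      by (simp add: chart_image_def b_def chart_inv_in chart_inv_right)
  qed
  have gs: "global_smooth b"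
    unfolding global_smooth_def smooth_on_def
  proof (intro ballI allI)
    fix d k assume d: "d \<in> A"
    let ?S1 = "chart_image d (fst c \<inter> fst c)" let ?S2 = "chart_image d (topspace X - K)"
    have o: "open ?S1" "open ?S2"
      using c oK by (auto intro!: open_chart_image[OF charts[OF d]] openin_chart)
    have k1: "Ck_on k (b \<circ> chart_inv d) ?S1"
      by (rule Ck_transfer[OF d c openin_chart[OF c] b_in_c])
    have "Ck_on k (\<lambda>z. 0 :: real) ?S2 \<longleftrightarrow> Ck_on k (b \<circ> chart_inv d) ?S2"
      by (rule Ck_on_cong[OF o(2)]) (simp add: b_off_K[OF d])
    then have k2: "Ck_on k (b \<circ> chart_inv d) ?S2"
      by (rule iffD1) (rule Ck_on_const[OF o(2)])
    have "snd d ` fst d = ?S1 \<union> ?S2"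
      using in_topspace[OF d] by (auto simp: chart_image_def K_def)
    then show "Ck_on k (\<lambda>z. b (chart_inv d z)) (snd d ` fst d)"
      using Ck_on_Un[OF o k1 k2] by (simp add: o_def)
  qed
  have lap_c: "lap c b p = (flat 4 (?s (snd c p)) - 2 * flat 3 (?s (snd c p))) / \<beta>\<^sup>2 *
      metric_trace c p (rank_one (snd c p - z0))
      - flat 2 (?s (snd c p)) / \<beta> * metric_trace c p (mat 1)" if "p \<in> fst c" for p
  proof -
    have eq: "levi (\<lambda>z. b (chart_inv c z)) (snd c p) = levi (\<lambda>z. flat 0 (?s z)) (snd c p)"
      by (rule levi_cong[OF open_chart_range[OF c] _ _ global_smoothD[OF gs c]])
        (use that in \<open>auto simp: b_def chart_inv_left[OF charts[OF c]]\<close>)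
    show ?thesis
      unfolding lap_def ddbar_eq_levi eq levi_flat_bump[OF \<beta>(1)] matrix_add_trace matrix_scale_trace
      by simp
  qed
  have lap_zero: "lap c b p = 0" if "p \<in> fst c" "snd c p \<notin> ball z0 R" for p
    unfolding lap_c[OF that(1)] using s_pos[of "snd c p"] that(2) by (simp add: flat_def)
  have "lap d b p = 0" if d: "d \<in> A" "p \<in> fst d" "p \<notin> {q \<in> fst c. snd c q \<in> ball z0 R}" for d p
  proof (cases "p \<in> fst c")
    case True
    then show ?thesis using lap_chart[OF gs d(1) c d(2)] lap_zero d(3) by auto
  next
    case False
    let ?S2 = "chart_image d (topspace X - K)"
    have o: "open ?S2" using oK by (intro open_chart_image[OF charts[OF d(1)]])
    have "snd d p \<in> ?S2" using False d in_topspace[OF d(1,2)] by (intro chart_imageI) (auto simp: K_def)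
    \<comment> \<open>The factor 0 expresses the local vanishing of \<open>b\<close> as a scalar
      multiple, to which \<open>levi_cmult\<close> applies.\<close>
    then have "levi (\<lambda>z. 0 * b (chart_inv d z)) (snd d p) = levi (\<lambda>z. b (chart_inv d z)) (snd d p)"
    proof (rule levi_cong[OF o])
      show "0 * b (chart_inv d z) = b (chart_inv d z)" if "z \<in> ?S2" for z
        using b_off_K[OF d(1) that] by simp
      show "Ck_on 2 (\<lambda>z. 0 * b (chart_inv d z)) ?S2"
        using Ck_on_const[OF o] by simp
    qed
    moreover have "levi (\<lambda>z. 0 * b (chart_inv d z)) (snd d p) = 0"
      using levi_cmult[OF open_chart_range[OF d(1)] _ global_smoothD[OF gs d(1)], of "snd d p" 0] d(2) by simp
    ultimately show ?thesis
      by (simp add: lap_def ddbar_eq_levi trace_def matrix_matrix_mult_def)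
  qed
  moreover have "lap c b p > 0" if p: "p \<in> fst c" "snd c p \<in> ball z0 R - ball z0 \<delta>" for p
  proof -
    define s where "s = ?s (snd c p)"
    define t1 where "t1 = metric_trace c p (rank_one (snd c p - z0))"
    define t2 where "t2 = metric_trace c p (mat 1)"
    have t: "m \<le> t1" "t2 \<le> B"
      using mB(3,4)[of "snd c p"] p unfolding t1_def t2_def by (auto simp: chart_inv_left[OF charts[OF c]])
    have s: "s > 0" using p s_pos unfolding s_def by simp
    have "s \<le> R\<^sup>2 / \<beta>" unfolding s_def bump_arg_def using \<beta>(1) by (intro divide_right_mono) auto
    then have sb: "s * \<beta> \<le> R\<^sup>2" using \<beta>(1) by (simp add: field_simps)
    have s4: "s \<le> 1 / 4"
    proof -
      have "s * (4 * R\<^sup>2) \<le> s * \<beta>" using \<beta>(2) s by (intro mult_left_mono) auto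
      then have "s * 4 * R\<^sup>2 \<le> 1 * R\<^sup>2" using sb by simp
      moreover have "R\<^sup>2 > 0" using R by simp
      ultimately have "s * 4 \<le> 1" using mult_le_cancel_right_pos by blast
      then show ?thesis by simp
    qed
    have main: "s\<^sup>2 * \<beta> * B < (1 - 2 * s) * m"
    proof -
      have "(s * \<beta>)\<^sup>2 \<le> (R\<^sup>2)\<^sup>2" using sb s \<beta>(1) by (intro power_mono) auto
      then have "(s * \<beta>)\<^sup>2 * B \<le> R ^ 4 * B" using mB(2) by (simp add: power_mult[symmetric] mult_right_mono)
      then have "\<beta> * (4 * (s\<^sup>2 * \<beta> * B)) \<le> \<beta> * m"
        using \<beta>(3) by (simp add: power2_eq_square mult_ac)
      then have "4 * (s\<^sup>2 * \<beta> * B) \<le> m" using \<beta>(1) by simp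
      moreover have "m / 2 \<le> (1 - 2 * s) * m" using s4 mB(1) by (simp add: field_simps)
      ultimately show ?thesis using mB(1) by linarith
    qed
    \<comment> \<open>After extracting \<open>exp (- 1 / s) / s ^ 4 / \<beta>\<^sup>2\<close>, the
      sign of the Laplacian is that of
      \<open>(1 - 2 * s) * t1 - s\<^sup>2 * \<beta> * t2\<close>.\<close>
    have e: "flat 4 s - 2 * flat 3 s = exp (- 1 / s) / s ^ 4 * (1 - 2 * s)"
      "flat 2 s = exp (- 1 / s) / s ^ 4 * s\<^sup>2"
      using s by (auto simp: flat_def field_simps power_numeral_reduce)
    have E: "exp (- 1 / s) / s ^ 4 > 0" using s by simp
    have "s\<^sup>2 * \<beta> * t2 \<le> s\<^sup>2 * \<beta> * B" using t(2) \<beta>(1) by (intro mult_left_mono) auto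
    moreover have "(1 - 2 * s) * m \<le> (1 - 2 * s) * t1" using t(1) s4 by (intro mult_left_mono) auto
    ultimately have "0 < (1 - 2 * s) * t1 - s\<^sup>2 * \<beta> * t2" using main by linarith
    then have "0 < exp (- 1 / s) / s ^ 4 / \<beta>\<^sup>2 * ((1 - 2 * s) * t1 - s\<^sup>2 * \<beta> * t2)"
      using E \<beta>(1) by (intro mult_pos_pos divide_pos_pos) auto
    also have "\<dots> = (flat 4 s - 2 * flat 3 s) / \<beta>\<^sup>2 * t1 - flat 2 s / \<beta> * t2"
      unfolding e using \<beta>(1) s by (simp add: field_simps power2_eq_square)
    finally show ?thesis unfolding lap_c[OF p(1)] s_def t1_def t2_def .
  qed
  ultimately show ?thesis using gs by blast
qed

text \<open>\<open>W\<close> collects \<open>V\<close> and all points where some good function has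
  positive Laplacian. A bump centred at a point of \<open>W\<close> near a given limit point shows
  that \<open>W\<close> is closed. Compactness then leaves finitely many good functions, and their
  sum is positive off \<open>V\<close> because no summand has negative Laplacian there.\<close>

theorem potential_exists:
  assumes V: "openin X V" "V \<noteq> {}" and cpt: "compact_space X"
  shows "\<exists>f. global_smooth f \<and> (\<forall>c\<in>A. \<forall>p\<in>fst c - V. lap c f p > 0)"
proof -
  \<comment> \<open>The inequality is weak so that good functions can be added, and the Laplacian is
    left unrestricted on \<open>V\<close>.\<close>
  define good where "good f \<longleftrightarrow> global_smooth f \<and> (\<forall>c\<in>A. \<forall>p\<in>fst c - V. lap c f p \<ge> 0)" for f
  define P where "P f = {p. \<exists>c\<in>A. p \<in> fst c \<and> lap c f p > 0}" for f
  have oP: "openin X (P f)" if "good f" for f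
  proof -
    have "P f = (\<Union>c\<in>A. {p \<in> fst c. lap c f p > 0})" by (auto simp: P_def)
    then show ?thesis using that lap_pos_open by (auto simp: good_def)
  qed
  define W where "W = V \<union> (\<Union>f\<in>{f. good f}. P f)"
  have oW: "openin X W" unfolding W_def using V(1) oP by (intro openin_Un openin_clauses) auto
  have haus: "Hausdorff_space X" using mfd by (simp add: complex_manifold_def)
  have closed: "X closure_of W \<subseteq> W"
  proof
    fix y assume y: "y \<in> X closure_of W"
    then have yX: "y \<in> topspace X" by (meson closure_of_subset_topspace subsetD)
    obtain c where c: "c \<in> A" "y \<in> fst c" using charts_cover[OF yX] by blast
    obtain r where r: "r > 0" "ball (snd c y) r \<subseteq> snd c ` fst c"
      using open_chart_range[OF c(1)] c(2) open_contains_ball by blast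
    \<comment> \<open>The centre of the bump will be \<open>y'\<close> instead of \<open>y\<close>,
      at distance less than \<open>R\<close>; with a third of \<open>r\<close> its closed ball of
      radius \<open>R\<close> still lies in the ball of radius \<open>r\<close> about
      \<open>snd c y\<close>.\<close>
    define R where "R = r / 3"
    have 1: "openin X {p \<in> fst c. snd c p \<in> ball (snd c y) R}"
      by (rule openin_chart_preimage[OF charts[OF c(1)] open_ball])
    have 2: "y \<in> {p \<in> fst c. snd c p \<in> ball (snd c y) R}" using c r by (simp add: R_def)
    have "\<exists>y'. y' \<in> W \<and> y' \<in> {p \<in> fst c. snd c p \<in> ball (snd c y) R}"
      by (rule mp[OF spec[OF conjunct2[OF iffD1[OF in_closure_of y]]] conjI[OF 2 1]])
    then obtain y' where "y' \<in> W" "y' \<in> {p \<in> fst c. snd c p \<in> ball (snd c y) R}" by blast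
    then have y': "y' \<in> W" "y' \<in> fst c" "dist (snd c y) (snd c y') < R" by auto
    let ?y = "snd c y'"
    have cb: "cball ?y R \<subseteq> snd c ` fst c"
    proof
      fix z assume "z \<in> cball ?y R"
      then have "dist (snd c y) z < r"
        using y'(3) dist_triangle[of "snd c y" z "?y"] r(1) by (simp add: R_def)
      then show "z \<in> snd c ` fst c" using r(2) by auto
    qed
    have R0: "R > 0" using r by (simp add: R_def)
    \<comment> \<open>\<open>N\<close> records why \<open>y'\<close> lies in \<open>W\<close>. The
      inner ball of the bump, where the sign of its Laplacian is unknown, will be placed inside
      \<open>N\<close>.\<close>
    obtain N where N: "openin X N" "y' \<in> N" "N = V \<or> (\<exists>f. good f \<and> N = P f)"
      using y'(1) V(1) oP unfolding W_def by blast
    have "open (chart_image c N)" by (rule open_chart_image[OF charts[OF c(1)] N(1)])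
    moreover have "?y \<in> chart_image c N" using y' N by (intro chart_imageI)
    ultimately obtain e where e: "e > 0" "ball ?y e \<subseteq> chart_image c N"
      using open_contains_ball by blast
    define \<delta> where "\<delta> = min e R / 2"
    have \<delta>: "0 < \<delta>" "\<delta> < R" "cball ?y \<delta> \<subseteq> chart_image c N"
      using e R0 by (auto simp: \<delta>_def min_def)
    have inN: "p \<in> N" if p: "p \<in> fst c" "snd c p \<in> cball ?y \<delta>" for p
    proof -
      obtain q where "q \<in> fst c" "q \<in> N" "snd c p = snd c q"
        using \<delta>(3) p(2) by (auto simp: chart_image_def)
      then show ?thesis using is_chartD(3)[OF charts[OF c(1)]] that(1) by (metis inj_onD)
    qed
    obtain b where b: "global_smooth b"
      "\<And>d p. d \<in> A \<Longrightarrow> p \<in> fst d \<Longrightarrow> p \<notin> {q \<in> fst c. snd c q \<in> ball ?y R} \<Longrightarrow> lap d b p = 0"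
      "\<And>p. p \<in> fst c \<Longrightarrow> snd c p \<in> ball ?y R - ball ?y \<delta> \<Longrightarrow> lap c b p > 0"
      using bump_exists[OF c(1) \<delta>(1,2) cb haus] by blast
    have b_nonneg: "lap d b p \<ge> 0" if "d \<in> A" "p \<in> fst d" "\<not> (p \<in> fst c \<and> snd c p \<in> ball ?y \<delta>)" for d p
    proof (cases "p \<in> {q \<in> fst c. snd c q \<in> ball ?y R}")
      case True
      then have "lap c b p > 0" using b(3) that by auto
      then show ?thesis using lap_chart[OF b(1) that(1) c(1) that(2)] True by simp
    qed (use b(2) that in auto)
    show "y \<in> W"
    proof (cases "y \<in> V \<or> snd c y \<in> ball ?y \<delta>")
      case True
      then have "y \<in> V \<or> y \<in> N" using inN[OF c(2)] by auto
      then show ?thesis using N(3) unfolding W_def by auto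
    next
      case False
      then have yb: "lap c b y > 0" using b(3)[OF c(2)] y'(3) by (auto simp: dist_commute)
      from N(3) show ?thesis
      proof
        \<comment> \<open>On \<open>V\<close> the Laplacian of a good function is unrestricted, so
          the uncontrolled inner ball does no harm and \<open>b\<close> alone is good.\<close>
        assume NV: "N = V"
        have "good b" unfolding good_def
        proof (intro conjI b(1) ballI)
          fix d p assume d: "d \<in> A" "p \<in> fst d - V"
          then have "\<not> (p \<in> fst c \<and> snd c p \<in> ball ?y \<delta>)" using inN[of p] NV by auto
          then show "lap d b p \<ge> 0" using b_nonneg d by blast
        qed
        moreover have "y \<in> P b" using yb c by (auto simp: P_def)
        ultimately show ?thesis unfolding W_def by blast
      next
        assume "\<exists>f. good f \<and> N = P f"
        then obtain f where f: "good f" "N = P f" by blast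
        then have gf: "global_smooth f" by (simp add: good_def)
        let ?K = "cball ?y \<delta>"
        have Kc: "?K \<subseteq> snd c ` fst c" using \<delta>(3) by (auto simp: chart_image_def)
        have fpos: "lap c f p > 0" if p: "p \<in> fst c" "snd c p \<in> ?K" for p
        proof -
          have "p \<in> P f" using inN[OF p] f(2) by simp
          then obtain d where "d \<in> A" "p \<in> fst d" "lap d f p > 0" by (auto simp: P_def)
          then show ?thesis using lap_chart[OF gf, of c d p] c p by simp
        qed
        have cf: "continuous_on ?K (\<lambda>z. lap c f (chart_inv c z))" "continuous_on ?K (\<lambda>z. lap c b (chart_inv c z))"
          using continuous_on_subset[OF lap_continuous[OF gf c(1)] Kc]
            continuous_on_subset[OF lap_continuous[OF b(1) c(1)] Kc] by auto
        have "?K \<noteq> {}" using \<delta>(1) by simp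
        from continuous_attains_inf[OF compact_cball this cf(1)]
        obtain z1 where z1: "z1 \<in> ?K" "\<forall>z\<in>?K. lap c f (chart_inv c z1) \<le> lap c f (chart_inv c z)" by blast
        from continuous_attains_inf[OF compact_cball \<open>?K \<noteq> {}\<close> cf(2)]
        obtain z2 where z2: "z2 \<in> ?K" "\<forall>z\<in>?K. lap c b (chart_inv c z2) \<le> lap c b (chart_inv c z)" by blast
        define m where "m = lap c f (chart_inv c z1)"
        define B where "B = \<bar>lap c b (chart_inv c z2)\<bar>"
        have "m > 0" unfolding m_def using z1(1) Kc by (intro fpos chart_inv_in) (auto simp: chart_inv_right)
        \<comment> \<open>On the inner ball \<open>lap c f\<close> is at least \<open>m\<close> and
          \<open>lap c b\<close> at least \<open>- B\<close>; the factor \<open>B / m\<close> is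
          exactly what compensates. Outside it, off \<open>V\<close>, both terms are
          non-negative.\<close>
        define g where "g p = (B / m) * f p + b p" for p
        have gg: "global_smooth g" unfolding g_def by (intro global_smooth_add global_smooth_cmult gf b(1))
        have lg: "lap d g p = (B / m) * lap d f p + lap d b p" if "d \<in> A" "p \<in> fst d" for d p
          unfolding g_def lap_add[OF global_smooth_cmult[OF gf] b(1) that] lap_cmult[OF gf that] ..
        have Bm: "B / m \<ge> 0" using \<open>m > 0\<close> by (simp add: B_def)
        have "good g" unfolding good_def
        proof (intro conjI gg ballI)
          fix d p assume d: "d \<in> A" "p \<in> fst d - V"
          show "lap d g p \<ge> 0"
          proof (cases "p \<in> fst c \<and> snd c p \<in> ball ?y \<delta>")
            case True
            then have pK: "snd c p \<in> ?K" "p \<in> fst c" by auto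
            have "m \<le> lap c f p" "- B \<le> lap c b p"
              using z1(2)[rule_format, OF pK(1)] z2(2)[rule_format, OF pK(1)] unfolding m_def B_def
              by (auto simp: chart_inv_left[OF charts[OF c(1)] pK(2)])
            moreover have "B \<le> (B / m) * lap c f p"
              using mult_left_mono[OF \<open>m \<le> lap c f p\<close> Bm] \<open>m > 0\<close> by simp
            ultimately have "lap c g p \<ge> 0" using lg[OF c(1) pK(2)] by simp
            then show ?thesis using lap_chart[OF gg _ c(1)] d pK(2) by auto
          next
            case False
            have "lap d f p \<ge> 0" using f(1) d unfolding good_def by blast
            from mult_nonneg_nonneg[OF Bm this] show ?thesis
              using lg[of d p] b_nonneg[OF d(1) _ False] d by auto
          qed
        qed
        moreover have "y \<in> P g"
        proof -
          have "lap c f y \<ge> 0" using f(1) c False unfolding good_def by blast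
          from mult_nonneg_nonneg[OF Bm this] have "lap c g y > 0" using lg[OF c] yb by linarith
          then show ?thesis using c by (auto simp: P_def)
        qed
        ultimately show ?thesis unfolding W_def by blast
      qed
    qed
  qed
  have "W \<subseteq> topspace X" using oW openin_subset by blast
  then have "closedin X W" using closed closure_of_subset_eq by blast
  moreover have "W \<noteq> {}" using V(2) by (auto simp: W_def)
  moreover have "connected_space X" using mfd by (simp add: complex_manifold_def)
  ultimately have WX: "W = topspace X" using oW connected_space_clopen_in by blast
  have "compactin X (topspace X - V)"
    by (rule closedin_compact_space[OF cpt]) (use V(1) in blast)
  moreover have "topspace X - V \<subseteq> \<Union> (P ` {f. good f})" using WX unfolding W_def by blast
  moreover have "\<forall>U\<in>P ` {f. good f}. openin X U" using oP by blast
  ultimately have "\<exists>F. finite F \<and> F \<subseteq> P ` {f. good f} \<and> topspace X - V \<subseteq> \<Union> F"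
    unfolding compactin_def by blast
  then obtain F where F: "finite F" "F \<subseteq> P ` {f. good f}" "topspace X - V \<subseteq> \<Union> F" by blast
  obtain I where I: "finite I" "I \<subseteq> {f. good f}" "F = P ` I" using finite_subset_image[OF F(1,2)] by blast
  have gI: "global_smooth f" if "f \<in> I" for f using I(2) that by (auto simp: good_def)
  define h where "h p = (\<Sum>f\<in>I. f p)" for p
  have "lap c h p > 0" if p: "c \<in> A" "p \<in> fst c - V" for c p
  proof -
    have "p \<in> topspace X - V" using p in_topspace by blast
    then obtain f where f: "f \<in> I" "p \<in> P f" using F(3) I(3) by blast
    then obtain d where "d \<in> A" "p \<in> fst d" "lap d f p > 0" by (auto simp: P_def)
    then have "lap c f p > 0" using lap_chart[OF gI[OF f(1)], of c d p] p by simp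
    moreover have "lap c f p \<ge> 0" if "f \<in> I" for f using I(2) that p unfolding good_def by blast
    ultimately have "(\<Sum>f\<in>I. lap c f p) > 0" using I(1) f(1) by (intro sum_pos2[of I f]) auto
    then show ?thesis unfolding h_def using lap_sum(2)[OF I(1) gI p(1)] p(2) by simp
  qed
  moreover have "global_smooth h"
  proof -
    obtain c p where "c \<in> A" "p \<in> fst c" using charts_cover V openin_subset by blast
    from lap_sum(1)[OF I(1) gI this] show ?thesis by (simp add: h_def[abs_def])
  qed
  ultimately show ?thesis by blast
qed

end

section \<open>RC-positivity of the canonical bundle and its dual\<close>

context hermitian_mfd
begin

lemma ricci_hermitian:
  assumes "c \<in> A" "p \<in> fst c"
  shows "hermitian (ricci \<omega> c p)"
  unfolding ricci_eq
  by (rule hermitian_minus, rule levi_hermitian[OF log_vol_Ck[OF assms(1)] open_chart_range[OF assms(1)]])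
    (use assms in blast)

lemma levi_sesq_continuous:
  assumes "Ck_on 2 u S" "open S"
  shows "continuous_on S (\<lambda>z. Re (sesq (levi u z) v v))"
  unfolding sesq_def by (intro continuous_intros levi_continuous[OF assms])

lemma potential_with_signs:
  assumes flat: "scalar_flat A \<omega>" and cpt: "compact_space X"
    and p0: "c0 \<in> A" "p0 \<in> fst c0" "ricci \<omega> c0 p0 \<noteq> 0"
  shows "\<exists>f. global_smooth f \<and> (\<forall>p\<in>topspace X. \<exists>c\<in>A. p \<in> fst c \<and>
    pos_dir (ricci \<omega> c p + ddbar c f p) \<and> pos_dir (- ricci \<omega> c p + ddbar c f p))"
proof -
  have tr: "trace (matrix_inv (\<omega> c p) ** ricci \<omega> c p) = 0" if "c \<in> A" "p \<in> fst c" for c p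
    using flat that by (simp add: scalar_flat_def scalar_curvature_def)
  have tr': "trace (matrix_inv (\<omega> c p) ** (- ricci \<omega> c p)) = 0" if "c \<in> A" "p \<in> fst c" for c p
    using matrix_scale_trace[of "matrix_inv (\<omega> c p)" "-1" "ricci \<omega> c p"] tr[OF that] by simp
  let ?Z = "snd c0 ` fst c0"
  let ?u = "\<lambda>z. ln (vol c0 (chart_inv c0 z))"
  let ?z0 = "snd c0 p0"
  have ric: "ricci \<omega> c0 p = - levi ?u (snd c0 p)" for p by (rule ricci_eq)
  have "pos_dir (ricci \<omega> c0 p0)"
    by (rule trace_free_imp_pos_dir[OF metric_pos[OF p0(1,2)] ricci_hermitian[OF p0(1,2)] tr[OF p0(1,2)] p0(3)])
  \<comment> \<open>The vectors \<open>v\<close> and \<open>w\<close> are fixed in the coordinates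
    of \<open>c0\<close> and serve as test directions on all of \<open>V\<close>, so only scalar
    functions of the point have to be controlled there.\<close>
  then obtain v where v: "Re (sesq (levi ?u ?z0) v v) < 0"
    unfolding pos_dir_def ric by (auto simp: sesq_matrix)
  have "pos_dir (- ricci \<omega> c0 p0)"
    by (rule trace_free_imp_pos_dir[OF metric_pos[OF p0(1,2)] hermitian_minus[OF ricci_hermitian[OF p0(1,2)]] tr'[OF p0(1,2)]])
      (use p0(3) in simp)
  then obtain w where w: "Re (sesq (levi ?u ?z0) w w) > 0"
    unfolding pos_dir_def ric by (auto simp: sesq_matrix)
  define r1 where "r1 z = - Re (sesq (levi ?u z) v v)" for z
  define r2 where "r2 z = Re (sesq (levi ?u z) w w)" for z
  \<comment> \<open>Half of the smaller value leaves a margin: near \<open>p0\<close> both functions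
    stay above \<open>e\<close>, and the perturbation by the potential will not fall below
    \<open>- e\<close>.\<close>
  define e where "e = min (r1 ?z0) (r2 ?z0) / 2"
  have e: "e > 0" "r1 ?z0 > e" "r2 ?z0 > e" using v w by (auto simp: e_def r1_def r2_def min_def)
  have cont: "continuous_on ?Z r1" "continuous_on ?Z r2"
    unfolding r1_def r2_def
    by (intro continuous_intros levi_sesq_continuous[OF log_vol_Ck open_chart_range] p0(1))+
  have z0: "?z0 \<in> ?Z" using p0 by blast
  let ?O = "{z \<in> ?Z. r1 z \<in> {e<..}} \<inter> {z \<in> ?Z. r2 z \<in> {e<..}}"
  have "open ?O"
    using continuous_openin_preimage_gen[OF cont(1), of "{e<..}"] continuous_openin_preimage_gen[OF cont(2), of "{e<..}"]
      openin_open_trans[OF _ open_chart_range[OF p0(1)]] by (intro open_Int) (auto simp: vimage_def Collect_conj_eq)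
  moreover have "?z0 \<in> ?O" using z0 e by simp
  \<comment> \<open>A closed ball is taken because the Levi form of the potential, constructed only
    afterwards, has to be bounded on it.\<close>
  ultimately obtain \<rho> where \<rho>: "\<rho> > 0" "cball ?z0 \<rho> \<subseteq> ?O"
    using open_contains_cball by blast
  define V where "V = {p \<in> fst c0. snd c0 p \<in> ball ?z0 \<rho>}"
  have oV: "openin X V" unfolding V_def by (rule openin_chart_preimage[OF charts[OF p0(1)] open_ball])
  have "V \<noteq> {}" using p0 \<rho>(1) by (auto simp: V_def)
  then obtain f where f: "global_smooth f" "\<forall>c\<in>A. \<forall>p\<in>fst c - V. lap c f p > 0"
    using potential_exists[OF oV _ cpt] by blast
  let ?f = "\<lambda>z. f (chart_inv c0 z)"
  have sub: "cball ?z0 \<rho> \<subseteq> ?Z" using \<rho>(2) by blast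
  have fc: "continuous_on (cball ?z0 \<rho>) (\<lambda>z. Re (sesq (levi ?f z) x x))" for x
    by (rule continuous_on_subset[OF levi_sesq_continuous[OF global_smoothD[OF f(1) p0(1)] open_chart_range[OF p0(1)]] sub])
  have "\<exists>B. \<forall>z\<in>cball ?z0 \<rho>. \<bar>Re (sesq (levi ?f z) x x)\<bar> \<le> B" for x
    using compact_imp_bounded[OF compact_continuous_image[OF fc[of x] compact_cball]]
    by (auto simp: bounded_iff)
  then obtain B1 B2 where B: "\<And>z. z \<in> cball ?z0 \<rho> \<Longrightarrow> \<bar>Re (sesq (levi ?f z) v v)\<bar> \<le> B1"
    "\<And>z. z \<in> cball ?z0 \<rho> \<Longrightarrow> \<bar>Re (sesq (levi ?f z) w w)\<bar> \<le> B2" by metis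
  define B where "B = \<bar>B1\<bar> + \<bar>B2\<bar> + 1"
  define \<epsilon> where "\<epsilon> = e / B"
  have Bpos: "B > 0" by (simp add: B_def add_nonneg_pos)
  have \<epsilon>: "\<epsilon> > 0" "\<epsilon> * B = e" using e Bpos by (auto simp: \<epsilon>_def)
  have small: "\<epsilon> * t \<ge> - e" if "\<bar>t\<bar> \<le> B" for t
    using mult_left_mono[of "- B" t \<epsilon>] that \<epsilon> by simp
  define g where "g p = \<epsilon> * f p" for p
  have gs: "global_smooth g" unfolding g_def by (rule global_smooth_cmult[OF f(1)])
  have gd: "ddbar c g p = \<epsilon> *\<^sub>R ddbar c f p" if "c \<in> A" "p \<in> fst c" for c p
    unfolding g_def ddbar_eq_levi
    by (rule levi_cmult[OF open_chart_range[OF that(1)] _ global_smoothD[OF f(1) that(1)]]) (use that in blast)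
  have "\<exists>c\<in>A. p \<in> fst c \<and> pos_dir (ricci \<omega> c p + ddbar c g p) \<and> pos_dir (- ricci \<omega> c p + ddbar c g p)"
    if pX: "p \<in> topspace X" for p
  proof (cases "p \<in> V")
    case True
    then have p: "p \<in> fst c0" "snd c0 p \<in> cball ?z0 \<rho>" by (auto simp: V_def)
    have "r1 (snd c0 p) > e" "r2 (snd c0 p) > e" using \<rho>(2) p(2) by auto
    moreover have "\<bar>Re (sesq (levi ?f (snd c0 p)) v v)\<bar> \<le> B" "\<bar>Re (sesq (levi ?f (snd c0 p)) w w)\<bar> \<le> B"
      using B[OF p(2)] by (auto simp: B_def)
    note this[THEN small]
    ultimately have "Re (sesq (ricci \<omega> c0 p + ddbar c0 g p) v v) > 0"
      "Re (sesq (- ricci \<omega> c0 p + ddbar c0 g p) w w) > 0"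
      unfolding gd[OF p0(1) p(1)] ric unfolding ddbar_eq_levi sesq_matrix by (auto simp: r1_def r2_def)
    then show ?thesis using p0(1) p(1) unfolding pos_dir_def by blast
  next
    case False
    obtain c where c: "c \<in> A" "p \<in> fst c" using charts_cover[OF pX] by blast
    have "lap c f p > 0" using f(2) c False by blast
    then have l: "\<epsilon> * lap c f p > 0" using \<epsilon> by simp
    have "metric_trace c p (ricci \<omega> c p + ddbar c g p) > 0"
      "metric_trace c p (- ricci \<omega> c p + ddbar c g p) > 0"
      using l unfolding matrix_add_trace gd[OF c] matrix_scale_trace tr[OF c] tr'[OF c] lap_def by auto
    then show ?thesis using positive_trace_imp_pos_dir[OF metric_pos[OF c]] c by blast
  qed
  then show ?thesis using gs by blast
qed

section \<open>Weighted metrics on the canonical bundle and its dual\<close>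

lemma weighted_Ck:
  assumes "global_smooth f" "c \<in> A"
  shows "Ck_on k (\<lambda>z. exp (- f (chart_inv c z))) (snd c ` fst c)"
  by (rule Ck_on_real_compose[OF open_chart_range[OF assms(2)] open_UNIV _ Ck_on_exp
        Ck_on_uminus[OF open_chart_range[OF assms(2)] global_smoothD[OF assms]]]) simp

lemma anticanonical_metric:
  assumes "global_smooth f"
  shows "line_metric A K_dual (\<lambda>c p. exp (- f p) * vol c p)"
  unfolding line_metric_def dual_bundle_simps canonical_bundle_simps
proof (intro conjI ballI)
  fix c assume c: "c \<in> A"
  show "0 < exp (- f p) * vol c p" if "p \<in> fst c" for p using vol_pos[OF c that] by simp
  show "smooth_on_manifold A (\<lambda>p. exp (- f p) * vol c p) (fst c)"
  proof (rule smooth_on_manifold_chart[OF c subset_refl openin_chart[OF c]])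
    have "Ck_on k (\<lambda>z. exp (- f (chart_inv c z)) * vol c (chart_inv c z)) (snd c ` fst c)" for k
      by (rule Ck_on_mult[OF open_chart_range[OF c] weighted_Ck[OF assms c] vol_Ck[OF c]])
    then show "smooth_on ((\<lambda>p. exp (- f p) * vol c p) \<circ> chart_inv c) (chart_image c (fst c))"
      by (simp add: smooth_on_def o_def chart_image_def)
  qed
next
  fix c d p assume "c \<in> A" "d \<in> A" "p \<in> fst c \<inter> fst d"
  then show "exp (- f p) * vol d p = (cmod (inverse (det (jacobian c d p))))\<^sup>2 * (exp (- f p) * vol c p)"
    unfolding cmod_inverse_square
    using vol_transform[of c d p] det_jacobian_nonzero[of c d p] by (simp add: field_simps)
qed

text \<open>Passing from \<open>vol\<close> to its inverse dualises the metric and reverses the sign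
  of the Ricci term. The weight \<open>exp (- f)\<close> is kept, so \<open>f\<close> enters both
  curvatures with the same sign.\<close>

lemma canonical_metric:
  assumes "global_smooth f"
  shows "line_metric A (canonical_bundle A) (\<lambda>c p. exp (- f p) * inverse (vol c p))"
  unfolding line_metric_def canonical_bundle_simps
proof (intro conjI ballI)
  fix c assume c: "c \<in> A"
  show "0 < exp (- f p) * inverse (vol c p)" if "p \<in> fst c" for p using vol_pos[OF c that] by simp
  show "smooth_on_manifold A (\<lambda>p. exp (- f p) * inverse (vol c p)) (fst c)"
  proof (rule smooth_on_manifold_chart[OF c subset_refl openin_chart[OF c]])
    have "Ck_on k (\<lambda>z. inverse (vol c (chart_inv c z))) (snd c ` fst c)" for k
      by (rule Ck_on_real_compose[OF open_chart_range[OF c] _ _ Ck_on_inverse vol_Ck[OF c]])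
        (use vol_pos[OF c chart_inv_in] in force)+
    then have "Ck_on k (\<lambda>z. exp (- f (chart_inv c z)) * inverse (vol c (chart_inv c z))) (snd c ` fst c)" for k
      by (rule Ck_on_mult[OF open_chart_range[OF c] weighted_Ck[OF assms c]])
    then show "smooth_on ((\<lambda>p. exp (- f p) * inverse (vol c p)) \<circ> chart_inv c) (chart_image c (fst c))"
      by (simp add: smooth_on_def o_def chart_image_def)
  qed
next
  fix c d p assume "c \<in> A" "d \<in> A" "p \<in> fst c \<inter> fst d"
  then show "exp (- f p) * inverse (vol d p) = (cmod (det (jacobian c d p)))\<^sup>2 * (exp (- f p) * inverse (vol c p))"
    using vol_transform[of c d p] det_jacobian_nonzero[of c d p] by (simp add: field_simps)
qed

lemma anticanonical_curvature:
  assumes "global_smooth f" "c \<in> A" "p \<in> fst c"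
  shows "line_curvature (\<lambda>c p. exp (- f p) * vol c p) c c p = ricci \<omega> c p + ddbar c f p"
proof -
  note o = open_chart_range[OF assms(2)] and f = global_smoothD[OF assms(1,2)]
  have pS: "snd c p \<in> snd c ` fst c" using assms(3) by blast
  have eq: "levi (\<lambda>z. ln (vol c (chart_inv c z)) - f (chart_inv c z)) (snd c p) =
      levi (\<lambda>z. ln (exp (- f (chart_inv c z)) * vol c (chart_inv c z))) (snd c p)"
    by (rule levi_cong[OF o pS _ Ck_on_diff[OF o log_vol_Ck[OF assms(2)] f]])
      (use vol_pos[OF assms(2) chart_inv_in] in \<open>force simp: ln_mult\<close>)
  show ?thesis
    unfolding line_curvature_def ddbar_eq_levi ricci_eq eq[symmetric]
      levi_diff[OF o pS log_vol_Ck[OF assms(2)] f] by simp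
qed

lemma canonical_curvature:
  assumes "global_smooth f" "c \<in> A" "p \<in> fst c"
  shows "line_curvature (\<lambda>c p. exp (- f p) * inverse (vol c p)) c c p = - ricci \<omega> c p + ddbar c f p"
proof -
  note o = open_chart_range[OF assms(2)] and f = global_smoothD[OF assms(1,2)]
  have pS: "snd c p \<in> snd c ` fst c" using assms(3) by blast
  have eq: "levi (\<lambda>z. - (ln (vol c (chart_inv c z)) + f (chart_inv c z))) (snd c p) =
      levi (\<lambda>z. ln (exp (- f (chart_inv c z)) * inverse (vol c (chart_inv c z)))) (snd c p)"
    by (rule levi_cong[OF o pS _ Ck_on_uminus[OF o Ck_on_add[OF o log_vol_Ck[OF assms(2)] f]]])
      (use vol_pos[OF assms(2) chart_inv_in] in \<open>force simp: ln_mult ln_inverse\<close>)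
  show ?thesis
    unfolding line_curvature_def ddbar_eq_levi ricci_eq eq[symmetric]
      levi_minus[OF o pS Ck_on_add[OF o log_vol_Ck[OF assms(2)] f]]
      levi_add[OF o pS log_vol_Ck[OF assms(2)] f] by simp
qed

theorem scalar_flat_RC_positive:
  assumes "scalar_flat A \<omega>" "compact_space X" "c0 \<in> A" "p0 \<in> fst c0" "ricci \<omega> c0 p0 \<noteq> 0"
  shows "RC_positive X A (canonical_bundle A)" "RC_positive X A K_dual"
proof -
  obtain f where f: "global_smooth f" "\<And>p. p \<in> topspace X \<Longrightarrow> \<exists>c\<in>A. p \<in> fst c \<and>
    pos_dir (ricci \<omega> c p + ddbar c f p) \<and> pos_dir (- ricci \<omega> c p + ddbar c f p)"
    using potential_with_signs[OF assms] by blast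
  show "RC_positive X A (canonical_bundle A)"
  proof (rule RC_positiveI[OF canonical_bundle_holomorphic canonical_metric[OF f(1)]])
    fix p assume "p \<in> topspace X"
    from f(2)[OF this] obtain c where c: "c \<in> A" "p \<in> fst c"
      and pos: "pos_dir (ricci \<omega> c p + ddbar c f p)" "pos_dir (- ricci \<omega> c p + ddbar c f p)" by blast
    show "\<exists>c\<in>A. \<exists>i\<in>lb_index (canonical_bundle A). p \<in> fst c \<and> p \<in> lb_dom (canonical_bundle A) i \<and>
        pos_dir (line_curvature (\<lambda>c p. exp (- f p) * inverse (vol c p)) i c p)"
      by (intro bexI[of _ c]) (use pos in \<open>simp_all add: c canonical_curvature[OF f(1) c]\<close>)
  qed
  show "RC_positive X A K_dual"
  proof (rule RC_positiveI[OF dual_bundle_holomorphic[OF canonical_bundle_holomorphic] anticanonical_metric[OF f(1)]])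
    fix p assume "p \<in> topspace X"
    from f(2)[OF this] obtain c where c: "c \<in> A" "p \<in> fst c"
      and pos: "pos_dir (ricci \<omega> c p + ddbar c f p)" "pos_dir (- ricci \<omega> c p + ddbar c f p)" by blast
    show "\<exists>c\<in>A. \<exists>i\<in>lb_index K_dual. p \<in> fst c \<and> p \<in> lb_dom K_dual i \<and>
        pos_dir (line_curvature (\<lambda>c p. exp (- f p) * vol c p) i c p)"
      by (intro bexI[of _ c]) (use pos in \<open>simp_all add: c anticanonical_curvature[OF f(1) c]\<close>)
  qed
qed

end

section \<open>Ricci-flat metrics have vanishing first Chern class\<close>

lemma form11_sesq: "form11 M u v = Re (\<i> * (sesq M u v - sesq M v u))"
  by (simp add: form11_def sesq_def algebra_simps sum_subtractf)

text \<open>Only imaginary parts of \<open>sesq_part\<close> contribute; symmetry of second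
  derivatives merges their four terms into two, which is the shape of the exterior derivative in
  \<open>dc_ext_deriv\<close>.\<close>

lemma form11_levi:
  assumes "Ck_on 2 f S" "open S" "z \<in> S"
  shows "form11 (levi f z) u v = - (hess f z u (\<i> *s v) - hess f z v (\<i> *s u)) / 2"
  unfolding form11_sesq levi_sesq[OF assms] sesq_part_def
  using hess_sym[OF assms, of "\<i> *s u" v] hess_sym[OF assms, of "\<i> *s v" u]
  by (simp add: field_simps)

section \<open>Linear combinations of forms and equality of de Rham classes\<close>

context complex_mfd
begin

lemma smooth_form1D:
  assumes "smooth_form1 A \<eta>" "c \<in> A"
  shows "Ck_on k (\<lambda>z. \<eta> c (chart_inv c z) v) (snd c ` fst c)"
  using assms by (simp add: smooth_form1_def smooth_on_def)

lemma smooth_form1_combination: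
  assumes "smooth_form1 A \<eta>" "smooth_form1 A \<eta>'"
  shows "smooth_form1 A (\<lambda>c p v. \<eta> c p v + r * \<eta>' c p v)"
  unfolding smooth_form1_def
proof (intro conjI ballI allI)
  fix c p assume c: "c \<in> A" "p \<in> fst c"
  have "linear (\<eta> c p)" "linear (\<eta>' c p)" using assms c by (auto simp: smooth_form1_def)
  then show "linear (\<lambda>v. \<eta> c p v + r * \<eta>' c p v)"
    by (intro linearI) (simp_all add: linear_add linear_cmul algebra_simps)
next
  fix c v assume c: "c \<in> A"
  then have o: "open (snd c ` fst c)" using charts by (simp add: is_chart_def)
  show "smooth_on (\<lambda>z. \<eta> c (chart_inv c z) v + r * \<eta>' c (chart_inv c z) v) (snd c ` fst c)"
    unfolding smooth_on_def
    by (intro allI Ck_on_add Ck_on_mult Ck_on_const o smooth_form1D[OF assms(1) c] smooth_form1D[OF assms(2) c])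
next
  fix c d p v assume "c \<in> A" "d \<in> A" "p \<in> fst c \<inter> fst d"
  then have "\<eta> c p v = \<eta> d p (d_transition c d p v)" "\<eta>' c p v = \<eta>' d p (d_transition c d p v)"
    using assms unfolding smooth_form1_def by blast+
  then show "\<eta> c p v + r * \<eta>' c p v = \<eta> d p (d_transition c d p v) + r * \<eta>' d p (d_transition c d p v)"
    by simp
qed

lemma ext_deriv1_combination:
  assumes "smooth_form1 A \<eta>" "smooth_form1 A \<eta>'" "c \<in> A" "p \<in> fst c"
  shows "ext_deriv1 (\<lambda>c p v. \<eta> c p v + r * \<eta>' c p v) c p u v = ext_deriv1 \<eta> c p u v + r * ext_deriv1 \<eta>' c p u v"
proof -
  have "dir_deriv c (\<lambda>q. \<eta> c q w + r * \<eta>' c q w) p x = dir_deriv c (\<lambda>q. \<eta> c q w) p x + r * dir_deriv c (\<lambda>q. \<eta>' c q w) p x"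
    for w x
  proof -
    have d: "(\<lambda>z. \<eta> c (chart_inv c z) w) differentiable (at (snd c p))"
      "(\<lambda>z. \<eta>' c (chart_inv c z) w) differentiable (at (snd c p))"
      by (rule Ck_on_differentiable[OF smooth_form1D[OF assms(1,3)]] Ck_on_differentiable[OF smooth_form1D[OF assms(2,3)]],
          use assms(4) in blast)+
    from has_derivative_imp_fderiv[OF has_derivative_add[OF differentiable_fderiv[OF d(1)]
          has_derivative_mult_right[OF differentiable_fderiv[OF d(2)]]]]
    show ?thesis by (simp add: dir_deriv_def o_def)
  qed
  then show ?thesis by (simp add: ext_deriv1_def algebra_simps)
qed

text \<open>With \<open>r = 1\<close> and \<open>r = -1\<close> an exact form can be added or
  subtracted, which is how \<open>deRham_class2_eq\<close> compares classes.\<close>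

lemma cohomologous2_combination:
  assumes "cohomologous2 A \<theta> \<theta>'" "cohomologous2 A \<zeta> \<zeta>'"
  shows "cohomologous2 A (\<lambda>c p u v. \<theta> c p u v + r * \<zeta> c p u v) (\<lambda>c p u v. \<theta>' c p u v + r * \<zeta>' c p u v)"
proof -
  obtain \<eta> \<eta>' where \<eta>: "smooth_form1 A \<eta>" "smooth_form1 A \<eta>'"
    and eq: "\<forall>c\<in>A. \<forall>p\<in>fst c. \<forall>u v. \<theta> c p u v - \<theta>' c p u v = ext_deriv1 \<eta> c p u v"
      "\<forall>c\<in>A. \<forall>p\<in>fst c. \<forall>u v. \<zeta> c p u v - \<zeta>' c p u v = ext_deriv1 \<eta>' c p u v"
    using assms unfolding cohomologous2_def by blast
  show ?thesis
    unfolding cohomologous2_def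
  proof (intro exI conjI ballI allI)
    show "smooth_form1 A (\<lambda>c p v. \<eta> c p v + r * \<eta>' c p v)" by (rule smooth_form1_combination[OF \<eta>])
    fix c p u v assume c: "c \<in> A" "p \<in> fst c"
    have 1: "\<theta> c p u v - \<theta>' c p u v = ext_deriv1 \<eta> c p u v" "\<zeta> c p u v - \<zeta>' c p u v = ext_deriv1 \<eta>' c p u v"
      using eq c by blast+
    show "\<theta> c p u v + r * \<zeta> c p u v - (\<theta>' c p u v + r * \<zeta>' c p u v) =
        ext_deriv1 (\<lambda>c p v. \<eta> c p v + r * \<eta>' c p v) c p u v"
      unfolding ext_deriv1_combination[OF \<eta> c] 1[symmetric] by (simp add: algebra_simps)
  qed
qed

lemma deRham_class2_eq:
  assumes "cohomologous2 A \<theta> (\<lambda>c p u v. 0)"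
  shows "deRham_class2 A \<theta> = deRham_class2 A (\<lambda>c p u v. 0)"
proof -
  have "cohomologous2 A \<theta>' \<theta> \<longleftrightarrow> cohomologous2 A \<theta>' (\<lambda>c p u v. 0)" for \<theta>'
  proof
    assume "cohomologous2 A \<theta>' \<theta>"
    from cohomologous2_combination[OF this assms, of 1]
    obtain \<eta> where "smooth_form1 A \<eta>" "\<forall>c\<in>A. \<forall>p\<in>fst c. \<forall>u v.
        \<theta>' c p u v + 1 * \<theta> c p u v - (\<theta> c p u v + 1 * 0) = ext_deriv1 \<eta> c p u v"
      unfolding cohomologous2_def by blast
    then show "cohomologous2 A \<theta>' (\<lambda>c p u v. 0)" unfolding cohomologous2_def by auto
  next
    assume "cohomologous2 A \<theta>' (\<lambda>c p u v. 0)"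
    from cohomologous2_combination[OF this assms, of "-1"]
    obtain \<eta> where "smooth_form1 A \<eta>" "\<forall>c\<in>A. \<forall>p\<in>fst c. \<forall>u v.
        \<theta>' c p u v + (-1) * \<theta> c p u v - (0 + (-1) * 0) = ext_deriv1 \<eta> c p u v"
      unfolding cohomologous2_def by blast
    then show "cohomologous2 A \<theta>' \<theta>" unfolding cohomologous2_def by auto
  qed
  then show ?thesis unfolding deRham_class2_def by simp
qed

end

context hermitian_mfd
begin

text \<open>A multiple of \<open>d\<^sup>c f\<close>; the coefficient that turns it into a primitive of the curvature form divided
  by \<open>2\<pi>\<close> is \<open>- 1 / (4\<pi>)\<close>.\<close>

definition dc :: "real \<Rightarrow> ('a \<Rightarrow> real) \<Rightarrow> ('a, 'n) form1" where
  "dc k f c p v = k * dir_deriv c f p (\<i> *s v)"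

text \<open>Compatibility between charts uses that the differential of a transition map commutes
  with multiplication by \<open>\<i>\<close>.\<close>

lemma dc_smooth:
  assumes f: "global_smooth f"
  shows "smooth_form1 A (dc k f)"
  unfolding smooth_form1_def
proof (intro conjI ballI allI)
  fix c p assume c: "c \<in> A" "p \<in> fst c"
  have "(\<lambda>z. f (chart_inv c z)) differentiable (at (snd c p))"
    by (rule Ck_on_differentiable[OF global_smoothD[OF f c(1)]]) (use c in blast)
  then have "linear (fderiv (\<lambda>z. f (chart_inv c z)) (snd c p))" by (rule fderiv_linear)
  then show "linear (dc k f c p)"
    unfolding dc_def[abs_def] dir_deriv_def o_def
    by (intro linearI) (simp_all add: linear_add linear_cmul scalar_add_right algebra_simps
        linear_cmul[OF bounded_linear.linear[OF bounded_linear_scalar_right]])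
next
  fix c v assume c: "c \<in> A"
  show "smooth_on (\<lambda>z. dc k f c (chart_inv c z) v) (snd c ` fst c)"
    unfolding smooth_on_def
  proof
    fix j
    note o = open_chart_range[OF c]
    have "Ck_on j (\<lambda>z. k * fderiv (\<lambda>z. f (chart_inv c z)) z (\<i> *s v)) (snd c ` fst c)"
      by (intro Ck_on_mult Ck_on_const o Ck_on_fderiv[OF global_smoothD[OF f c]])
    then show "Ck_on j (\<lambda>z. dc k f c (chart_inv c z) v) (snd c ` fst c)"
      by (rule iffD1[OF Ck_on_cong[OF o], rotated]) (simp add: dc_def dir_deriv_def o_def chart_inv_right)
  qed
next
  fix c d p v assume cd: "c \<in> A" "d \<in> A" "p \<in> fst c \<inter> fst d"
  then have p: "p \<in> fst c" "p \<in> fst d" by auto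
  let ?S = "chart_image c (fst d)"
  have o: "open ?S" by (rule open_chart_image[OF charts[OF cd(1)] openin_chart[OF cd(2)]])
  have pS: "snd c p \<in> ?S" using p by (rule chart_imageI)
  have T: "transition c d differentiable (at (snd c p))"
    using holomorphic_mapD(1)[OF transition_holomorphic[OF cd(1,2)] pS] by (auto simp: differentiable_def)
  have D: "(\<lambda>z. f (chart_inv d z)) differentiable (at (transition c d (snd c p)))"
    unfolding transition_point[OF cd(1) p(1)]
    by (rule Ck_on_differentiable[OF global_smoothD[OF f cd(2)]]) (use p in blast)
  have "fderiv (\<lambda>z. f (chart_inv c z)) (snd c p) = fderiv (\<lambda>z. f (chart_inv d (transition c d z))) (snd c p)"
    by (rule fderiv_cong[OF o pS]) (simp add: chart_inv_transition[OF cd(1,2)])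
  also have "\<dots> = (\<lambda>v. fderiv (\<lambda>z. f (chart_inv d z)) (snd d p) (d_transition c d p v))"
    using fderiv_compose[OF T D] by (simp add: d_transition_def transition_point[OF cd(1) p(1)])
  finally have "dir_deriv c f p v = dir_deriv d f p (d_transition c d p v)" for v
    by (simp add: dir_deriv_def o_def)
  moreover have "d_transition c d p (\<i> *s v) = \<i> *s d_transition c d p v"
    unfolding d_transition_def by (rule holomorphic_mapD(2)[OF transition_holomorphic[OF cd(1,2)] pS])
  ultimately show "dc k f c p v = dc k f d p (d_transition c d p v)" by (simp add: dc_def)
qed

lemma dc_ext_deriv:
  assumes f: "global_smooth f" and c: "c \<in> A" "p \<in> fst c"
  shows "ext_deriv1 (dc k f) c p u v = - 2 * k * form11 (ddbar c f p) u v"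
proof -
  note o = open_chart_range[OF c(1)] and f2 = global_smoothD[OF f c(1), of 2]
  let ?f = "\<lambda>z. f (chart_inv c z)"
  have pS: "snd c p \<in> snd c ` fst c" using c by blast
  have "dir_deriv c (\<lambda>q. dc k f c q w) p x = k * hess ?f (snd c p) x (\<i> *s w)" for w x
  proof -
    have "fderiv (\<lambda>z. dc k f c (chart_inv c z) w) (snd c p) = fderiv (\<lambda>z. k * fderiv ?f z (\<i> *s w)) (snd c p)"
      by (rule fderiv_cong[OF o pS]) (simp add: dc_def dir_deriv_def o_def chart_inv_right)
    also have "\<dots> = (\<lambda>x. k * hess ?f (snd c p) x (\<i> *s w))"
    proof -
      have "(\<lambda>z. fderiv ?f z (\<i> *s w)) differentiable (at (snd c p))"
        by (rule Ck_on_differentiable[OF Ck_on_fderiv[OF global_smoothD[OF f c(1)]] pS])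
      from has_derivative_imp_fderiv[OF has_derivative_mult_right[OF differentiable_fderiv[OF this]]]
      show ?thesis by (simp add: hess_def)
    qed
    finally show ?thesis by (simp add: dir_deriv_def o_def)
  qed
  then show ?thesis
    by (simp add: ext_deriv1_def ddbar_eq_levi form11_levi[OF f2 o pS] algebra_simps)
qed

text \<open>\<open>h c\<close> and \<open>vol c\<close> change by the same factor from chart to
  chart, so their quotient is a positive function on the manifold itself.\<close>

lemma metric_log_ratio:
  assumes h: "line_metric A K_dual h"
  obtains f where "global_smooth f" "\<And>c p. c \<in> A \<Longrightarrow> p \<in> fst c \<Longrightarrow> h c p = exp (- f p) * vol c p"
proof -
  have hpos: "h c p > 0" if "c \<in> A" "p \<in> fst c" for c p
    using line_metricD(1)[OF h, of c p] that by simp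
  have tr: "h d p = (cmod (inverse (det (jacobian c d p))))\<^sup>2 * h c p"
    if "c \<in> A" "d \<in> A" "p \<in> fst c" "p \<in> fst d" for c d p
    using line_metricD(3)[OF h, of c d p] that by simp
  \<comment> \<open>A function on the manifold cannot refer to a chart, so one is picked at each
    point; the quotient does not depend on the pick.\<close>
  define ch where "ch p = (SOME c. c \<in> A \<and> p \<in> fst c)" for p
  have ch: "ch p \<in> A" "p \<in> fst (ch p)" if "c \<in> A" "p \<in> fst c" for c p
    using someI[of "\<lambda>c. c \<in> A \<and> p \<in> fst c" c] that unfolding ch_def by auto
  define f where "f p = ln (vol (ch p) p) - ln (h (ch p) p)" for p
  have f: "f p = ln (vol c p) - ln (h c p)" if c: "c \<in> A" "p \<in> fst c" for c p
  proof -
    let ?d = "ch p"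
    note d = ch[OF c]
    have nz: "cmod (det (jacobian c ?d p)) > 0" using det_jacobian_nonzero[OF c(1) d(1) c(2) d(2)] by simp
    have "h ?d p / vol ?d p = h c p / vol c p"
      using tr[OF c(1) d(1) c(2) d(2), unfolded cmod_inverse_square] vol_transform[OF c(1) d(1) c(2) d(2)] nz
        vol_pos[OF c] vol_pos[OF d] by (simp add: field_simps)
    then have "ln (h ?d p / vol ?d p) = ln (h c p / vol c p)" by simp
    then show ?thesis
      using hpos[OF c] hpos[OF d] vol_pos[OF c] vol_pos[OF d] by (simp add: f_def ln_div)
  qed
  have "global_smooth f"
    unfolding global_smooth_def smooth_on_def
  proof (intro ballI allI)
    fix c k assume c: "c \<in> A"
    note o = open_chart_range[OF c]
    have "Ck_on k (\<lambda>z. ln (h c (chart_inv c z))) (snd c ` fst c)"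
      using line_metric_log[OF dual_bundle_holomorphic[OF canonical_bundle_holomorphic] h _ c, of c k] c
      by (simp add: chart_image_def)
    then have "Ck_on k (\<lambda>z. ln (vol c (chart_inv c z)) - ln (h c (chart_inv c z))) (snd c ` fst c)"
      by (rule Ck_on_diff[OF o log_vol_Ck[OF c]])
    then show "Ck_on k (\<lambda>z. f (chart_inv c z)) (snd c ` fst c)"
      by (rule iffD1[OF Ck_on_cong[OF o], rotated]) (simp add: f[OF c chart_inv_in])
  qed
  moreover have "h c p = exp (- f p) * vol c p" if "c \<in> A" "p \<in> fst c" for c p
    using hpos[OF that] vol_pos[OF that] by (simp add: f[OF that] exp_diff)
  ultimately show ?thesis by (rule that)
qed

lemma ricci_flat_curvature_exact:
  assumes ricci: "\<And>c p. c \<in> A \<Longrightarrow> p \<in> fst c \<Longrightarrow> ricci \<omega> c p = 0"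
    and h: "line_metric A K_dual h"
    and \<theta>: "is_curvature_form A K_dual h \<theta>"
  shows "cohomologous2 A (\<lambda>c p u v. \<theta> c p u v / (2 * pi)) (\<lambda>c p u v. 0)"
proof -
  obtain f where f: "global_smooth f" "\<And>c p. c \<in> A \<Longrightarrow> p \<in> fst c \<Longrightarrow> h c p = exp (- f p) * vol c p"
    using metric_log_ratio[OF h] by blast
  have curv: "\<theta> c p = form11 (ddbar c f p)" if c: "c \<in> A" "p \<in> fst c" for c p
  proof -
    note o = open_chart_range[OF c(1)]
    have pS: "snd c p \<in> snd c ` fst c" using c by blast
    have "Ck_on 2 (\<lambda>z. ln (h c (chart_inv c z))) (snd c ` fst c)"
      using line_metric_log[OF dual_bundle_holomorphic[OF canonical_bundle_holomorphic] h _ c(1), of c 2] c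
      by (simp add: chart_image_def)
    then have "levi (\<lambda>z. ln (h c (chart_inv c z))) (snd c p) =
        levi (\<lambda>z. ln (exp (- f (chart_inv c z)) * vol c (chart_inv c z))) (snd c p)"
      by (rule levi_cong[OF o pS, rotated]) (simp add: f(2)[OF c(1) chart_inv_in])
    then have "line_curvature h c c p = line_curvature (\<lambda>c p. exp (- f p) * vol c p) c c p"
      by (simp add: line_curvature_def ddbar_eq_levi)
    then have "line_curvature h c c p = ddbar c f p"
      using anticanonical_curvature[OF f(1) c] ricci[OF c] by simp
    moreover have "\<theta> c p = form11 (line_curvature h c c p)"
      using \<theta> c unfolding is_curvature_form_def by simp
    ultimately show ?thesis by simp
  qed
  show ?thesis
    unfolding cohomologous2_def
  proof (intro exI conjI ballI allI)
    show "smooth_form1 A (dc (- 1 / (4 * pi)) f)" by (rule dc_smooth[OF f(1)])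
    show "\<theta> c p u v / (2 * pi) - 0 = ext_deriv1 (dc (- 1 / (4 * pi)) f) c p u v" if "c \<in> A" "p \<in> fst c" for c p u v
      by (simp add: dc_ext_deriv[OF f(1) that] curv[OF that])
  qed
qed

text \<open>\<open>line_chern_class\<close> is a union over all metrics. Each one contributes the
  class of 0 by \<open>ricci_flat_curvature_exact\<close>, and the metric given by
  \<open>vol\<close> shows that the family of classes is not empty.\<close>

theorem ricci_flat_first_chern_class:
  assumes "\<And>c p. c \<in> A \<Longrightarrow> p \<in> fst c \<Longrightarrow> ricci \<omega> c p = 0"
  shows "first_chern_class A = deRham_class2 A (\<lambda>c p u v. 0)"
proof -
  let ?L = "K_dual"
  \<comment> \<open>The instance of \<open>anticanonical_metric\<close> for the zero function, left
    unsimplified to match it.\<close>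
  let ?h = "\<lambda>c p. exp (- 0) * vol c p"
  let ?\<theta> = "\<lambda>c p. form11 (line_curvature ?h c c p)"
  have hol: "holomorphic_line_bundle X A ?L"
    by (rule dual_bundle_holomorphic[OF canonical_bundle_holomorphic])
  have h: "line_metric A ?L ?h" by (rule anticanonical_metric[OF global_smooth_0])
  have \<theta>: "is_curvature_form A ?L ?h ?\<theta>"
    unfolding is_curvature_form_def
  proof (intro ballI)
    fix c i p assume "c \<in> A" "i \<in> lb_index ?L" "p \<in> fst c \<inter> lb_dom ?L i"
    then show "?\<theta> c p = form11 (line_curvature ?h i c p)"
      using line_curvature_frame[OF hol h, of i c c p] by simp
  qed
  have eq: "deRham_class2 A (\<lambda>c p u v. \<theta> c p u v / (2 * pi)) = deRham_class2 A (\<lambda>c p u v. 0)"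
    if "line_metric A ?L h" "is_curvature_form A ?L h \<theta>" for h \<theta>
    by (rule deRham_class2_eq[OF ricci_flat_curvature_exact[OF assms that]])
  have "{deRham_class2 A (\<lambda>c p u v. \<theta> c p u v / (2 * pi)) | h \<theta>. line_metric A ?L h \<and> is_curvature_form A ?L h \<theta>} =
      {deRham_class2 A (\<lambda>c p u v. 0)}" (is "?F = _")
  proof
    show "?F \<subseteq> {deRham_class2 A (\<lambda>c p u v. 0)}" using eq by blast
    have "deRham_class2 A (\<lambda>c p u v. ?\<theta> c p u v / (2 * pi)) \<in> ?F"
      using h \<theta> by (intro CollectI exI[of _ ?h] exI[of _ ?\<theta>] conjI refl)
    then show "{deRham_class2 A (\<lambda>c p u v. 0)} \<subseteq> ?F" using eq[OF h \<theta>] by simp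
  qed
  then show ?thesis by (simp add: first_chern_class_def line_chern_class_def)
qed

end

theorem corollary1p3:
  fixes X :: "'a topology"
    and A :: "('a, 'n::finite) chart set"
    and \<omega> :: "('a, 'n) metric"
  assumes "compact_kaehler_manifold X A"
    and "kaehler_metric A \<omega>"
    and "scalar_flat A \<omega>"
  shows "calabi_yau_manifold X A \<or>
         (RC_positive X A (canonical_bundle A) \<and>
          RC_positive X A (dual_bundle (canonical_bundle A)))"
proof -
  interpret hermitian_mfd X A \<omega>
    using assms(1,2) by unfold_locales (auto simp: compact_kaehler_manifold_def kaehler_metric_def)
  have cpt: "compact_space X" using assms(1) by (simp add: compact_kaehler_manifold_def)
  show ?thesis
  proof (cases "\<forall>c\<in>A. \<forall>p\<in>fst c. ricci \<omega> c p = 0")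
    case True
    then have "first_chern_class A = deRham_class2 A (\<lambda>c p u v. 0)"
      by (intro ricci_flat_first_chern_class) blast
    then show ?thesis using assms(1) by (simp add: calabi_yau_manifold_def)
  next
    case False
    then show ?thesis using scalar_flat_RC_positive[OF assms(3) cpt] by blast
  qed
qed

end
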